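(* Consider the Gaussian model: let $X_1,\ldots,X_{r+1}$ be i.i.d. standard Gaussian points in $\mathbb{R}^n$, $1\le r\le n$, let $\mathcal V_{n,r}$ be the $r$-dimensional volume of the simplex with these vertices, $\mathcal L_{n,r}=\log(r!\,\mathcal V_{n,r})$, and let $m_n=\frac12\big(n\log n-n+\frac12\log n+\log(2^{3/2}\pi)\big)$. If $r=r(n)$ is such that $n-r\to\infty$ as $n\to\infty$, then $$\lim_{n\to\infty}\frac{\mathbb{E}\exp\Big(t\big(\mathcal L_{n,r}-(m_n-m_{n-r})-\frac12\log\big(\frac{(r+1)(n-r)}{n}\big)\big)\Big)}{e^{\frac14t^2\log\frac n{n-r}}}=1.$$ If, additionally, $n-r=o(n)$, then we have mod-Gaussian convergence (meaning that $\eta(t)=\frac12t^2$) with parameters $w_n=\frac12\log\frac n{n-r}\to\infty$ and limiting function identically equal to $1$.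
   Context: Here $t$ is the argument of the moment generating function. Mod-$\phi$ convergence: random variables $Y_n$, with moment generating functions defined on some strip $S=\{t\in\mathbb{C}:c_-<\operatorname{Re}t<c_+\}$, converge in the mod-$\phi$ sense, where $\phi$ is an infinitely divisible distribution with $\int e^{tx}\phi(dx)=e^{\eta(t)}$, with parameters $w_n\to+\infty$ and limiting function $\psi$, if $\mathbb{E}e^{tY_n}/e^{w_n\eta(t)}\to\psi(t)$ locally uniformly on $S$, with $\psi$ analytic on $S$. In the claim, $Y_n=\mathcal L_{n,r}-(m_n-m_{n-r})-\frac12\log\big(\frac{(r+1)(n-r)}{n}\big)$. *)

theory Defs
  imports "HOL-Probability.Probability"
begin

(* The dimension n varies with the limit, so R^n is the set of extensional functions on
   {..<n}, i.e. PiE {..<n} (%_. UNIV), with measures built by PiM. *)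

definition borel_euclid :: "nat \<Rightarrow> (nat \<Rightarrow> real) measure" where
  "borel_euclid n = (\<Pi>\<^sub>M k\<in>{..<n}. borel)"

definition lebesgue_euclid :: "nat \<Rightarrow> (nat \<Rightarrow> real) measure" where
  "lebesgue_euclid n = (\<Pi>\<^sub>M k\<in>{..<n}. lborel)"

definition std_gaussian :: "real measure" where
  "std_gaussian = density lborel (\<lambda>x. ennreal (std_normal_density x))"

definition std_gaussian_euclid :: "nat \<Rightarrow> (nat \<Rightarrow> real) measure" where
  "std_gaussian_euclid n = (\<Pi>\<^sub>M k\<in>{..<n}. std_gaussian)"

definition simplex_hull :: "nat \<Rightarrow> 'i set \<Rightarrow> ('i \<Rightarrow> nat \<Rightarrow> real) \<Rightarrow> (nat \<Rightarrow> real) set" where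
  "simplex_hull n I x =
     {(\<lambda>k\<in>{..<n}. \<Sum>i\<in>I. c i * x i k) | c. (\<forall>i\<in>I. 0 \<le> c i) \<and> (\<Sum>i\<in>I. c i) = 1}"

definition orthonormal_family :: "nat \<Rightarrow> nat \<Rightarrow> (nat \<Rightarrow> nat \<Rightarrow> real) \<Rightarrow> bool" where
  "orthonormal_family n r u \<longleftrightarrow>
     (\<forall>i<r. \<forall>j<r. (\<Sum>k<n. u i k * u j k) = (if i = j then 1 else 0))"

(* Isometric parametrisation of the r-dimensional affine subspace p + span {u j | j < r}. *)
definition affine_chart ::
  "nat \<Rightarrow> nat \<Rightarrow> (nat \<Rightarrow> real) \<Rightarrow> (nat \<Rightarrow> nat \<Rightarrow> real) \<Rightarrow> (nat \<Rightarrow> real) \<Rightarrow> (nat \<Rightarrow> real)" where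
  "affine_chart n r p u a = (\<lambda>k\<in>{..<n}. p k + (\<Sum>j<r. a j * u j k))"

(* The r-dimensional volume of a subset A of an r-dimensional affine subspace of R^n:
   Lebesgue measure of A in Cartesian coordinates of such a subspace. The number does not
   depend on the coordinates chosen, nor on the subspace: if A lies in two different
   r-dimensional affine subspaces, it has volume 0 in both. *)
definition affine_volume :: "nat \<Rightarrow> nat \<Rightarrow> (nat \<Rightarrow> real) set \<Rightarrow> real" where
  "affine_volume n r A =
     (SOME v. \<exists>p u. orthonormal_family n r u
        \<and> A \<subseteq> affine_chart n r p u ` space (lebesgue_euclid r)
        \<and> v = measure (lebesgue_euclid r)
                {a \<in> space (lebesgue_euclid r). affine_chart n r p u a \<in> A})"

definition simplex_volume :: "nat \<Rightarrow> nat \<Rightarrow> (nat \<Rightarrow> nat \<Rightarrow> real) \<Rightarrow> real" where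
  "simplex_volume n r x = affine_volume n r (simplex_hull n {1..r+1} x)"

(* For a degenerate simplex this is ln 0 = 0 rather than -infinity; Gaussian simplices are
   almost surely non-degenerate. *)
definition log_volume :: "nat \<Rightarrow> nat \<Rightarrow> (nat \<Rightarrow> nat \<Rightarrow> real) \<Rightarrow> real" where
  "log_volume n r x = ln (fact r * simplex_volume n r x)"

definition m_seq :: "nat \<Rightarrow> real" where
  "m_seq n = 1/2 * (real n * ln (real n) - real n + 1/2 * ln (real n) + ln (2 powr (3/2) * pi))"

definition centred_log_volume :: "nat \<Rightarrow> nat \<Rightarrow> (nat \<Rightarrow> nat \<Rightarrow> real) \<Rightarrow> real" where
  "centred_log_volume n r x =
     log_volume n r x - (m_seq n - m_seq (n - r))
       - 1/2 * ln ((real r + 1) * real (n - r) / real n)"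

definition mgf_integrable :: "'a measure \<Rightarrow> ('a \<Rightarrow> real) \<Rightarrow> complex \<Rightarrow> bool" where
  "mgf_integrable M Y t \<longleftrightarrow> integrable M (\<lambda>\<omega>. exp (t * complex_of_real (Y \<omega>)))"

definition mgf :: "'a measure \<Rightarrow> ('a \<Rightarrow> real) \<Rightarrow> complex \<Rightarrow> complex" where
  "mgf M Y t = (LINT \<omega>|M. exp (t * complex_of_real (Y \<omega>)))"

definition infinitely_divisible :: "real measure \<Rightarrow> bool" where
  "infinitely_divisible \<phi> \<longleftrightarrow> real_distribution \<phi> \<and>
     (\<forall>k\<ge>1::nat. \<exists>\<nu>. real_distribution \<nu> \<and>
        distr (\<Pi>\<^sub>M i\<in>{..<k}. \<nu>) borel (\<lambda>x. \<Sum>i<k. x i) = \<phi>)"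

definition strip :: "ereal \<Rightarrow> ereal \<Rightarrow> complex set" where
  "strip a b = {t. a < ereal (Re t) \<and> ereal (Re t) < b}"

(* The strip may be unbounded on either side. Convergence concerns the tail of the sequence
   only, so Y n is required to have a moment generating function on the whole strip for all
   sufficiently large n. The last conjunct is locally uniform convergence on the strip. *)
definition mod_phi_convergent ::
  "(nat \<Rightarrow> 'a measure) \<Rightarrow> (nat \<Rightarrow> 'a \<Rightarrow> real) \<Rightarrow> real measure \<Rightarrow> (complex \<Rightarrow> complex)
     \<Rightarrow> (nat \<Rightarrow> real) \<Rightarrow> (complex \<Rightarrow> complex) \<Rightarrow> ereal \<Rightarrow> ereal \<Rightarrow> bool" where
  "mod_phi_convergent M Y \<phi> \<eta> w \<psi> a b \<longleftrightarrow>
     a < b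
     \<and> (\<forall>\<^sub>F n in sequentially. prob_space (M n) \<and> Y n \<in> borel_measurable (M n)
          \<and> (\<forall>t\<in>strip a b. mgf_integrable (M n) (Y n) t))
     \<and> infinitely_divisible \<phi>
     \<and> (\<forall>t\<in>strip a b. mgf_integrable \<phi> (\<lambda>x. x) t \<and> mgf \<phi> (\<lambda>x. x) t = exp (\<eta> t))
     \<and> filterlim w at_top sequentially
     \<and> \<psi> analytic_on strip a b
     \<and> (\<forall>s\<in>strip a b. \<exists>U. open U \<and> s \<in> U \<and> U \<subseteq> strip a b \<and>
          uniform_limit U (\<lambda>n t. mgf (M n) (Y n) t / exp (complex_of_real (w n) * \<eta> t))
            \<psi> sequentially)"

end

theory Submission
  imports Defs "Jordan_Normal_Form.Determinant"
begin

text \<open>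
  The \<open>r\<close>-volume of a simplex is \<open>sqrt (det Gram) / r!\<close>, where \<open>Gram\<close> is the Gram matrix of the
  edge vectors at one vertex. A rotation of the index space sends the all-ones vector to a multiple
  of a basis vector and turns the \<open>r + 1\<close> Gaussian vertices into independent Gaussian vectors, of which
  \<open>r\<close> span the edges; hence the determinant has the law of \<open>(r + 1) det Gram(Z_1, ..., Z_r)\<close> with
  independent Gaussian \<open>Z_i\<close>. Rotating \<open>R^n\<close> so that one of these vectors becomes a multiple of the last
  basis vector splits off an independent factor \<open>|Z|^2\<close> and lowers \<open>n\<close> and \<open>r\<close> by one, so the
  determinant is a product of independent chi-square variables with \<open>n - r + 1, ..., n\<close> degrees of
  freedom, whose complex moments are ratios of Gamma functions.

  In the logarithm of the moment of the \<open>k\<close>-th factor, \<open>t m_k + (t^2/4 - t/2) ln k\<close> is a discrete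
  antiderivative up to an error \<open>O(1/k^2)\<close>, uniformly for bounded \<open>t\<close>. Summing over
  \<open>n - r < k \<le> n\<close> leaves an error \<open>O(1/(n - r))\<close>, which tends to zero.
\<close>

section \<open>Lebesgue measure under affine maps\<close>

text \<open>The dimension grows with \<open>n\<close>, so everything takes place on product measures
  over \<open>{..<n}\<close>, and the change of variables for linear maps is built from
  one-coordinate updates. \<open>affine_volume\<close> is a choice over charts, so its value
  requires a chart for every simplex, degenerate or not, and agreement of all charts. The centring
  is dictated by the exact moments. The chi-square moment of order t/2 with k degrees of freedom is
  exp ((t/2) ln k + (t/2)(t/2 - 1)/k + O(1/k^2)). As m_k is half of Stirling's approximation to ln
  k! up to an additive constant, (t/2) ln k is t (m_k - m_(k-1)) up to O(1/k^2), and 1/k is ln k -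
  ln (k-1) up to O(1/k^2). Summation leaves t (m_n - m_(n-r)) + (t^2/4 - t/2) ln (n/(n-r)). The
  centring removes the first term and the part with -t/2, its r + 1 cancels the factor r + 1 of the
  determinant, and (t^2/4) ln (n/(n-r)) is the Gaussian exponent. Moments are obtained for Re t >
  -(n-r) - 1, so a strip bounded on the left eventually lies in this domain.\<close>

definition scales :: "nat \<Rightarrow> real \<Rightarrow> ((nat \<Rightarrow> real) \<Rightarrow> (nat \<Rightarrow> real)) \<Rightarrow> bool" where
  "scales n d f \<longleftrightarrow> d > 0 \<and> f \<in> measurable (lebesgue_euclid n) (lebesgue_euclid n)
     \<and> f ` space (lebesgue_euclid n) = space (lebesgue_euclid n)
     \<and> (\<forall>B\<in>sets (lebesgue_euclid n). f ` B \<in> sets (lebesgue_euclid n)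
          \<and> emeasure (lebesgue_euclid n) (f ` B) = ennreal d * emeasure (lebesgue_euclid n) B)"

lemma space_lebesgue_euclid: "space (lebesgue_euclid n) = PiE {..<n} (\<lambda>_. UNIV)"
  by (simp add: lebesgue_euclid_def space_PiM)

lemma measurable_lebesgue_euclid_component [simp]:
  "i < n \<Longrightarrow> (\<lambda>x. x i) \<in> borel_measurable (lebesgue_euclid n)"
  unfolding lebesgue_euclid_def
  using measurable_component_singleton[of i "{..<n}" "\<lambda>_. lborel"] by simp

lemma measurable_lebesgue_euclid:
  assumes "\<And>i. i < n \<Longrightarrow> (\<lambda>x. f x i) \<in> borel_measurable M"
  shows "(\<lambda>x. \<lambda>i\<in>{..<n}. f x i) \<in> measurable M (lebesgue_euclid n)"
  unfolding lebesgue_euclid_def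
  by (rule measurable_restrict) (use assms in simp)

lemma scales_cong:
  assumes "scales n d f" "d = e" "\<And>x. x \<in> space (lebesgue_euclid n) \<Longrightarrow> f x = g x"
  shows "scales n e g"
proof -
  have "f ` B = g ` B" if "B \<subseteq> space (lebesgue_euclid n)" for B
    using that assms(3) by (intro image_cong) auto
  moreover have "f \<in> measurable (lebesgue_euclid n) (lebesgue_euclid n) \<longleftrightarrow> g \<in> measurable (lebesgue_euclid n) (lebesgue_euclid n)"
    by (rule measurable_cong) (use assms(3) in simp)
  ultimately show ?thesis
    using assms(1) unfolding scales_def assms(2)[symmetric] by (metis sets.sets_into_space order_refl)
qed

lemma scales_comp:
  assumes f: "scales n a f" and g: "scales n b g"
  shows "scales n (a * b) (\<lambda>x. f (g x))"
proof -
  have im: "(\<lambda>x. f (g x)) ` B = f ` (g ` B)" for B by auto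
  show ?thesis
    using f g unfolding scales_def im
    by (auto simp: ennreal_mult mult.assoc intro: measurable_compose)
qed

text \<open>Fubini in the coordinate \<open>i\<close>: by \<open>inv\<close> the shift
  \<open>g\<close> is constant along each fibre, so there the map is y to c y + g, which scales
  length by |c|.\<close>

lemma emeasure_coordinate_update:
  assumes i: "i < n" and c: "c \<noteq> 0" and g: "g \<in> borel_measurable (lebesgue_euclid n)"
    and inv: "\<And>x y. g (x(i := y)) = g x" and B: "B \<in> sets (lebesgue_euclid n)"
  defines "f \<equiv> \<lambda>x. x(i := c * x i + g x)"
  shows "f \<in> measurable (lebesgue_euclid n) (lebesgue_euclid n)"
    "ennreal \<bar>c\<bar> * emeasure (lebesgue_euclid n) (f -` B \<inter> space (lebesgue_euclid n))
       = emeasure (lebesgue_euclid n) B"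
proof -
  let ?L = "lebesgue_euclid n"
  define J where "J = {..<n} - {i}"
  have nJ: "{..<n} = insert i J" and J: "finite J" "i \<notin> J" using i by (auto simp: J_def)
  have L: "?L = PiM (insert i J) (\<lambda>_. lborel)" by (simp add: lebesgue_euclid_def nJ)
  interpret product_sigma_finite "\<lambda>_. lborel :: real measure" by standard
  have fL: "f x = (\<lambda>k\<in>{..<n}. if k = i then c * x i + g x else x k)" if "x \<in> space ?L" for x
    using that i by (auto simp: f_def fun_eq_iff space_lebesgue_euclid PiE_def extensional_def)
  have fm': "(\<lambda>x. \<lambda>k\<in>{..<n}. if k = i then c * x i + g x else x k) \<in> measurable ?L ?L"
  proof (rule measurable_lebesgue_euclid)
    fix k assume "k < n"
    then show "(\<lambda>x. if k = i then c * x i + g x else x k) \<in> borel_measurable ?L"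
      using g i by (cases "k = i") (auto intro!: borel_measurable_add borel_measurable_times)
  qed
  show fm: "f \<in> measurable ?L ?L"
    using fm' fL by (subst measurable_cong) auto
  have Bm [measurable]: "B \<in> sets (PiM (insert i J) (\<lambda>_. lborel))" using B by (simp add: L)
  have fBm [measurable]: "f -` B \<inter> space ?L \<in> sets (PiM (insert i J) (\<lambda>_. lborel))"
    using measurable_sets[OF fm B] by (simp add: L)
  have upd: "x(i := y) \<in> space ?L" if "x \<in> space (PiM J (\<lambda>_. lborel :: real measure))" for x y
    using that by (auto simp: L space_PiM PiE_def extensional_def)
  have "emeasure ?L (f -` B \<inter> space ?L) = (\<integral>\<^sup>+x. indicator (f -` B \<inter> space ?L) x \<partial>?L)"
    using measurable_sets[OF fm B] by simp
  also have "\<dots> = (\<integral>\<^sup>+x. \<integral>\<^sup>+y. indicator (f -` B \<inter> space ?L) (x(i := y)) \<partial>lborel \<partial>PiM J (\<lambda>_. lborel))"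
    unfolding L[symmetric] by (subst L, subst product_nn_integral_insert[OF J]) (use measurable_sets[OF fm B] in \<open>auto simp: L[symmetric]\<close>)
  also have "\<dots> = (\<integral>\<^sup>+x. \<integral>\<^sup>+y. indicator B (x(i := g x + c * y)) \<partial>lborel \<partial>PiM J (\<lambda>_. lborel))"
    by (intro nn_integral_cong) (auto simp: f_def inv indicator_def upd add.commute)
  finally have 1: "emeasure ?L (f -` B \<inter> space ?L) = \<dots>" .
  have "emeasure ?L B = (\<integral>\<^sup>+x. indicator B x \<partial>?L)"
    using B by simp
  also have "\<dots> = (\<integral>\<^sup>+x. \<integral>\<^sup>+y. indicator B (x(i := y)) \<partial>lborel \<partial>PiM J (\<lambda>_. lborel))"
    unfolding L by (subst product_nn_integral_insert[OF J]) auto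
  also have "\<dots> = (\<integral>\<^sup>+x. ennreal \<bar>c\<bar> * (\<integral>\<^sup>+y. indicator B (x(i := g x + c * y)) \<partial>lborel) \<partial>PiM J (\<lambda>_. lborel))"
  proof (intro nn_integral_cong)
    fix x assume x: "x \<in> space (PiM J (\<lambda>_. lborel :: real measure))"
    have "(\<lambda>y. x(i := y)) \<in> measurable lborel (PiM (insert i J) (\<lambda>_. lborel))"
      using x J by (auto intro!: measurable_fun_upd[where J=J])
    then have "(\<lambda>y. indicator B (x(i := y)) :: ennreal) \<in> borel_measurable lborel"
      by (rule measurable_compose) (use Bm in simp)
    then show "(\<integral>\<^sup>+y. indicator B (x(i := y)) \<partial>lborel)
        = ennreal \<bar>c\<bar> * (\<integral>\<^sup>+y. indicator B (x(i := g x + c * y)) \<partial>lborel)"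
      using c by (subst nn_integral_real_affine[where c=c and t="g x"]) auto
  qed
  also have "\<dots> = ennreal \<bar>c\<bar> * (\<integral>\<^sup>+x. \<integral>\<^sup>+y. indicator B (x(i := g x + c * y)) \<partial>lborel \<partial>PiM J (\<lambda>_. lborel))"
  proof (rule nn_integral_cmult)
    have [measurable]: "(\<lambda>x. x(i := 0)) \<in> measurable (PiM J (\<lambda>_. lborel)) (PiM (insert i J) (\<lambda>_. lborel :: real measure))"
      by (rule measurable_fun_upd[where J=J]) auto
    have gm [measurable]: "g \<in> borel_measurable (PiM (insert i J) (\<lambda>_. lborel))" using g by (simp add: L)
    have [measurable]: "g \<in> borel_measurable (PiM J (\<lambda>_. lborel))"
      using measurable_compose[OF _ gm, of "\<lambda>x. x(i := 0)" "PiM J (\<lambda>_. lborel)"] by (simp add: inv)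
    have [measurable]: "(\<lambda>p. (fst p)(i := g (fst p) + c * snd p))
        \<in> measurable (PiM J (\<lambda>_. lborel) \<Otimes>\<^sub>M lborel) (PiM (insert i J) (\<lambda>_. lborel :: real measure))"
      by (rule measurable_fun_upd[where J=J]) auto
    have "(\<lambda>p. indicator B ((fst p)(i := g (fst p) + c * snd p)) :: ennreal)
        \<in> borel_measurable (PiM J (\<lambda>_. lborel) \<Otimes>\<^sub>M lborel)"
      by measurable
    then have "case_prod (\<lambda>x y. indicator B (x(i := g x + c * y)) :: ennreal)
        \<in> borel_measurable (PiM J (\<lambda>_. lborel) \<Otimes>\<^sub>M lborel)"
      by (simp add: case_prod_beta')
    then show "(\<lambda>x. \<integral>\<^sup>+y. indicator B (x(i := g x + c * y)) \<partial>lborel)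
        \<in> borel_measurable (PiM J (\<lambda>_. lborel))"
      by (rule lborel.borel_measurable_nn_integral)
  qed
  finally show "ennreal \<bar>c\<bar> * emeasure ?L (f -` B \<inter> space ?L) = emeasure ?L B"
    by (simp add: 1)
qed

text \<open>The inverse map is again a coordinate update, with 1/c and -g/c. Images under one are
  preimages under the other, so the preimage formula for the inverse yields the image
  formula.\<close>

lemma scales_coordinate_update:
  assumes i: "i < n" and c: "c \<noteq> 0" and g: "g \<in> borel_measurable (lebesgue_euclid n)"
    and inv: "\<And>x y. g (x(i := y)) = g x"
  shows "scales n \<bar>c\<bar> (\<lambda>x. x(i := c * x i + g x))"
proof -
  let ?L = "lebesgue_euclid n"
  let ?f = "\<lambda>x. x(i := c * x i + g x)"
  let ?h = "\<lambda>x. x(i := (1 / c) * x i + (- g x / c))"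
  have h: "?h \<in> measurable ?L ?L"
    and hB: "\<And>B. B \<in> sets ?L \<Longrightarrow> ennreal \<bar>1 / c\<bar> * emeasure ?L (?h -` B \<inter> space ?L) = emeasure ?L B"
    using emeasure_coordinate_update[of i n "1 / c" "\<lambda>x. - g x / c"] i c g inv by auto
  have fh: "?f (?h x) = x" "?h (?f x) = x" for x using c by (auto simp: inv field_simps)
  have sp: "x(i := y) \<in> space ?L" if "x \<in> space ?L" for x y
    using that i by (auto simp: space_lebesgue_euclid PiE_def extensional_def)
  have im: "?f ` B = ?h -` B \<inter> space ?L" if "B \<subseteq> space ?L" for B
  proof safe
    fix x assume "x \<in> B"
    then show "?f x \<in> ?h -` B" "?f x \<in> space ?L" using fh that sp by auto
  next
    fix x assume "?h x \<in> B"
    then have "?f (?h x) \<in> ?f ` B" by (rule imageI)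
    then show "x \<in> ?f ` B" by (simp only: fh(1))
  qed
  have em: "ennreal \<bar>c\<bar> * emeasure ?L B = emeasure ?L (?h -` B \<inter> space ?L)" if "B \<in> sets ?L" for B
    using c by (simp add: hB[OF that, symmetric] mult.assoc[symmetric] ennreal_mult[symmetric])
  have "?f \<in> measurable ?L ?L"
    using emeasure_coordinate_update(1)[OF i c g inv sets.empty_sets] .
  moreover have "?f ` space ?L = space ?L" using sp by (subst im) auto
  moreover have "?f ` B \<in> sets ?L \<and> emeasure ?L (?f ` B) = ennreal \<bar>c\<bar> * emeasure ?L B" if "B \<in> sets ?L" for B
    using im[OF sets.sets_into_space[OF that]] measurable_sets[OF h that] em[OF that]
    by simp
  ultimately show ?thesis
    using c unfolding scales_def by simp
qed

text \<open>Surjectivity, one of the clauses of \<open>scales\<close>, makes the image of the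
  preimage all of \<open>B\<close>; this returns to the preimages that \<open>distr\<close> speaks
  of.\<close>

lemma emeasure_vimage_scales:
  assumes "scales n d f" "B \<in> sets (lebesgue_euclid n)"
  shows "ennreal d * emeasure (lebesgue_euclid n) (f -` B \<inter> space (lebesgue_euclid n)) = emeasure (lebesgue_euclid n) B"
proof -
  let ?L = "lebesgue_euclid n"
  have *: "f -` B \<inter> space ?L \<in> sets ?L" using assms measurable_sets unfolding scales_def by blast
  have "f ` (f -` B \<inter> space ?L) = B"
  proof -
    have "B \<subseteq> f ` space ?L"
      using assms(1) sets.sets_into_space[OF assms(2)] by (simp add: scales_def)
    then show ?thesis by auto
  qed
  with * show ?thesis using assms unfolding scales_def by metis
qed

section \<open>Matrices as maps and a supply of rotations\<close>

definition matmap :: "nat \<Rightarrow> real Matrix.mat \<Rightarrow> (nat \<Rightarrow> real) \<Rightarrow> nat \<Rightarrow> real" where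
  "matmap n A x = (\<lambda>i\<in>{..<n}. \<Sum>k<n. A $$ (i, k) * x k)"

lemma matmap_mult:
  assumes "A \<in> carrier_mat n n" "B \<in> carrier_mat n n"
  shows "matmap n (A * B) x = matmap n A (matmap n B x)"
proof
  fix i
  show "matmap n (A * B) x i = matmap n A (matmap n B x) i"
  proof (cases "i < n")
    case True
    have "(\<Sum>k<n. (A * B) $$ (i, k) * x k) = (\<Sum>k<n. (\<Sum>j<n. A $$ (i, j) * B $$ (j, k)) * x k)"
      using assms True by (intro sum.cong) (auto simp: scalar_prod_def lessThan_atLeast0)
    also have "\<dots> = (\<Sum>j<n. A $$ (i, j) * (\<Sum>k<n. B $$ (j, k) * x k))"
      by (simp add: sum_distrib_left sum_distrib_right mult.assoc, subst sum.swap, simp)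
    finally show ?thesis using True by (simp add: matmap_def)
  qed (simp add: matmap_def)
qed

lemma matmap_one: "x \<in> space (lebesgue_euclid n) \<Longrightarrow> matmap n (1\<^sub>m n) x = x"
  by (auto simp: matmap_def space_lebesgue_euclid fun_eq_iff PiE_def extensional_def if_distrib[of "\<lambda>u. u * _"] cong: if_cong)

text \<open>The measure clauses hold for every orthogonal matrix, but this follows only from
  \<open>scales_affine\<close> below, whose proof relies on a supply of matrices satisfying them.\<close>

definition rotations :: "nat \<Rightarrow> real Matrix.mat set" where
  "rotations n = {Q. Q \<in> carrier_mat n n \<and> Q * Q\<^sup>T = 1\<^sub>m n \<and> Q\<^sup>T * Q = 1\<^sub>m n
     \<and> scales n 1 (matmap n Q) \<and> scales n 1 (matmap n Q\<^sup>T)}"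

lemma scales_id: "scales n 1 (\<lambda>x. x)"
  by (auto simp: scales_def)

lemma one_rotations: "1\<^sub>m n \<in> rotations n"
  using scales_cong[OF scales_id refl matmap_one[symmetric]] by (auto simp: rotations_def)

lemma mult_rotations:
  assumes "P \<in> rotations n" "Q \<in> rotations n"
  shows "P * Q \<in> rotations n"
proof -
  have c: "P \<in> carrier_mat n n" "Q \<in> carrier_mat n n" "P\<^sup>T \<in> carrier_mat n n" "Q\<^sup>T \<in> carrier_mat n n"
    using assms by (auto simp: rotations_def)
  have t: "(P * Q)\<^sup>T = Q\<^sup>T * P\<^sup>T" using c by (simp add: transpose_mult)
  have "(P * Q) * (Q\<^sup>T * P\<^sup>T) = P * (Q * Q\<^sup>T) * P\<^sup>T"
    using c by (smt (verit, ccfv_threshold) assoc_mult_mat mult_carrier_mat)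
  moreover have "(Q\<^sup>T * P\<^sup>T) * (P * Q) = Q\<^sup>T * (P\<^sup>T * P) * Q"
    using c by (smt (verit, ccfv_threshold) assoc_mult_mat mult_carrier_mat)
  moreover have "matmap n (P * Q) = (\<lambda>x. matmap n P (matmap n Q x))"
    "matmap n (Q\<^sup>T * P\<^sup>T) = (\<lambda>x. matmap n Q\<^sup>T (matmap n P\<^sup>T x))"
    using c by (auto simp: matmap_mult)
  ultimately show ?thesis
    using assms c scales_comp[of n 1 "matmap n P" 1 "matmap n Q"]
      scales_comp[of n 1 "matmap n Q\<^sup>T" 1 "matmap n P\<^sup>T"]
    unfolding rotations_def by (auto simp: t)
qed

definition givens :: "nat \<Rightarrow> nat \<Rightarrow> nat \<Rightarrow> real \<Rightarrow> real \<Rightarrow> real Matrix.mat" where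
  "givens n p l c s = Matrix.mat n n (\<lambda>(i, j).
     if i = p then (if j = p then c else 0) - (if j = l then s else 0)
     else if i = l then (if j = p then s else 0) + (if j = l then c else 0)
     else if j = i then 1 else 0)"

lemma transpose_givens: "p \<noteq> l \<Longrightarrow> (givens n p l c s)\<^sup>T = givens n p l c (- s)"
  by (rule eq_matI) (auto simp: givens_def)

lemma matmap_givens:
  assumes "p < n" "l < n" "p \<noteq> l" "x \<in> space (lebesgue_euclid n)"
  shows "matmap n (givens n p l c s) x = x(p := c * x p - s * x l, l := s * x p + c * x l)"
proof
  fix i
  show "matmap n (givens n p l c s) x i = (x(p := c * x p - s * x l, l := s * x p + c * x l)) i"
    using assms
    by (auto simp: matmap_def givens_def space_lebesgue_euclid PiE_def extensional_def algebra_simps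
        sum.distrib sum_subtractf if_distrib[of "\<lambda>u. u * _"] if_distrib[of "\<lambda>u. _ * u"] cong: if_cong)
qed

lemma givens_mult_transpose:
  assumes "p < n" "l < n" "p \<noteq> l" "c\<^sup>2 + s\<^sup>2 = 1"
  shows "givens n p l c s * givens n p l c (- s) = 1\<^sub>m n"
proof (rule eq_matI)
  fix i j assume "i < dim_row (1\<^sub>m n :: real mat)" "j < dim_col (1\<^sub>m n :: real mat)"
  then have ij: "i < n" "j < n" by auto
  have cs: "c * c + s * s = 1" "s * s + c * c = 1" using assms by (auto simp: power2_eq_square)
  have "(givens n p l c s * givens n p l c (- s)) $$ (i, j)
      = (\<Sum>k<n. givens n p l c s $$ (i, k) * givens n p l c (- s) $$ (k, j))"
    using ij by (simp add: scalar_prod_def givens_def lessThan_atLeast0)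
  also have "\<dots> = matmap n (givens n p l c s) (\<lambda>k\<in>{..<n}. givens n p l c (- s) $$ (k, j)) i"
    using ij by (simp add: matmap_def)
  also have "\<dots> = (1\<^sub>m n) $$ (i, j)"
    using assms ij cs
    by (subst matmap_givens) (auto simp: space_lebesgue_euclid givens_def)
  finally show "(givens n p l c s * givens n p l c (- s)) $$ (i, j) = (1\<^sub>m n) $$ (i, j)" .
qed (auto simp: givens_def)

text \<open>A planar rotation is a composition of coordinate updates (two shear-scalings if \<open>c \<noteq> 0\<close>,
  three shears for a quarter turn).\<close>

lemma scales_givens:
  assumes p: "p < n" "l < n" "p \<noteq> l" and cs: "c\<^sup>2 + s\<^sup>2 = 1"
  shows "scales n 1 (matmap n (givens n p l c s))"
proof -
  note upd = scales_coordinate_update[OF _ _ borel_measurable_times[OF borel_measurable_const]]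
  have *: "scales n 1 (\<lambda>x. x(p := c * x p - s * x l, l := s * x p + c * x l))"
  proof (cases "c = 0")
    case False
    have 1: "scales n \<bar>c\<bar> (\<lambda>x. x(p := c * x p + (- s) * x l))"
      by (rule upd) (use p False in auto)
    have 2: "scales n \<bar>1 / c\<bar> (\<lambda>x. x(l := (1 / c) * x l + (s / c) * x p))"
      by (rule upd) (use p False in auto)
    \<comment> \<open>The second update reads the coordinate \<open>p\<close> already changed by the
      first; 1 - s^2 = c^2 restores the rotation. The factors c and 1/c multiply to 1.\<close>
    have "x l / c + s * (c * x p - s * x l) / c = s * x p + c * x l" for x :: "nat \<Rightarrow> real"
    proof -
      have "x l + s * (c * x p - s * x l) = c * (s * x p) + (1 - s\<^sup>2) * x l"
        by (simp add: algebra_simps power2_eq_square)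
      also have "1 - s\<^sup>2 = c\<^sup>2" using cs by simp
      finally show ?thesis using False by (simp add: field_simps power2_eq_square)
    qed
    then show ?thesis
      using False p by (intro scales_cong[OF scales_comp[OF 2 1]]) (auto simp: fun_eq_iff abs_mult[symmetric])
  next
    case True
    then have s: "s * s = 1" using cs by (simp add: power2_eq_square)
    have 1: "scales n \<bar>1\<bar> (\<lambda>x. x(p := 1 * x p + (- s) * x l))"
      by (rule upd) (use p in auto)
    have 2: "scales n \<bar>1\<bar> (\<lambda>x. x(l := 1 * x l + s * x p))"
      by (rule upd) (use p in auto)
    have *: "s * (s * y) = y" for y using s by (simp add: mult.assoc[symmetric])
    \<comment> \<open>Here s is 1 or -1, and shearing in \<open>p\<close>, in \<open>l\<close> and
      in \<open>p\<close> again gives the quarter turn.\<close>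
    have "(\<lambda>x. x(p := c * x p - s * x l, l := s * x p + c * x l))
        = (\<lambda>x. (\<lambda>x. x(p := 1 * x p + (- s) * x l)) ((\<lambda>x. x(l := 1 * x l + s * x p)) ((\<lambda>x. x(p := 1 * x p + (- s) * x l)) x)))"
      using p True s by (auto simp: fun_eq_iff algebra_simps simp flip: mult.assoc)
    then show ?thesis
      using scales_comp[OF 1 scales_comp[OF 2 1]] by simp
  qed
  show ?thesis by (rule scales_cong[OF * refl]) (use p in \<open>simp add: matmap_givens\<close>)
qed

lemma givens_rotations:
  assumes "p < n" "l < n" "p \<noteq> l" "c\<^sup>2 + s\<^sup>2 = 1"
  shows "givens n p l c s \<in> rotations n"
  using assms givens_mult_transpose[of p n l c s] givens_mult_transpose[of p n l c "- s"]
  by (auto simp: rotations_def transpose_givens scales_givens) (auto simp: givens_def)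

text \<open>Turn the plane of \<open>p\<close> and \<open>l\<close> until the \<open>l\<close>
  component is absorbed into \<open>p\<close>. The last two properties guarantee that zeros made by
  earlier rotations survive.\<close>

lemma rotation_eliminates_one:
  assumes p: "p < n" "l < n" "p \<noteq> l" and v: "v \<in> space (lebesgue_euclid n)"
  obtains Q where "Q \<in> rotations n" "matmap n Q v l = 0"
    "\<And>w i. w \<in> space (lebesgue_euclid n) \<Longrightarrow> i \<noteq> p \<Longrightarrow> i \<noteq> l \<Longrightarrow> matmap n Q w i = w i"
    "\<And>w. w \<in> space (lebesgue_euclid n) \<Longrightarrow> w p = 0 \<Longrightarrow> w l = 0 \<Longrightarrow> matmap n Q w = w"
proof (cases "v l = 0")
  case True
  then show ?thesis using that[of "1\<^sub>m n"] one_rotations v by (auto simp: matmap_one)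
next
  case False
  define \<rho> where "\<rho> = sqrt ((v p)\<^sup>2 + (v l)\<^sup>2)"
  have r: "\<rho> \<noteq> 0" "\<rho>\<^sup>2 = (v p)\<^sup>2 + (v l)\<^sup>2" using False by (auto simp: \<rho>_def sum_power2_eq_zero_iff)
  let ?Q = "givens n p l (v p / \<rho>) (- v l / \<rho>)"
  have "(v p / \<rho>)\<^sup>2 + (- v l / \<rho>)\<^sup>2 = 1"
    unfolding power_divide power2_minus add_divide_distrib[symmetric] r(2)[symmetric] using r(1) by simp
  then have "?Q \<in> rotations n" using p by (intro givens_rotations)
  then show ?thesis using p v by (intro that[of ?Q]) (auto simp: matmap_givens)
qed

lemma matmap_space [simp]: "matmap n Q v \<in> space (lebesgue_euclid n)"
  by (auto simp: matmap_def space_lebesgue_euclid)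

text \<open>One rotation for each index of \<open>L\<close>, all with pivot \<open>p\<close>. The
  clause on fixed vectors is meant for work column by column: columns that already vanish on
  \<open>insert p L\<close> stay as they are.\<close>

lemma rotation_eliminates:
  assumes p: "p < n" and L: "finite L" "L \<subseteq> {..<n} - {p}" and v: "v \<in> space (lebesgue_euclid n)"
  shows "\<exists>Q\<in>rotations n. (\<forall>l\<in>L. matmap n Q v l = 0) \<and>
    (\<forall>w\<in>space (lebesgue_euclid n). (\<forall>i\<in>insert p L. w i = 0) \<longrightarrow> matmap n Q w = w)"
  using L
proof (induction L rule: finite_induct)
  case empty
  then show ?case using one_rotations by (auto simp: matmap_one intro!: bexI[of _ "1\<^sub>m n"])
next
  case (insert l L)
  then obtain Q where Q: "Q \<in> rotations n" "\<And>l. l \<in> L \<Longrightarrow> matmap n Q v l = 0"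
    "\<And>w. w \<in> space (lebesgue_euclid n) \<Longrightarrow> \<forall>i\<in>insert p L. w i = 0 \<Longrightarrow> matmap n Q w = w"
    by auto
  obtain G where G: "G \<in> rotations n" "matmap n G (matmap n Q v) l = 0"
    "\<And>w i. w \<in> space (lebesgue_euclid n) \<Longrightarrow> i \<noteq> p \<Longrightarrow> i \<noteq> l \<Longrightarrow> matmap n G w i = w i"
    "\<And>w. w \<in> space (lebesgue_euclid n) \<Longrightarrow> w p = 0 \<Longrightarrow> w l = 0 \<Longrightarrow> matmap n G w = w"
    by (rule rotation_eliminates_one[of p n l "matmap n Q v"]) (use p insert.prems in auto)
  have c: "matmap n (G * Q) = (\<lambda>x. matmap n G (matmap n Q x))"
    using G Q by (auto simp: matmap_mult rotations_def)
  show ?case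
  proof (intro bexI[of _ "G * Q"] conjI ballI impI)
    fix k assume "k \<in> insert l L"
    then show "matmap n (G * Q) v k = 0" using G(2) G(3)[of "matmap n Q v" k] Q(2) insert.prems c by (cases "k = l") auto
  next
    fix w assume "w \<in> space (lebesgue_euclid n)" "\<forall>i\<in>insert p (insert l L). w i = 0"
    then show "matmap n (G * Q) w = w" using G(4) Q(3)[of w] c by simp
  qed (use G Q in \<open>simp add: mult_rotations\<close>)
qed

text \<open>QR reduction: the rotation for column \<open>m\<close> clears the entries below its
  pivot and fixes every vector that vanishes at the indices from \<open>m\<close> on, as the earlier
  columns do.\<close>

lemma rotation_triangularizes:
  assumes v: "\<And>j. v j \<in> space (lebesgue_euclid n)" and "m \<le> n"
  shows "\<exists>Q\<in>rotations n. \<forall>j<m. \<forall>l. j < l \<and> l < n \<longrightarrow> matmap n Q (v j) l = 0"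
  using \<open>m \<le> n\<close>
proof (induction m)
  case 0
  then show ?case using one_rotations by auto
next
  case (Suc m)
  then obtain Q where Q: "Q \<in> rotations n" "\<And>j l. j < m \<Longrightarrow> j < l \<Longrightarrow> l < n \<Longrightarrow> matmap n Q (v j) l = 0"
    by auto
  obtain G where G: "G \<in> rotations n" "\<And>l. l \<in> {m<..<n} \<Longrightarrow> matmap n G (matmap n Q (v m)) l = 0"
    "\<And>w. w \<in> space (lebesgue_euclid n) \<Longrightarrow> \<forall>i\<in>insert m {m<..<n}. w i = 0 \<Longrightarrow> matmap n G w = w"
  proof -
    have "{m<..<n} \<subseteq> {..<n} - {m}" "m < n" using Suc.prems by auto
    then show ?thesis
      using rotation_eliminates[of m n "{m<..<n}" "matmap n Q (v m)"] that by (metis finite_greaterThanLessThan matmap_space)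
  qed
  have c: "matmap n (G * Q) = (\<lambda>x. matmap n G (matmap n Q x))"
    using G Q by (auto simp: matmap_mult rotations_def)
  have "matmap n G (matmap n Q (v j)) l = 0" if "j < Suc m" "j < l" "l < n" for j l
  proof (cases "j = m")
    case True then show ?thesis using G that by auto
  next
    case False
    then have "j < m" using that by simp
    then have "matmap n G (matmap n Q (v j)) = matmap n Q (v j)"
      using Q Suc.prems by (intro G) auto
    then show ?thesis using Q \<open>j < m\<close> that by simp
  qed
  then show ?case using mult_rotations[OF G(1) Q(1)] by (intro bexI[of _ "G * Q"]) (auto simp: c)
qed

text \<open>Overwrite the coordinates in increasing order. Row \<open>i\<close> involves only
  indices from \<open>i\<close> on, which still hold their old values, so each step is a coordinate
  update with factor \<open>R i i\<close>.\<close>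

lemma scales_upper_triangular:
  assumes tri: "\<And>i k. k < i \<Longrightarrow> i < n \<Longrightarrow> R i k = 0" and nz: "\<And>i. i < n \<Longrightarrow> R i i \<noteq> 0"
  shows "scales n (\<Prod>i<n. \<bar>R i i\<bar>) (\<lambda>x. \<lambda>i\<in>{..<n}. q i + (\<Sum>k<n. R i k * x k))"
proof -
  let ?L = "lebesgue_euclid n"
  have "scales n (\<Prod>i<m. \<bar>R i i\<bar>) (\<lambda>x. \<lambda>i\<in>{..<n}. if i < m then q i + (\<Sum>k<n. R i k * x k) else x i)"
    if "m \<le> n" for m
    using that
  proof (induction m)
    case 0
    show ?case
      by (rule scales_cong[OF scales_id])
        (auto simp: space_lebesgue_euclid PiE_def extensional_def fun_eq_iff)
  next
    case (Suc m)
    let ?g = "\<lambda>x. q m + (\<Sum>k\<in>{m<..<n}. R m k * x k)"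
    have u: "scales n \<bar>R m m\<bar> (\<lambda>x. x(m := R m m * x m + ?g x))"
    proof (rule scales_coordinate_update)
      show "?g \<in> borel_measurable ?L"
        by (intro borel_measurable_add borel_measurable_sum borel_measurable_times) auto
      show "?g (x(m := y)) = ?g x" for x y by (auto intro!: sum.cong)
    qed (use Suc.prems nz in auto)
    have sum: "(\<Sum>k<n. R m k * x k) = R m m * x m + (\<Sum>k\<in>{m<..<n}. R m k * x k)" for x
    proof -
      have "(\<Sum>k<n. R m k * x k) = (\<Sum>k\<in>insert m {m<..<n}. R m k * x k)"
        using Suc.prems tri by (intro sum.mono_neutral_right) (auto simp: not_less)
      then show ?thesis by simp
    qed
    have "scales n (\<bar>R m m\<bar> * (\<Prod>i<m. \<bar>R i i\<bar>)) (\<lambda>x. (\<lambda>x. x(m := R m m * x m + ?g x))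
        (\<lambda>i\<in>{..<n}. if i < m then q i + (\<Sum>k<n. R i k * x k) else x i))"
      by (rule scales_comp[OF u]) (use Suc in \<open>simp only: Suc_leD\<close>)
    then show ?case
    proof (rule scales_cong)
      show "(\<lambda>i\<in>{..<n}. if i < m then q i + (\<Sum>k<n. R i k * x k) else x i)
          (m := R m m * (\<lambda>i\<in>{..<n}. if i < m then q i + (\<Sum>k<n. R i k * x k) else x i) m
            + ?g (\<lambda>i\<in>{..<n}. if i < m then q i + (\<Sum>k<n. R i k * x k) else x i))
        = (\<lambda>i\<in>{..<n}. if i < Suc m then q i + (\<Sum>k<n. R i k * x k) else x i)" for x
        using Suc.prems by (auto simp: fun_eq_iff sum less_Suc_eq)
    qed (simp add: mult.commute)
  qed
  from this[of n] show ?thesis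
    by (rule scales_cong) (auto simp: fun_eq_iff)
qed

section \<open>Change of variables for affine maps\<close>

lemma orthogonal_imp_det:
  fixes Q :: "real Matrix.mat"
  assumes "Q \<in> carrier_mat n n" "Q * Q\<^sup>T = 1\<^sub>m n"
  shows "\<bar>Determinant.det Q\<bar> = 1"
proof -
  have "Determinant.det Q * Determinant.det Q = 1"
    using assms det_mult[of Q n "Q\<^sup>T"] det_transpose[of Q n] by simp
  then show ?thesis by (metis abs_1 abs_mult_self_eq abs_ge_zero abs_mult real_sqrt_abs2 real_sqrt_one)
qed

text \<open>QR decomposition: T is the product of Q^T, which preserves measure by membership in
  \<open>rotations\<close>, and a triangular R whose diagonal entries have product det T up to
  sign.\<close>

theorem scales_affine:
  assumes T: "T \<in> carrier_mat n n" and nz: "Determinant.det T \<noteq> 0"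
  shows "scales n \<bar>Determinant.det T\<bar> (\<lambda>x. \<lambda>i\<in>{..<n}. q i + matmap n T x i)"
proof -
  let ?v = "\<lambda>j. \<lambda>i\<in>{..<n}. T $$ (i, j)"
  obtain Q where Q: "Q \<in> rotations n" and tri: "\<And>j l. j < l \<Longrightarrow> l < n \<Longrightarrow> matmap n Q (?v j) l = 0"
    using rotation_triangularizes[of ?v n n] by (auto simp: space_lebesgue_euclid)
  have Qc: "Q \<in> carrier_mat n n" "Q\<^sup>T \<in> carrier_mat n n" "Q * Q\<^sup>T = 1\<^sub>m n" "Q\<^sup>T * Q = 1\<^sub>m n"
    using Q by (auto simp: rotations_def)
  define R where "R = Q * T"
  have R: "R \<in> carrier_mat n n" using Qc T by (simp add: R_def)
  have Rv: "R $$ (l, j) = matmap n Q (?v j) l" if "j < n" "l < n" for j l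
    using that Qc T by (auto simp: R_def matmap_def scalar_prod_def lessThan_atLeast0 intro!: sum.cong)
  have R0: "R $$ (l, j) = 0" if "j < l" "l < n" for j l using tri[OF that] Rv that by simp
  have QR: "Q\<^sup>T * R = T"
    using Qc T by (simp add: R_def assoc_mult_mat[symmetric, of _ n n _ n _ n])
  have detR: "Determinant.det R = (\<Prod>i<n. R $$ (i, i))"
    using det_upper_triangular[of R n] R R0
    by (auto simp: upper_triangular_def prod_list_diag_prod lessThan_atLeast0)
  have absdet: "\<bar>Determinant.det T\<bar> = \<bar>Determinant.det R\<bar>"
    using orthogonal_imp_det[OF Qc(1,3)] det_mult[OF Qc(1) T] by (simp add: R_def abs_mult)
  have Rnz: "R $$ (i, i) \<noteq> 0" if "i < n" for i
  proof
    assume "R $$ (i, i) = 0"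
    then have "(\<Prod>i<n. R $$ (i, i)) = 0" using that by (intro prod_zero) auto
    then have "Determinant.det R = 0" by (simp only: detR)
    then show False using nz absdet by simp
  qed
  \<comment> \<open>The shift is entered as Q q, so that the final application of Q^T turns it into
    q.\<close>
  have "scales n (\<Prod>i<n. \<bar>R $$ (i, i)\<bar>)
      (\<lambda>x. \<lambda>i\<in>{..<n}. matmap n Q q i + (\<Sum>k<n. R $$ (i, k) * x k))"
    by (rule scales_upper_triangular) (use R0 Rnz in auto)
  then have "scales n (1 * (\<Prod>i<n. \<bar>R $$ (i, i)\<bar>))
      (\<lambda>x. matmap n Q\<^sup>T (\<lambda>i\<in>{..<n}. matmap n Q q i + (\<Sum>k<n. R $$ (i, k) * x k)))"
    by (rule scales_comp[rotated]) (use Q in \<open>simp add: rotations_def\<close>)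
  moreover have "1 * (\<Prod>i<n. \<bar>R $$ (i, i)\<bar>) = \<bar>Determinant.det T\<bar>"
    by (simp add: absdet detR abs_prod)
  moreover have "matmap n Q\<^sup>T (\<lambda>i\<in>{..<n}. matmap n Q q i + (\<Sum>k<n. R $$ (i, k) * x k))
      = (\<lambda>i\<in>{..<n}. q i + matmap n T x i)" for x
  proof
    fix i
    have "matmap n T x i = matmap n Q\<^sup>T (matmap n R x) i" using QR matmap_mult[OF Qc(2) R] by metis
    moreover have "matmap n Q\<^sup>T (matmap n Q q) i = q i" if "i < n"
    proof -
      have "matmap n Q\<^sup>T (matmap n Q q) i = matmap n (1\<^sub>m n) q i" by (simp add: Qc flip: matmap_mult)
      then show ?thesis using that by (simp add: matmap_def if_distrib[of "\<lambda>u. u * _"] cong: if_cong)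
    qed
    moreover have "matmap n Q\<^sup>T (\<lambda>i\<in>{..<n}. matmap n Q q i + (\<Sum>k<n. R $$ (i, k) * x k)) i
        = matmap n Q\<^sup>T (matmap n Q q) i + matmap n Q\<^sup>T (matmap n R x) i" if "i < n"
      using that by (simp add: matmap_def distrib_left sum.distrib)
    ultimately show "matmap n Q\<^sup>T (\<lambda>i\<in>{..<n}. matmap n Q q i + (\<Sum>k<n. R $$ (i, k) * x k)) i
      = (\<lambda>i\<in>{..<n}. q i + matmap n T x i) i"
      by (cases "i < n") (auto simp: matmap_def)
  qed
  ultimately show ?thesis by simp
qed

section \<open>The volume of a simplex\<close>

lemma null_coordinate_hyperplane:
  assumes "l < n"
  shows "{y \<in> space (lebesgue_euclid n). y l = d} \<in> null_sets (lebesgue_euclid n)"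
proof -
  interpret product_sigma_finite "\<lambda>_. lborel :: real measure" by standard
  let ?A = "\<lambda>k. if k = l then {d} else UNIV :: real set"
  have eq: "{y \<in> space (lebesgue_euclid n). y l = d} = PiE {..<n} ?A"
  proof (intro Set.set_eqI iffI)
    fix y assume "y \<in> {y \<in> space (lebesgue_euclid n). y l = d}"
    then show "y \<in> PiE {..<n} ?A" by (simp add: space_lebesgue_euclid PiE_iff)
  next
    fix y assume y: "y \<in> PiE {..<n} ?A"
    have "y l \<in> ?A l" using PiE_mem[OF y, of l] assms by simp
    then show "y \<in> {y \<in> space (lebesgue_euclid n). y l = d}"
      using y by (simp add: space_lebesgue_euclid PiE_iff)
  qed
  have "emeasure (lebesgue_euclid n) (PiE {..<n} ?A) = (\<Prod>k<n. emeasure lborel (?A k))"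
    unfolding lebesgue_euclid_def by (rule emeasure_PiM) auto
  also have "\<dots> = 0" using assms by (intro prod_zero) auto
  finally show ?thesis
    unfolding eq null_sets_def by (auto simp: lebesgue_euclid_def intro!: sets_PiM_I_finite)
qed

text \<open>The shear that writes the linear form into coordinate \<open>l\<close> has the nonzero
  factor \<open>w l\<close> and pulls a coordinate hyperplane back to this one.\<close>

lemma null_hyperplane:
  assumes l: "l < n" "w l \<noteq> 0"
  shows "{y \<in> space (lebesgue_euclid n). (\<Sum>k<n. w k * y k) = d} \<in> null_sets (lebesgue_euclid n)"
proof -
  let ?L = "lebesgue_euclid n"
  let ?g = "\<lambda>y. \<Sum>k\<in>{..<n} - {l}. w k * y k"
  let ?f = "\<lambda>y. y(l := w l * y l + ?g y)"
  let ?H = "{y \<in> space ?L. y l = d}"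
  have f: "scales n \<bar>w l\<bar> ?f"
  proof (rule scales_coordinate_update)
    show "?g \<in> borel_measurable ?L"
      by (intro borel_measurable_sum borel_measurable_times) auto
    show "?g (y(l := z)) = ?g y" for y z by (intro sum.cong) auto
  qed (use l in auto)
  have "w l * y l + ?g y = (\<Sum>k<n. w k * y k)" for y
    using l by (subst (2) sum.remove[of _ l]) auto
  moreover have "y(l := z) \<in> space ?L" if "y \<in> space ?L" for y z
    using that l by (auto simp: space_lebesgue_euclid PiE_def extensional_def)
  ultimately have eq: "{y \<in> space ?L. (\<Sum>k<n. w k * y k) = d} = ?f -` ?H \<inter> space ?L"
    by auto
  have H: "?H \<in> sets ?L" "emeasure ?L ?H = 0"
    using null_coordinate_hyperplane[OF l(1)] by (auto simp: null_sets_def)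
  have "?f \<in> measurable ?L ?L" using f by (simp add: scales_def)
  moreover have "emeasure ?L (?f -` ?H \<inter> space ?L) = 0"
    using emeasure_vimage_scales[OF f H(1)] H(2) l by simp
  ultimately show ?thesis
    unfolding eq null_sets_def using measurable_sets[OF _ H(1)] by blast
qed

text \<open>\<open>measure\<close> is 0 on sets that are not measurable, so a degenerate hull can be
  treated without a measurability proof.\<close>

lemma measure_subset_null:
  assumes "A \<subseteq> N" "N \<in> null_sets M" shows "measure M A = 0"
proof (cases "A \<in> sets M")
  case True
  then show ?thesis using assms null_sets_subset[OF assms(2) True assms(1)] by (simp add: measure_eq_0_null_sets)
qed (simp add: measure_notin_sets)

text \<open>Vertices are numbered from 1 and edges from 0: edge \<open>j\<close> runs from vertex 1
  to vertex \<open>j + 2\<close>.\<close>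

lemma sum_vertices: "(\<Sum>i\<in>{1..r+1::nat}. f i) = f 1 + (\<Sum>j<r. f (j + 2) :: real)"
proof -
  have "(\<Sum>i\<in>{1..r+1}. f i) = (\<Sum>i<Suc r. f (Suc i))"
    by (rule sum.reindex_bij_witness[of _ Suc "\<lambda>i. i - 1"]) auto
  also have "\<dots> = f 1 + (\<Sum>j<r. f (j + 2))"
    by (subst sum.lessThan_Suc_shift) simp
  finally show ?thesis .
qed

text \<open>Eliminating the weight of vertex 1 presents the hull as the image of the standard
  simplex, of volume 1/r!, under y to a_1 + T y, where the columns of T are the edges. If T is
  singular, the image lies in a hyperplane.\<close>

lemma measure_simplex_hull:
  "measure (lebesgue_euclid r) (simplex_hull r {1..r+1} a)
    = \<bar>Determinant.det (Matrix.mat r r (\<lambda>(k, j). a (j + 2) k - a 1 k))\<bar> / fact r"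
proof -
  define T where "T = Matrix.mat r r (\<lambda>(k, j). a (j + 2) k - a 1 k)"
  let ?L = "lebesgue_euclid r"
  let ?f = "\<lambda>y. \<lambda>k\<in>{..<r}. a 1 k + matmap r T y k"
  let ?D = "{y. (\<forall>i\<in>{..<r}. 0 \<le> y i) \<and> sum y {..<r} \<le> 1} \<inter> space (PiM {..<r} (\<lambda>_. lborel))"
  have comb: "(\<lambda>k\<in>{..<r}. \<Sum>i\<in>{1..r+1}. c i * a i k)
     = ?f (\<lambda>j\<in>{..<r}. c (j + 2))" if "(\<Sum>i\<in>{1..r+1}. c i) = 1" for c
  proof
    fix k
    have c1: "c 1 = 1 - (\<Sum>j<r. c (j + 2))" using that unfolding sum_vertices by simp
    have "a 1 k + (\<Sum>j<r. (a (j + 2) k - a 1 k) * c (j + 2))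
        = (1 - (\<Sum>j<r. c (j + 2))) * a 1 k + (\<Sum>j<r. c (j + 2) * a (j + 2) k)"
      by (simp add: algebra_simps sum_subtractf sum_distrib_left)
    then show "(\<lambda>k\<in>{..<r}. \<Sum>i\<in>{1..r+1}. c i * a i k) k = ?f (\<lambda>j\<in>{..<r}. c (j + 2)) k"
      unfolding sum_vertices
      unfolding c1 by (simp add: matmap_def T_def)
  qed
  have im: "simplex_hull r {1..r+1} a = ?f ` ?D"
  proof safe
    fix z assume "z \<in> simplex_hull r {1..r+1} a"
    then obtain c where c: "\<forall>i\<in>{1..r+1}. 0 \<le> c i" "(\<Sum>i\<in>{1..r+1}. c i) = 1"
      and z: "z = (\<lambda>k\<in>{..<r}. \<Sum>i\<in>{1..r+1}. c i * a i k)"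
      unfolding simplex_hull_def by blast
    have "0 \<le> c 1" using c(1) by simp
    moreover have "c 1 + (\<Sum>j<r. c (j + 2)) = 1" using c(2) unfolding sum_vertices .
    ultimately have "(\<Sum>j<r. c (j + 2)) \<le> 1" by linarith
    then have "(\<lambda>j\<in>{..<r}. c (j + 2)) \<in> ?D"
      using c(1) by (auto simp: space_PiM)
    then show "z \<in> ?f ` ?D" unfolding z comb[OF c(2)] by (rule imageI)
  next
    fix y :: "nat \<Rightarrow> real" assume y: "\<forall>i\<in>{..<r}. 0 \<le> y i" "sum y {..<r} \<le> 1" "y \<in> space (PiM {..<r} (\<lambda>_. lborel))"
    \<comment> \<open>Vertex 1 receives the weight left over by the other vertices.\<close>
    define c where "c i = (if i = 1 then 1 - sum y {..<r} else y (i - 2))" for i :: nat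
    have c1: "(\<Sum>i\<in>{1..r+1}. c i) = 1" unfolding sum_vertices by (simp add: c_def)
    have "y = (\<lambda>j\<in>{..<r}. c (j + 2))"
      using y(3) by (auto simp: c_def space_PiM PiE_def extensional_def)
    then have "?f y = (\<lambda>k\<in>{..<r}. \<Sum>i\<in>{1..r+1}. c i * a i k)"
      using comb[OF c1] by simp
    moreover have "\<forall>i\<in>{1..r+1}. 0 \<le> c i" using y by (auto simp: c_def)
    ultimately show "?f y \<in> simplex_hull r {1..r+1} a"
      unfolding simplex_hull_def using c1 by blast
  qed
  have Tc: "T \<in> carrier_mat r r" by (simp add: T_def)
  have "measure ?L (simplex_hull r {1..r+1} a) = \<bar>Determinant.det T\<bar> / fact r"
  proof (cases "Determinant.det T = 0")
    case False
    have Dm: "?D \<in> sets ?L"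
    proof -
      have "(\<lambda>x. \<Sum>i<r. x i) \<in> borel_measurable ?L"
        by (intro borel_measurable_sum) auto
      then have "PiE {..<r} (\<lambda>_. {0..}) \<inter> ((\<lambda>x. \<Sum>i<r. x i) -` {..1} \<inter> space ?L) \<in> sets ?L"
        by (intro sets.Int measurable_sets[of _ ?L borel])
          (auto simp: lebesgue_euclid_def intro!: sets_PiM_I_finite)
      also have "PiE {..<r} (\<lambda>_. {0..}) \<inter> ((\<lambda>x. \<Sum>i<r. x i) -` {..1} \<inter> space ?L) = ?D"
        by (auto simp: space_PiM lebesgue_euclid_def)
      finally show ?thesis .
    qed
    have "emeasure ?L (?f ` ?D) = ennreal \<bar>Determinant.det T\<bar> * emeasure ?L ?D"
      using scales_affine[OF Tc False, of "a 1"] Dm unfolding scales_def by blast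
    also have "emeasure ?L ?D = ennreal (1 / fact r)"
      using emeasure_std_simplex_aux[of "{..<r}" 1] by (simp add: lebesgue_euclid_def)
    finally have "emeasure ?L (?f ` ?D) = ennreal (\<bar>Determinant.det T\<bar> / fact r)"
      by (simp only: ennreal_mult[symmetric] abs_ge_zero zero_le_divide_1_iff fact_ge_zero times_divide_eq_right mult_1_right)
    then show ?thesis
      unfolding im by (rule measure_eq_emeasure_eq_ennreal[rotated]) simp
  next
    case True
    then have "Determinant.det T\<^sup>T = 0" using det_transpose[OF Tc] by simp
    \<comment> \<open>A kernel vector of T^T is orthogonal to every edge, hence normal to a
      hyperplane that contains the hull.\<close>
    then obtain v where v: "v \<in> carrier_vec r" "v \<noteq> 0\<^sub>v r" "T\<^sup>T *\<^sub>v v = 0\<^sub>v r"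
      using det_0_iff_vec_prod_zero[of "T\<^sup>T" r] Tc by auto
    define w where "w = vec_index v"
    obtain l where l: "l < r" "w l \<noteq> 0"
      using v(1,2) by (metis carrier_vecD eq_vecI index_zero_vec w_def)
    have wT: "(\<Sum>k<r. w k * T $$ (k, j)) = 0" if "j < r" for j
    proof -
      have "vec_index (T\<^sup>T *\<^sub>v v) j = 0" using v(3) that by simp
      then show ?thesis
        using that v(1) Tc by (simp add: scalar_prod_def w_def lessThan_atLeast0 mult.commute)
    qed
    have "?f ` ?D \<subseteq> {y \<in> space ?L. (\<Sum>k<r. w k * y k) = (\<Sum>k<r. w k * a 1 k)}"
    proof safe
      fix y
      show "?f y \<in> space ?L" by (auto simp: space_lebesgue_euclid)
      have "(\<Sum>k<r. w k * ?f y k) = (\<Sum>k<r. w k * a 1 k) + (\<Sum>k<r. \<Sum>j<r. w k * T $$ (k, j) * y j)"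
        by (simp add: matmap_def distrib_left sum.distrib sum_distrib_left mult.assoc)
      also have "(\<Sum>k<r. \<Sum>j<r. w k * T $$ (k, j) * y j) = (\<Sum>j<r. (\<Sum>k<r. w k * T $$ (k, j)) * y j)"
        by (subst sum.swap) (simp add: sum_distrib_right)
      finally show "(\<Sum>k<r. w k * ?f y k) = (\<Sum>k<r. w k * a 1 k)" using wT by simp
    qed
    then have "measure ?L (?f ` ?D) = 0"
      by (rule measure_subset_null) (rule null_hyperplane[where w = w, OF l])
    then show ?thesis unfolding im using True by simp
  qed
  then show ?thesis by (simp only: T_def)
qed

section \<open>Isometric charts and independence of the volume from the chart\<close>

lemma orthonormal_coord:
  assumes u: "orthonormal_family n r u" and j: "j < r"
  shows "(\<Sum>k<n. (\<Sum>i<r. a i * u i k) * u j k) = a j"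
proof -
  have "(\<Sum>k<n. (\<Sum>i<r. a i * u i k) * u j k) = (\<Sum>i<r. a i * (\<Sum>k<n. u i k * u j k))"
    by (simp add: sum_distrib_right sum_distrib_left mult.assoc, subst sum.swap, simp)
  also have "\<dots> = (\<Sum>i<r. if i = j then a i else 0)"
    using u j by (intro sum.cong) (auto simp: orthonormal_family_def)
  finally show ?thesis using j by simp
qed

lemma orthonormal_inner:
  assumes u: "orthonormal_family n r u"
  shows "(\<Sum>k<n. (\<Sum>i<r. a i * u i k) * (\<Sum>i<r. b i * u i k)) = (\<Sum>i<r. a i * b i)"
proof -
  have "(\<Sum>k<n. (\<Sum>i<r. a i * u i k) * (\<Sum>i<r. b i * u i k))
      = (\<Sum>j<r. b j * (\<Sum>k<n. (\<Sum>i<r. a i * u i k) * u j k))"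
    by (subst (2) sum_distrib_left, subst sum_distrib_left, subst sum.swap) (simp add: mult_ac)
  then show ?thesis using orthonormal_coord[OF u] by (simp add: mult.commute)
qed

lemma affine_chart_inj:
  assumes u: "orthonormal_family n r u"
  shows "inj_on (affine_chart n r p u) (space (lebesgue_euclid r))"
proof (rule inj_onI)
  fix a b assume ab: "a \<in> space (lebesgue_euclid r)" "b \<in> space (lebesgue_euclid r)"
    and eq: "affine_chart n r p u a = affine_chart n r p u b"
  have "(\<Sum>i<r. a i * u i k) = (\<Sum>i<r. b i * u i k)" if "k < n" for k
    using fun_cong[OF eq, of k] that by (simp add: affine_chart_def)
  then have "a j = b j" if "j < r" for j
    using orthonormal_coord[OF u that, of a] orthonormal_coord[OF u that, of b] by simp
  moreover have "a \<in> PiE {..<r} (\<lambda>_. UNIV)" "b \<in> PiE {..<r} (\<lambda>_. UNIV)"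
    using ab by (simp_all only: space_lebesgue_euclid)
  ultimately show "a = b" by (intro PiE_ext) auto
qed

lemma affine_chart_convex_combination:
  assumes c: "(\<Sum>i\<in>I. c i) = 1"
    and x: "\<And>i k. i \<in> I \<Longrightarrow> k < n \<Longrightarrow> x i k = affine_chart n r p u (a i) k"
  shows "(\<lambda>k\<in>{..<n}. \<Sum>i\<in>I. c i * x i k) = affine_chart n r p u (\<lambda>j\<in>{..<r}. \<Sum>i\<in>I. c i * a i j)"
proof
  fix k
  have "(\<Sum>i\<in>I. c i * x i k) = p k + (\<Sum>j<r. (\<Sum>i\<in>I. c i * a i j) * u j k)" if "k < n"
  proof -
    have "(\<Sum>i\<in>I. c i * x i k) = (\<Sum>i\<in>I. c i * p k + (\<Sum>j<r. c i * a i j * u j k))"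
      using x that by (intro sum.cong) (auto simp: affine_chart_def algebra_simps sum_distrib_left)
    also have "\<dots> = (\<Sum>i\<in>I. c i) * p k + (\<Sum>i\<in>I. \<Sum>j<r. c i * a i j * u j k)"
      by (simp add: sum.distrib sum_distrib_right)
    also have "(\<Sum>i\<in>I. \<Sum>j<r. c i * a i j * u j k) = (\<Sum>j<r. (\<Sum>i\<in>I. c i * a i j) * u j k)"
      by (subst sum.swap) (simp add: sum_distrib_right)
    finally show ?thesis using c by simp
  qed
  then show "(\<lambda>k\<in>{..<n}. \<Sum>i\<in>I. c i * x i k) k = affine_chart n r p u (\<lambda>j\<in>{..<r}. \<Sum>i\<in>I. c i * a i j) k"
    by (simp add: affine_chart_def)
qed

lemma simplex_hull_affine_chart:
  assumes x: "\<And>i k. i \<in> I \<Longrightarrow> k < n \<Longrightarrow> x i k = affine_chart n r p u (a i) k"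
  shows "simplex_hull n I x = affine_chart n r p u ` simplex_hull r I a"
proof -
  have comb: "(\<lambda>k\<in>{..<n}. \<Sum>i\<in>I. c i * x i k) = affine_chart n r p u (\<lambda>j\<in>{..<r}. \<Sum>i\<in>I. c i * a i j)"
    if "(\<Sum>i\<in>I. c i) = 1" for c
    by (rule affine_chart_convex_combination[OF that x])
  show ?thesis
  proof (intro subset_antisym subsetI)
    fix z assume "z \<in> simplex_hull n I x"
    then obtain c where c: "\<forall>i\<in>I. 0 \<le> c i" "(\<Sum>i\<in>I. c i) = 1"
      and z: "z = (\<lambda>k\<in>{..<n}. \<Sum>i\<in>I. c i * x i k)"
      unfolding simplex_hull_def by (elim CollectE exE conjE)
    show "z \<in> affine_chart n r p u ` simplex_hull r I a"
      unfolding z comb[OF c(2)] simplex_hull_def by (intro imageI CollectI exI[of _ c] conjI refl c)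
  next
    fix z assume "z \<in> affine_chart n r p u ` simplex_hull r I a"
    then obtain c where c: "\<forall>i\<in>I. 0 \<le> c i" "(\<Sum>i\<in>I. c i) = 1"
      and z: "z = affine_chart n r p u (\<lambda>j\<in>{..<r}. \<Sum>i\<in>I. c i * a i j)"
      unfolding simplex_hull_def by (elim imageE CollectE exE conjE) simp
    show "z \<in> simplex_hull n I x"
      unfolding z comb[OF c(2), symmetric] simplex_hull_def by (intro CollectI exI[of _ c] conjI refl c)
  qed
qed

lemma simplex_hull_subset_space: "simplex_hull r I a \<subseteq> space (lebesgue_euclid r)"
proof
  fix z assume "z \<in> simplex_hull r I a"
  then obtain c where "z = (\<lambda>k\<in>{..<r}. \<Sum>i\<in>I. c i * a i k)"
    unfolding simplex_hull_def by (elim CollectE exE conjE)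
  then show "z \<in> space (lebesgue_euclid r)" by (simp add: space_lebesgue_euclid)
qed

lemma inj_on_Collect_image:
  assumes "inj_on f S" "H \<subseteq> S" shows "{b \<in> S. f b \<in> f ` H} = H"
  using assms unfolding inj_on_def by blast

definition gram_edges :: "nat \<Rightarrow> nat \<Rightarrow> (nat \<Rightarrow> nat \<Rightarrow> real) \<Rightarrow> real Matrix.mat" where
  "gram_edges n r x = Matrix.mat r r
     (\<lambda>(i, j). \<Sum>k<n. (x (i + 2) k - x 1 k) * (x (j + 2) k - x 1 k))"

lemma affine_volume_unique:
  assumes u: "orthonormal_family n r u"
    and sub: "simplex_hull n {1..r+1} x \<subseteq> affine_chart n r p u ` space (lebesgue_euclid r)"
  shows "measure (lebesgue_euclid r)
      {a \<in> space (lebesgue_euclid r). affine_chart n r p u a \<in> simplex_hull n {1..r+1} x}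
    = sqrt (Determinant.det (gram_edges n r x)) / fact r"
proof -
  let ?S = "space (lebesgue_euclid r)" and ?I = "{1..r+1}"
  have "\<exists>b\<in>?S. \<forall>k<n. x i k = affine_chart n r p u b k" if i: "i \<in> ?I" for i
  proof -
    \<comment> \<open>The convex combination with all its weight at \<open>i\<close> shows that
      vertex \<open>i\<close> belongs to the hull and so has chart coordinates.\<close>
    let ?c = "\<lambda>j. if j = i then 1 else 0 :: real"
    have "(\<Sum>j\<in>?I. ?c j) = 1" using i by (simp only: sum.delta finite_atLeastAtMost) simp
    moreover have "(\<Sum>j\<in>?I. ?c j * x j k) = x i k" for k
      using i by (simp only: if_distrib[of "\<lambda>u. u * _"] mult_1 mult_zero_left sum.delta finite_atLeastAtMost if_True cong: if_cong)
    ultimately have "(\<lambda>k\<in>{..<n}. x i k) \<in> simplex_hull n ?I x"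
      unfolding simplex_hull_def by (intro CollectI exI[of _ ?c]) auto
    then obtain b where "b \<in> ?S" and b: "(\<lambda>k\<in>{..<n}. x i k) = affine_chart n r p u b" using sub by blast
    moreover have "x i k = affine_chart n r p u b k" if "k < n" for k
      using fun_cong[OF b, of k] that by simp
    ultimately show ?thesis by blast
  qed
  then have "\<forall>i\<in>?I. \<exists>b. b \<in> ?S \<and> (\<forall>k<n. x i k = affine_chart n r p u b k)" by blast
  from bchoice[OF this] obtain a where "\<forall>i\<in>?I. a i \<in> ?S \<and> (\<forall>k<n. x i k = affine_chart n r p u (a i) k)" ..
  then have a: "\<And>i k. i \<in> ?I \<Longrightarrow> k < n \<Longrightarrow> x i k = affine_chart n r p u (a i) k"
    by blast
  have hull: "simplex_hull n ?I x = affine_chart n r p u ` simplex_hull r ?I a"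
    by (rule simplex_hull_affine_chart) (rule a)
  have "{b \<in> ?S. affine_chart n r p u b \<in> simplex_hull n ?I x} = simplex_hull r ?I a"
    unfolding hull
    by (rule inj_on_Collect_image[OF affine_chart_inj[OF u] simplex_hull_subset_space])
  moreover define T where "T = Matrix.mat r r (\<lambda>(k, j). a (j + 2) k - a 1 k)"
  ultimately have "measure (lebesgue_euclid r) {b \<in> ?S. affine_chart n r p u b \<in> simplex_hull n ?I x}
      = \<bar>Determinant.det T\<bar> / fact r"
    by (simp only: measure_simplex_hull)
  moreover have "gram_edges n r x = T\<^sup>T * T"
  proof (rule eq_matI)
    fix i j assume "i < dim_row (T\<^sup>T * T)" "j < dim_col (T\<^sup>T * T)"
    then have ij: "i < r" "j < r" by (auto simp: T_def)
    have edge: "x (i + 2) k - x 1 k = (\<Sum>l<r. (a (i + 2) l - a 1 l) * u l k)" if "k < n" "i < r" for i k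
      using a[of "i + 2" k] a[of 1 k] that
      by (simp add: affine_chart_def algebra_simps sum_subtractf)
    have "gram_edges n r x $$ (i, j) = (\<Sum>k<n. (x (i + 2) k - x 1 k) * (x (j + 2) k - x 1 k))"
      using ij by (simp add: gram_edges_def)
    also have "\<dots> = (\<Sum>k<n. (\<Sum>l<r. (a (i + 2) l - a 1 l) * u l k) * (\<Sum>l<r. (a (j + 2) l - a 1 l) * u l k))"
      by (intro sum.cong refl) (simp only: edge ij lessThan_iff)
    also have "\<dots> = (T\<^sup>T * T) $$ (i, j)"
      using ij by (subst orthonormal_inner[OF u]) (simp add: T_def scalar_prod_def lessThan_atLeast0)
    finally show "gram_edges n r x $$ (i, j) = (T\<^sup>T * T) $$ (i, j)" .
  qed (auto simp: gram_edges_def T_def)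
  moreover have "Determinant.det (T\<^sup>T * T) = (Determinant.det T)\<^sup>2"
    using det_mult[of "T\<^sup>T" r T] det_transpose[of T r] by (simp add: T_def power2_eq_square)
  ultimately show ?thesis by simp
qed

text \<open>Triangularizing the edges puts them into the span of the first \<open>r\<close> rows of
  Q, even when they are linearly dependent, so a degenerate simplex has a chart as well.\<close>

lemma simplex_hull_in_affine_chart:
  assumes "r \<le> n"
  shows "\<exists>p u. orthonormal_family n r u
    \<and> simplex_hull n {1..r+1} x \<subseteq> affine_chart n r p u ` space (lebesgue_euclid r)"
proof -
  let ?v = "\<lambda>j. \<lambda>k\<in>{..<n}. x (j + 2) k - x 1 k"
  have "?v j \<in> space (lebesgue_euclid n)" for j by (simp add: space_lebesgue_euclid)
  then obtain Q where Q: "Q \<in> rotations n" and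
    "\<forall>j<r. \<forall>l. j < l \<and> l < n \<longrightarrow> matmap n Q (?v j) l = 0"
    by (rule rotation_triangularizes[of ?v n r, OF _ assms, THEN bexE])
  then have tri: "\<And>j l. j < r \<Longrightarrow> j < l \<Longrightarrow> l < n \<Longrightarrow> matmap n Q (?v j) l = 0"
    by simp
  have Qc: "Q \<in> carrier_mat n n" "Q\<^sup>T \<in> carrier_mat n n" "Q * Q\<^sup>T = 1\<^sub>m n" "Q\<^sup>T * Q = 1\<^sub>m n"
    using Q by (auto simp: rotations_def)
  define u where "u i k = Q $$ (i, k)" for i k
  have orth: "(\<Sum>k<n. u i k * u j k) = (if i = j then 1 else 0)" if "i < n" "j < n" for i j
  proof -
    have "(\<Sum>k<n. u i k * u j k) = (Q * Q\<^sup>T) $$ (i, j)"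
      using that Qc(1) by (simp add: u_def scalar_prod_def lessThan_atLeast0)
    then show ?thesis using that by (simp add: Qc)
  qed
  have on: "orthonormal_family n r u" unfolding orthonormal_family_def using orth assms by auto
  define a where "a i = (if i = 1 then (\<lambda>_. 0) else matmap n Q (?v (i - 2)))" for i
  have chart: "x i k = affine_chart n r (x 1) u (a i) k" if "i \<in> {1..r+1}" "k < n" for i k
  proof (cases "i = 1")
    case False
    define j where "j = i - 2"
    have j: "i = j + 2" "j < r" using that False by (auto simp: j_def)
    have "?v j k = matmap n Q\<^sup>T (matmap n Q (?v j)) k"
      using matmap_mult[OF Qc(2,1), of "?v j"] matmap_one[of "?v j" n] Qc(4) by (simp add: space_lebesgue_euclid)
    also have "\<dots> = (\<Sum>l<n. matmap n Q (?v j) l * u l k)"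
      using that Qc by (subst matmap_def) (simp add: u_def mult.commute)
    also have "\<dots> = (\<Sum>l<r. matmap n Q (?v j) l * u l k)"
      using assms tri[OF j(2)] j(2) by (intro sum.mono_neutral_right) auto
    finally show ?thesis using that j by (simp add: affine_chart_def a_def)
  qed (use that in \<open>simp add: affine_chart_def a_def\<close>)
  have "simplex_hull n {1..r+1} x = affine_chart n r (x 1) u ` simplex_hull r {1..r+1} a"
    by (rule simplex_hull_affine_chart) (rule chart)
  with on simplex_hull_subset_space[of r "{1..r+1}" a] show ?thesis
    by (intro exI[of _ "x 1"] exI[of _ u]) (simp only: image_mono simp_thms)
qed

theorem simplex_volume_gram:
  assumes "r \<le> n"
  shows "simplex_volume n r x = sqrt (Determinant.det (gram_edges n r x)) / fact r"
proof -
  obtain p u where pu: "orthonormal_family n r u"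
    "simplex_hull n {1..r+1} x \<subseteq> affine_chart n r p u ` space (lebesgue_euclid r)"
    using simplex_hull_in_affine_chart[OF assms] by blast
  show ?thesis
    unfolding simplex_volume_def affine_volume_def
  proof (rule some_equality, intro exI conjI)
    fix v
    assume "\<exists>p u. orthonormal_family n r u
        \<and> simplex_hull n {1..r+1} x \<subseteq> affine_chart n r p u ` space (lebesgue_euclid r)
        \<and> v = measure (lebesgue_euclid r)
          {a \<in> space (lebesgue_euclid r). affine_chart n r p u a \<in> simplex_hull n {1..r+1} x}"
    then show "v = sqrt (Determinant.det (gram_edges n r x)) / fact r"
      by (elim exE conjE) (simp only: affine_volume_unique)
  qed (rule pu, rule pu, rule affine_volume_unique[OF pu, symmetric])
qed

text \<open>Read off from the volume: the quotient is a measure, hence nonnegative, and the real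
  \<open>sqrt\<close> is negative at negative arguments.\<close>

lemma det_gram_edges_nonneg:
  assumes "r \<le> n" shows "Determinant.det (gram_edges n r x) \<ge> 0"
proof -
  obtain p u where "orthonormal_family n r u"
    "simplex_hull n {1..r+1} x \<subseteq> affine_chart n r p u ` space (lebesgue_euclid r)"
    using simplex_hull_in_affine_chart[OF assms] by blast
  from affine_volume_unique[OF this, symmetric] have "sqrt (Determinant.det (gram_edges n r x)) / fact r \<ge> 0"
    by (simp only: measure_nonneg)
  then have "sqrt (Determinant.det (gram_edges n r x)) / fact r * fact r \<ge> 0"
    by (rule mult_nonneg_nonneg) simp
  then show ?thesis by simp
qed

text \<open>The factorials cancel. In the degenerate case both sides are 0 because
  \<open>ln 0 = 0\<close>.\<close>

lemma log_volume_gram: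
  assumes "r \<le> n"
  shows "log_volume n r x = 1/2 * ln (Determinant.det (gram_edges n r x))"
  using det_gram_edges_nonneg[OF assms, of x]
  by (cases "Determinant.det (gram_edges n r x) = 0")
    (auto simp: log_volume_def simplex_volume_gram[OF assms] ln_sqrt)

section \<open>Gram determinants of Gaussian vectors\<close>

lemma prob_space_std_gaussian: "prob_space std_gaussian"
  unfolding std_gaussian_def by (rule prob_space_normal_density) simp

interpretation std_gaussian: prob_space std_gaussian
  by (rule prob_space_std_gaussian)

lemma sets_std_gaussian [simp, measurable_cong]: "sets std_gaussian = sets borel"
  by (simp add: std_gaussian_def)

lemma space_std_gaussian [simp]: "space std_gaussian = UNIV"
  by (simp add: std_gaussian_def)

lemma prob_space_std_gaussian_euclid: "prob_space (std_gaussian_euclid n)"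
  unfolding std_gaussian_euclid_def by (rule prob_space_PiM) (rule prob_space_std_gaussian)

lemma sets_std_gaussian_euclid [simp, measurable_cong]: "sets (std_gaussian_euclid n) = sets (lebesgue_euclid n)"
  unfolding std_gaussian_euclid_def lebesgue_euclid_def by (rule sets_PiM_cong) auto

lemma sets_borel_euclid: "sets (borel_euclid n) = sets (lebesgue_euclid n)"
  unfolding borel_euclid_def lebesgue_euclid_def by (rule sets_PiM_cong) auto

lemma space_std_gaussian_euclid [simp]: "space (std_gaussian_euclid n) = space (lebesgue_euclid n)"
  by (rule sets_eq_imp_space_eq) simp

lemma std_gaussian_euclid_density:
  "std_gaussian_euclid n = density (lebesgue_euclid n) (\<lambda>x. ennreal (\<Prod>k<n. std_normal_density (x k)))"
proof -
  interpret product_prob_space "\<lambda>_. std_gaussian" by standard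
  interpret L: product_sigma_finite "\<lambda>_. lborel :: real measure" by standard
  let ?D = "density (lebesgue_euclid n) (\<lambda>x. ennreal (\<Prod>k<n. std_normal_density (x k)))"
  have m: "(\<lambda>x. ennreal (\<Prod>k<n. std_normal_density (x k))) \<in> borel_measurable (lebesgue_euclid n)"
    by (intro measurable_compose[OF _ measurable_ennreal] borel_measurable_prod
        measurable_compose[OF measurable_lebesgue_euclid_component borel_measurable_normal_density]) auto
  have "?D = PiM {..<n} (\<lambda>_. std_gaussian)"
  proof (rule PiM_eqI)
    fix A :: "nat \<Rightarrow> real set" assume A: "\<And>i. i \<in> {..<n} \<Longrightarrow> A i \<in> sets std_gaussian"
    have AL: "PiE {..<n} A \<in> sets (lebesgue_euclid n)"
      unfolding lebesgue_euclid_def using A by (intro sets_PiM_I_finite) auto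
    have "emeasure ?D (PiE {..<n} A)
        = (\<integral>\<^sup>+x. ennreal (\<Prod>k<n. std_normal_density (x k)) * indicator (PiE {..<n} A) x \<partial>lebesgue_euclid n)"
      by (rule emeasure_density[OF m AL])
    also have "\<dots> = (\<integral>\<^sup>+x. (\<Prod>k<n. ennreal (std_normal_density (x k)) * indicator (A k) (x k)) \<partial>lebesgue_euclid n)"
    proof (rule nn_integral_cong)
      fix x assume x: "x \<in> space (lebesgue_euclid n)"
      have "indicator (PiE {..<n} A) x = (\<Prod>k<n. indicator (A k) (x k) :: ennreal)"
      proof (cases "\<forall>k<n. x k \<in> A k")
        case True
        then show ?thesis using x by (simp add: space_lebesgue_euclid PiE_iff)
      next
        case False
        then obtain k where "k < n" "x k \<notin> A k" by blast
        then have "(\<Prod>k<n. indicator (A k) (x k) :: ennreal) = 0" by (intro prod_zero) (auto simp: indicator_def)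
        moreover have "x \<notin> PiE {..<n} A" using \<open>k < n\<close> \<open>x k \<notin> A k\<close> by auto
        ultimately show ?thesis by simp
      qed
      then show "ennreal (\<Prod>k<n. std_normal_density (x k)) * indicator (PiE {..<n} A) x
          = (\<Prod>k<n. ennreal (std_normal_density (x k)) * indicator (A k) (x k))"
        by (simp add: prod.distrib prod_ennreal)
    qed
    also have "\<dots> = (\<Prod>k<n. \<integral>\<^sup>+y. ennreal (std_normal_density y) * indicator (A k) y \<partial>lborel)"
      unfolding lebesgue_euclid_def using A by (intro L.product_nn_integral_prod) auto
    also have "\<dots> = (\<Prod>k<n. emeasure std_gaussian (A k))"
      using A by (intro prod.cong refl) (simp add: std_gaussian_def emeasure_density)
    finally show "emeasure ?D (PiE {..<n} A) = (\<Prod>i\<in>{..<n}. emeasure std_gaussian (A i))" .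
  next
    show "sets ?D = sets (PiM {..<n} (\<lambda>_. std_gaussian))"
      using sets_std_gaussian_euclid[of n] by (simp add: std_gaussian_euclid_def)
  qed simp
  then show ?thesis by (simp add: std_gaussian_euclid_def)
qed

lemma prod_std_normal_density:
  "(\<Prod>k<n. std_normal_density (x k)) = (1 / sqrt (2 * pi)) ^ n * exp (- (\<Sum>k<n. (x k)\<^sup>2) / 2)"
proof -
  have "(\<Prod>k<n. exp (- (x k)\<^sup>2 / 2)) = exp (\<Sum>k<n. - (x k)\<^sup>2 / 2)"
    by (simp only: exp_sum finite_lessThan)
  also have "(\<Sum>k<n. - (x k)\<^sup>2 / 2) = - (\<Sum>k<n. (x k)\<^sup>2) / 2"
    by (simp add: sum_negf flip: sum_divide_distrib)
  finally show ?thesis by (simp only: std_normal_density_def prod.distrib prod_constant card_lessThan)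
qed

lemma matmap_inner:
  assumes Q: "Q \<in> carrier_mat n n" "Q\<^sup>T * Q = 1\<^sub>m n"
  shows "(\<Sum>i<n. matmap n Q x i * matmap n Q y i) = (\<Sum>i<n. x i * y i)"
proof -
  have e: "(\<Sum>i<n. Q $$ (i, k) * Q $$ (i, l)) = (if k = l then 1 else 0)" if "k < n" "l < n" for k l
  proof -
    have "(\<Sum>i<n. Q $$ (i, k) * Q $$ (i, l)) = (Q\<^sup>T * Q) $$ (k, l)"
      using that Q(1) by (simp add: scalar_prod_def lessThan_atLeast0)
    then show ?thesis using that by (simp add: Q(2))
  qed
  have "(\<Sum>i<n. matmap n Q x i * matmap n Q y i)
      = (\<Sum>i<n. \<Sum>k<n. \<Sum>l<n. (x k * y l) * (Q $$ (i, k) * Q $$ (i, l)))"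
    by (simp add: matmap_def sum_product mult_ac)
  also have "\<dots> = (\<Sum>k<n. \<Sum>l<n. (x k * y l) * (\<Sum>i<n. Q $$ (i, k) * Q $$ (i, l)))"
    by (subst sum.swap, rule sum.cong[OF refl], subst sum.swap) (simp add: sum_distrib_left)
  also have "\<dots> = (\<Sum>k<n. \<Sum>l<n. if l = k then x k * y k else 0)"
    by (intro sum.cong refl) (simp add: e)
  finally show ?thesis by simp
qed

text \<open>Every orthogonal matrix has determinant 1 or -1, so \<open>scales_affine\<close> extends
  invariance from \<open>rotations\<close> to all of them.\<close>

lemma distr_lebesgue_orthogonal:
  assumes Q: "Q \<in> carrier_mat n n" "Q * Q\<^sup>T = 1\<^sub>m n"
  shows "matmap n Q \<in> measurable (lebesgue_euclid n) (lebesgue_euclid n)"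
    "distr (lebesgue_euclid n) (lebesgue_euclid n) (matmap n Q) = lebesgue_euclid n"
proof -
  have d: "\<bar>Determinant.det Q\<bar> = 1" using orthogonal_imp_det[OF Q] .
  have "(\<lambda>x. \<lambda>i\<in>{..<n}. 0 + matmap n Q x i) = matmap n Q"
    by (auto simp: matmap_def fun_eq_iff)
  then have s: "scales n 1 (matmap n Q)"
    using scales_affine[OF Q(1), of "\<lambda>_. 0"] d by fastforce
  then show m: "matmap n Q \<in> measurable (lebesgue_euclid n) (lebesgue_euclid n)" by (simp add: scales_def)
  show "distr (lebesgue_euclid n) (lebesgue_euclid n) (matmap n Q) = lebesgue_euclid n"
    using emeasure_vimage_scales[OF s] m by (intro measure_eqI) (auto simp: emeasure_distr)
qed

text \<open>Lebesgue measure is invariant, and the density depends on the norm only.\<close>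

lemma distr_std_gaussian_orthogonal:
  assumes Q: "Q \<in> carrier_mat n n" "Q * Q\<^sup>T = 1\<^sub>m n"
  shows "distr (std_gaussian_euclid n) (std_gaussian_euclid n) (matmap n Q) = std_gaussian_euclid n"
proof (rule measure_eqI)
  let ?L = "lebesgue_euclid n" and ?G = "std_gaussian_euclid n"
  let ?\<phi> = "\<lambda>x. ennreal (\<Prod>k<n. std_normal_density (x k))"
  have QT: "Q\<^sup>T * Q = 1\<^sub>m n" using mat_mult_left_right_inverse[OF Q(1) _ Q(2)] Q(1) by simp
  note m = distr_lebesgue_orthogonal(1)[OF Q]
  have phi: "?\<phi> \<in> borel_measurable ?L"
    by (intro measurable_compose[OF _ measurable_ennreal] borel_measurable_prod
        measurable_compose[OF measurable_lebesgue_euclid_component borel_measurable_normal_density]) auto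
  have inv: "?\<phi> (matmap n Q x) = ?\<phi> x" for x
    using matmap_inner[OF Q(1) QT, of x x] by (simp add: prod_std_normal_density power2_eq_square)
  fix B assume "B \<in> sets (distr ?G ?G (matmap n Q))"
  then have B: "B \<in> sets ?L" by simp
  have mB: "matmap n Q -` B \<inter> space ?L \<in> sets ?L" using measurable_sets[OF m B] .
  have "emeasure (distr ?G ?G (matmap n Q)) B = emeasure ?G (matmap n Q -` B \<inter> space ?L)"
    using m B by (subst emeasure_distr) (simp_all cong: measurable_cong_sets)
  also have "\<dots> = (\<integral>\<^sup>+x. ?\<phi> x * indicator (matmap n Q -` B \<inter> space ?L) x \<partial>?L)"
    unfolding std_gaussian_euclid_density by (rule emeasure_density[OF phi mB])
  also have "\<dots> = (\<integral>\<^sup>+x. ?\<phi> (matmap n Q x) * indicator B (matmap n Q x) \<partial>?L)"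
    by (intro nn_integral_cong) (auto simp: inv indicator_def)
  also have "\<dots> = (\<integral>\<^sup>+x. ?\<phi> x * indicator B x \<partial>distr ?L ?L (matmap n Q))"
    by (rule nn_integral_distr[symmetric, OF m]) (use phi B in \<open>auto intro!: borel_measurable_times_ennreal\<close>)
  also have "\<dots> = (\<integral>\<^sup>+x. ?\<phi> x * indicator B x \<partial>?L)"
    by (simp only: distr_lebesgue_orthogonal(2)[OF Q])
  also have "\<dots> = emeasure ?G B"
    unfolding std_gaussian_euclid_density by (rule emeasure_density[symmetric, OF phi B])
  finally show "emeasure (distr ?G ?G (matmap n Q)) B = emeasure ?G B" .
qed simp

section \<open>Arrays of independent Gaussian entries\<close>

lemma indep_vars_PiM_components:
  assumes A: "finite A" "A \<noteq> {}" and \<mu>: "prob_space \<mu>"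
  shows "prob_space.indep_vars (PiM A (\<lambda>_. \<mu>)) (\<lambda>_. \<mu>) (\<lambda>p \<omega>. \<omega> p) A"
proof -
  let ?P = "PiM A (\<lambda>_. \<mu>)"
  interpret P: prob_space ?P by (intro prob_space_PiM \<mu>)
  have comp: "distr ?P \<mu> (\<lambda>x. x p) = \<mu>" if "p \<in> A" for p
    by (rule distr_PiM_component) (use \<mu> that in auto)
  show ?thesis
  proof (subst P.indep_vars_iff_distr_eq_PiM')
    have "distr ?P ?P (\<lambda>x. \<lambda>i\<in>A. x i) = distr ?P ?P (\<lambda>x. x)"
      by (intro distr_cong refl) (auto simp: space_PiM PiE_def extensional_def fun_eq_iff)
    also have "\<dots> = PiM A (\<lambda>p. distr ?P \<mu> (\<lambda>x. x p))"
      by (subst distr_id2) (auto intro!: PiM_cong simp: comp)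
    finally show "distr ?P ?P (\<lambda>x. \<lambda>i\<in>A. x i) = PiM A (\<lambda>p. distr ?P \<mu> (\<lambda>x. x p))" .
  qed (use A in auto)
qed

text \<open>Sorting the independent entries by their first index gives independent blocks, each
  distributed as a product over \<open>K\<close>.\<close>

lemma distr_PiM_curry:
  fixes \<mu> :: "'b measure"
  assumes I: "finite I" "I \<noteq> {}" and K: "finite K" "K \<noteq> {}" and \<mu>: "prob_space \<mu>"
  shows "distr (PiM (I \<times> K) (\<lambda>_. \<mu>)) (PiM I (\<lambda>_. PiM K (\<lambda>_. \<mu>))) (\<lambda>\<omega>. \<lambda>i\<in>I. \<lambda>k\<in>K. \<omega> (i, k))
    = PiM I (\<lambda>_. PiM K (\<lambda>_. \<mu>))"
proof -
  let ?P = "PiM (I \<times> K) (\<lambda>_. \<mu>)"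
  interpret \<mu>: prob_space \<mu> by fact
  interpret P: prob_space ?P by (intro prob_space_PiM \<mu>)
  have "P.indep_vars (\<lambda>_. \<mu>) (\<lambda>p \<omega>. \<omega> p) (I \<times> K)"
    by (rule indep_vars_PiM_components) (use I K \<mu> in auto)
  then have "P.indep_vars (\<lambda>i. PiM ({i} \<times> K) (\<lambda>_. \<mu>)) (\<lambda>i \<omega>. \<lambda>p\<in>{i} \<times> K. \<omega> p) I"
    by (rule P.indep_vars_restrict) (auto simp: disjoint_family_on_def)
  then have "P.indep_vars (\<lambda>_. PiM K (\<lambda>_. \<mu>)) (\<lambda>i \<omega>. \<lambda>k\<in>K. (\<lambda>p\<in>{i} \<times> K. \<omega> p) (i, k)) I"
    by (rule P.indep_vars_compose2) (intro measurable_restrict, simp)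
  then have ind: "P.indep_vars (\<lambda>_. PiM K (\<lambda>_. \<mu>)) (\<lambda>i \<omega>. \<lambda>k\<in>K. \<omega> (i, k)) I"
    by (rule iffD1[OF P.indep_vars_cong, rotated -1]) (auto simp: fun_eq_iff)
  have "(\<lambda>\<omega>. \<lambda>k\<in>K. \<omega> (i, k)) \<in> measurable ?P (PiM K (\<lambda>_. \<mu>))" if "i \<in> I" for i
    using that by (auto intro!: measurable_restrict)
  moreover have "distr ?P (PiM K (\<lambda>_. \<mu>)) (\<lambda>\<omega>. \<lambda>k\<in>K. \<omega> (i, k)) = PiM K (\<lambda>_. \<mu>)" if "i \<in> I" for i
    by (rule distr_PiM_reindex) (use that \<mu> in \<open>auto simp: inj_on_def\<close>)
  ultimately show ?thesis
    using ind I by (subst (asm) P.indep_vars_iff_distr_eq_PiM') (auto cong: PiM_cong)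
qed

definition gauss_rows :: "nat \<Rightarrow> nat \<Rightarrow> (nat \<Rightarrow> nat \<Rightarrow> real) measure" where
  "gauss_rows r n = PiM {..<r} (\<lambda>_. std_gaussian_euclid n)"

lemma prob_space_gauss_rows: "prob_space (gauss_rows r n)"
  unfolding gauss_rows_def by (rule prob_space_PiM) (rule prob_space_std_gaussian_euclid)

lemma measurable_gauss_rows_row:
  "i < r \<Longrightarrow> (\<lambda>x. x i) \<in> measurable (gauss_rows r n) (std_gaussian_euclid n)"
  unfolding gauss_rows_def by (rule measurable_component_singleton) simp

lemma measurable_gauss_rows_entry [simp]:
  assumes "i < r" "k < n" shows "(\<lambda>x. x i k) \<in> borel_measurable (gauss_rows r n)"
proof -
  have "(\<lambda>x. x k) \<in> borel_measurable (std_gaussian_euclid n)"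
    using measurable_lebesgue_euclid_component[OF assms(2)] by (simp cong: measurable_cong_sets)
  from measurable_compose[OF measurable_gauss_rows_row[OF assms(1)] this] show ?thesis .
qed

lemma measurable_to_gauss_rows:
  assumes "\<And>i k. i < r \<Longrightarrow> k < n \<Longrightarrow> (\<lambda>x. f x i k) \<in> borel_measurable M"
  shows "(\<lambda>x. \<lambda>i\<in>{..<r}. \<lambda>k\<in>{..<n}. f x i k) \<in> measurable M (gauss_rows r n)"
  unfolding gauss_rows_def std_gaussian_euclid_def
  by (intro measurable_restrict) (use assms in \<open>simp cong: measurable_cong_sets\<close>)

text \<open>Both arrays are regroupings of a flat family indexed by pairs, and exchanging the two
  indices there is a reindexing of i.i.d. entries.\<close>

lemma distr_gauss_rows_transpose:
  assumes "0 < m" "0 < n"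
  shows "distr (gauss_rows m n) (gauss_rows n m) (\<lambda>x. \<lambda>k\<in>{..<n}. \<lambda>i\<in>{..<m}. x i k) = gauss_rows n m"
proof -
  let ?P = "PiM ({..<m} \<times> {..<n}) (\<lambda>_. std_gaussian)" and ?P' = "PiM ({..<n} \<times> {..<m}) (\<lambda>_. std_gaussian)"
  let ?R = "\<lambda>\<omega>. \<lambda>i\<in>{..<m}. \<lambda>k\<in>{..<n}. \<omega> (i, k)" and ?R' = "\<lambda>\<omega>. \<lambda>k\<in>{..<n}. \<lambda>i\<in>{..<m}. \<omega> (k, i)"
  let ?S = "\<lambda>\<omega>. \<lambda>p\<in>{..<n} \<times> {..<m}. \<omega> (snd p, fst p)"
  have R: "distr ?P (gauss_rows m n) ?R = gauss_rows m n"
    unfolding gauss_rows_def std_gaussian_euclid_def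
    by (rule distr_PiM_curry) (use assms prob_space_std_gaussian in auto)
  have R': "distr ?P' (gauss_rows n m) ?R' = gauss_rows n m"
    unfolding gauss_rows_def std_gaussian_euclid_def
    by (rule distr_PiM_curry) (use assms prob_space_std_gaussian in auto)
  have S: "distr ?P ?P' ?S = ?P'"
    by (rule distr_PiM_reindex[where f = "\<lambda>p. (snd p, fst p)"]) (auto simp: inj_on_def prob_space_std_gaussian)
  have entry: "(\<lambda>\<omega>. \<omega> p) \<in> borel_measurable (PiM A (\<lambda>_. std_gaussian))" if "p \<in> A"
    for p :: "nat \<times> nat" and A
    using measurable_component_singleton[of p A "\<lambda>_. std_gaussian"] that by (simp cong: measurable_cong_sets)
  have mR: "?R \<in> measurable ?P (gauss_rows m n)"
    by (intro measurable_to_gauss_rows entry) simp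
  have mR': "?R' \<in> measurable ?P' (gauss_rows n m)"
    by (intro measurable_to_gauss_rows entry) simp
  have mS: "?S \<in> measurable ?P ?P'"
    by (intro measurable_restrict) auto
  have mT: "(\<lambda>x. \<lambda>k\<in>{..<n}. \<lambda>i\<in>{..<m}. x i k) \<in> measurable (gauss_rows m n) (gauss_rows n m)"
    by (auto intro!: measurable_to_gauss_rows)
  have "distr (gauss_rows m n) (gauss_rows n m) (\<lambda>x. \<lambda>k\<in>{..<n}. \<lambda>i\<in>{..<m}. x i k)
      = distr (distr ?P (gauss_rows m n) ?R) (gauss_rows n m) (\<lambda>x. \<lambda>k\<in>{..<n}. \<lambda>i\<in>{..<m}. x i k)"
    by (simp only: R)
  also have "\<dots> = distr ?P (gauss_rows n m) ((\<lambda>x. \<lambda>k\<in>{..<n}. \<lambda>i\<in>{..<m}. x i k) \<circ> ?R)"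
    by (rule distr_distr[OF mT mR])
  also have "(\<lambda>x. \<lambda>k\<in>{..<n}. \<lambda>i\<in>{..<m}. x i k) \<circ> ?R = ?R' \<circ> ?S"
    by (auto simp: fun_eq_iff)
  also have "distr ?P (gauss_rows n m) (?R' \<circ> ?S) = distr (distr ?P ?P' ?S) (gauss_rows n m) ?R'"
    by (rule distr_distr[OF mR' mS, symmetric])
  finally show ?thesis by (simp only: S R')
qed

lemma distr_gauss_rows_compose:
  assumes Q: "Q \<in> carrier_mat n n" "Q * Q\<^sup>T = 1\<^sub>m n"
  shows "distr (gauss_rows m n) (gauss_rows m n) (compose {..<m} (matmap n Q)) = gauss_rows m n"
proof -
  have "matmap n Q \<in> measurable (std_gaussian_euclid n) (std_gaussian_euclid n)"
    using distr_lebesgue_orthogonal(1)[OF Q] by (simp cong: measurable_cong_sets)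
  then show ?thesis
    unfolding gauss_rows_def
    by (subst distr_PiM_finite_prob_space')
      (simp_all add: prob_space_std_gaussian_euclid distr_std_gaussian_orthogonal[OF Q])
qed

text \<open>After transposition, mixing the rows is the action of Q on each single vector of the
  array, where rotation invariance applies; a second transposition returns to the original
  layout.\<close>

lemma distr_gauss_rows_mix:
  assumes m: "0 < m" "0 < n" and Q: "Q \<in> carrier_mat m m" "Q * Q\<^sup>T = 1\<^sub>m m"
  shows "distr (gauss_rows m n) (gauss_rows m n)
     (\<lambda>x. \<lambda>i\<in>{..<m}. \<lambda>k\<in>{..<n}. \<Sum>j<m. Q $$ (i, j) * x j k) = gauss_rows m n"
proof -
  let ?T = "\<lambda>m n x. \<lambda>k\<in>{..<n}. \<lambda>i\<in>{..<m}. x i k :: real"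
  have mT: "?T m n \<in> measurable (gauss_rows m n) (gauss_rows n m)" for m n
    by (auto intro!: measurable_to_gauss_rows)
  have mC: "compose {..<n} (matmap m Q) \<in> measurable (gauss_rows n m) (gauss_rows n m)"
  proof -
    have "matmap m Q \<in> measurable (std_gaussian_euclid m) (std_gaussian_euclid m)"
      using distr_lebesgue_orthogonal(1)[OF Q] by (simp cong: measurable_cong_sets)
    then show ?thesis
      unfolding gauss_rows_def compose_def
      by (intro measurable_restrict) (auto intro: measurable_compose[OF measurable_component_singleton])
  qed
  have eq: "(\<lambda>x. \<lambda>i\<in>{..<m}. \<lambda>k\<in>{..<n}. \<Sum>j<m. Q $$ (i, j) * x j k)
      = ?T n m \<circ> (compose {..<n} (matmap m Q) \<circ> ?T m n)"
    by (auto simp: fun_eq_iff compose_def matmap_def)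
  have "distr (gauss_rows m n) (gauss_rows m n) (?T n m \<circ> (compose {..<n} (matmap m Q) \<circ> ?T m n))
      = distr (distr (distr (gauss_rows m n) (gauss_rows n m) (?T m n)) (gauss_rows n m) (compose {..<n} (matmap m Q)))
          (gauss_rows m n) (?T n m)"
    by (subst distr_distr[OF mC mT], rule distr_distr[symmetric, OF mT measurable_comp[OF mT mC]])
  also have "\<dots> = gauss_rows m n"
    by (simp only: distr_gauss_rows_transpose[OF m] distr_gauss_rows_compose[OF Q]
        distr_gauss_rows_transpose[OF m(2,1)])
  finally show ?thesis unfolding eq .
qed

section \<open>Determinant identities for Gram matrices\<close>

definition gram :: "nat \<Rightarrow> nat \<Rightarrow> (nat \<Rightarrow> nat \<Rightarrow> real) \<Rightarrow> real Matrix.mat" where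
  "gram n r z = Matrix.mat r r (\<lambda>(i, j). \<Sum>k<n. z i k * z j k)"

lemma gram_carrier [simp]: "gram n r z \<in> carrier_mat r r"
  by (simp add: gram_def)

lemma borel_measurable_det_mat:
  fixes a :: "'b \<Rightarrow> nat \<Rightarrow> nat \<Rightarrow> real"
  assumes "\<And>i j. i < r \<Longrightarrow> j < r \<Longrightarrow> (\<lambda>x. a x i j) \<in> borel_measurable M"
  shows "(\<lambda>x. Determinant.det (Matrix.mat r r (\<lambda>(i, j). a x i j))) \<in> borel_measurable M"
proof -
  have "Determinant.det (Matrix.mat r r (\<lambda>(i, j). a x i j))
     = (\<Sum>p\<in>{p. p permutes {0..<r}}. signof p * (\<Prod>i=0..<r. a x i (p i)))" for x
    by (subst det_def'[of _ r]) (auto intro!: sum.cong prod.cong dest: permutes_in_image)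
  moreover have "(\<lambda>x. \<Sum>p\<in>{p. p permutes {0..<r}}. signof p * (\<Prod>i=0..<r. a x i (p i))) \<in> borel_measurable M"
  proof (intro borel_measurable_sum borel_measurable_times borel_measurable_const borel_measurable_prod)
    fix p i assume "p \<in> {p. p permutes {0..<r}}" "i \<in> {0..<r}"
    then show "(\<lambda>x. a x i (p i)) \<in> borel_measurable M"
      using assms permutes_in_image[of p "{0..<r}" i] by auto
  qed
  ultimately show ?thesis by simp
qed

text \<open>Sylvester's identity: the two products of \<open>?A\<close> and \<open>?M\<close> are
  block triangular, with determinants det (I + u w) and 1 + w u.\<close>

lemma det_one_plus_ones:
  "Determinant.det (Matrix.mat r r (\<lambda>(i, j). (if i = j then 1 else 0) + 1)) = real r + 1"
proof -
  let ?u = "Matrix.mat r 1 (\<lambda>_. 1 :: real)" and ?w = "Matrix.mat 1 r (\<lambda>_. 1 :: real)"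
  let ?E = "1\<^sub>m r :: real Matrix.mat" and ?o = "1\<^sub>m 1 :: real Matrix.mat"
  let ?M = "four_block_mat ?E (- ?u) ?w ?o" and ?A = "four_block_mat ?E ?u (0\<^sub>m 1 r) ?o"
  have AM: "?A * ?M = four_block_mat (Matrix.mat r r (\<lambda>(i, j). (if i = j then 1 else 0) + 1)) (0\<^sub>m r 1) ?w ?o"
    by (subst mult_four_block_mat[of _ r r _ 1 _ 1 _ _ r _ 1])
      (auto intro!: cong_four_block_mat eq_matI simp: scalar_prod_def)
  have MA: "?M * ?A = four_block_mat ?E (0\<^sub>m r 1) ?w (Matrix.mat 1 1 (\<lambda>_. real r + 1))"
    by (subst mult_four_block_mat[of _ r r _ 1 _ 1 _ _ r _ 1])
      (auto intro!: cong_four_block_mat eq_matI simp: scalar_prod_def)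
  have c: "?A \<in> carrier_mat (r + 1) (r + 1)" "?M \<in> carrier_mat (r + 1) (r + 1)"
    by (auto intro!: four_block_carrier_mat)
  have "Determinant.det (?A * ?M) = Determinant.det (?M * ?A)"
    using det_mult[OF c] det_mult[OF c(2,1)] by simp
  then show ?thesis
    unfolding AM MA
    by (subst (asm) (1 2) det_four_block_mat_upper_right_zero[of _ r _ 1])
      (auto simp: det_single)
qed

text \<open>The Gram matrix is a product of two block triangular matrices; the last coordinates of
  the other rows stay in their off-diagonal blocks.\<close>

lemma det_gram_peel:
  assumes z: "\<And>k. k < n \<Longrightarrow> z r k = 0"
  shows "Determinant.det (gram (Suc n) (Suc r) z) = (z r n)\<^sup>2 * Determinant.det (gram n r z)"
proof -
  let ?c = "Matrix.mat r 1 (\<lambda>(i, _). z i n)" and ?d = "Matrix.mat 1 r (\<lambda>(_, i). z i n)"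
  let ?l = "Matrix.mat 1 1 (\<lambda>_. z r n)"
  let ?N = "four_block_mat (gram n r z) ?c (0\<^sub>m 1 r) ?l" and ?K = "four_block_mat (1\<^sub>m r) (0\<^sub>m r 1) ?d ?l"
  have c: "?N \<in> carrier_mat (r + 1) (r + 1)" "?K \<in> carrier_mat (r + 1) (r + 1)"
    by (rule four_block_carrier_mat; simp)+
  have "?N * ?K = gram (Suc n) (Suc r) z"
    by (subst mult_four_block_mat[of _ r r _ 1 _ 1 _ _ r _ 1], simp_all,
        unfold right_mult_one_mat[OF gram_carrier] right_mult_zero_mat[OF gram_carrier], rule eq_matI)
      (auto simp: gram_def scalar_prod_def z less_Suc_eq not_less)
  then have "Determinant.det (gram (Suc n) (Suc r) z) = Determinant.det ?N * Determinant.det ?K"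
    using det_mult[OF c] by simp
  also have "Determinant.det ?N = Determinant.det (gram n r z) * z r n"
    by (subst det_four_block_mat_lower_left_zero[of _ r _ 1]) (auto simp: det_single)
  also have "Determinant.det ?K = z r n"
    by (subst det_four_block_mat_upper_right_zero[of _ r _ 1]) (auto simp: det_single)
  finally show ?thesis by (simp add: power2_eq_square)
qed

lemma mult_mat_entry:
  fixes A :: "real Matrix.mat"
  assumes "A \<in> carrier_mat n m" "B \<in> carrier_mat m p" "i < n" "j < p"
  shows "(A * B) $$ (i, j) = (\<Sum>k<m. A $$ (i, k) * B $$ (k, j))"
  using assms by (simp add: scalar_prod_def lessThan_atLeast0)

text \<open>Rotating the index space so that the all-ones vector becomes a multiple of the last basis
  vector turns the \<open>r + 1\<close> vertices into \<open>r\<close> vectors spanning the edges and one centroid.\<close>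

lemma gram_edges_orthogonal:
  obtains Q where "Q \<in> carrier_mat (Suc r) (Suc r)" "Q * Q\<^sup>T = 1\<^sub>m (Suc r)"
    "\<And>n x. Determinant.det (gram_edges n r x)
       = (real r + 1) * Determinant.det (gram n r (\<lambda>i k. \<Sum>j<Suc r. Q $$ (i, j) * x (Suc j) k))"
proof -
  let ?m = "Suc r"
  let ?v = "\<lambda>i\<in>{..<?m}. 1 :: real"
  have v: "?v \<in> space (lebesgue_euclid ?m)" by (simp add: space_lebesgue_euclid)
  have "{..<r} \<subseteq> {..<?m} - {r}" by auto
  from rotation_eliminates[OF lessI finite_lessThan this v] obtain Q
    where Q: "Q \<in> rotations ?m" and Q0: "\<And>l. l < r \<Longrightarrow> matmap ?m Q ?v l = 0" by auto
  have Qc: "Q \<in> carrier_mat ?m ?m" "Q\<^sup>T \<in> carrier_mat ?m ?m" "Q * Q\<^sup>T = 1\<^sub>m ?m" "Q\<^sup>T * Q = 1\<^sub>m ?m"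
    using Q by (auto simp: rotations_def)
  have Qback: "(\<Sum>l<?m. Q $$ (l, j) * (\<Sum>i<?m. Q $$ (l, i) * y i)) = y j" if "j < ?m" for y :: "nat \<Rightarrow> real" and j
  proof -
    have "matmap ?m Q\<^sup>T (matmap ?m Q y) j = matmap ?m (1\<^sub>m ?m) y j"
      by (simp only: matmap_mult[OF Qc(2,1), symmetric] Qc(4))
    also have "matmap ?m Q\<^sup>T (matmap ?m Q y) j = (\<Sum>l<?m. Q $$ (l, j) * (\<Sum>i<?m. Q $$ (l, i) * y i))"
      using that Qc(1) by (simp add: matmap_def del: sum.lessThan_Suc)
    also have "matmap ?m (1\<^sub>m ?m) y j = y j"
      using that by (simp add: matmap_def if_distrib[of "\<lambda>u. u * _"] del: sum.lessThan_Suc cong: if_cong)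
    finally show ?thesis .
  qed
  \<comment> \<open>Q maps the all-ones vector to \<alpha> times the last basis vector. Mapping back
    shows that every entry of the last row times \<alpha> is 1, so the last row is constant.\<close>
  define \<alpha> where "\<alpha> = (\<Sum>i<?m. Q $$ (r, i))"
  have al: "Q $$ (r, j) * \<alpha> = 1" if "j < ?m" for j
  proof -
    have "(\<Sum>i<?m. Q $$ (l, i)) = 0" if "l < r" for l
      using Q0[OF that] that by (simp add: matmap_def del: sum.lessThan_Suc)
    then have "(\<Sum>l<?m. Q $$ (l, j) * (\<Sum>i<?m. Q $$ (l, i) * 1)) = Q $$ (r, j) * \<alpha>"
      by (subst sum.lessThan_Suc) (simp add: \<alpha>_def del: sum.lessThan_Suc)
    then show ?thesis using Qback[OF that, of "\<lambda>_. 1"] by simp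
  qed
  have Qr: "Q $$ (r, i) = Q $$ (r, j)" if "i < ?m" "j < ?m" for i j
    using al[OF that(1)] al[OF that(2)] by (metis mult_cancel_right mult_zero_right zero_neq_one)
  \<comment> \<open>Edges are differences of vertices, so the constant last row of Q cancels and
    they are combinations of the first \<open>r\<close> mixed vectors, with coefficients C. Row
    \<open>i\<close> of C holds the first \<open>r\<close> coordinates of Q (e_(i+1) - e_0), whose
    last one is 0; this is why C C^T is I plus the all-ones matrix.\<close>
  define C where "C = Matrix.mat r r (\<lambda>(i, l). Q $$ (l, Suc i) - Q $$ (l, 0))"
  have Cc: "C \<in> carrier_mat r r" by (simp add: C_def)
  have CC: "C * C\<^sup>T = Matrix.mat r r (\<lambda>(i, j). (if i = j then 1 else 0) + 1)"
  proof (rule eq_matI)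
    fix i j assume "i < dim_row (Matrix.mat r r (\<lambda>(i, j). (if i = j then 1 else 0) + 1 :: real))"
      "j < dim_col (Matrix.mat r r (\<lambda>(i, j). (if i = j then 1 else 0) + 1 :: real))"
    then have ij: "i < r" "j < r" by auto
    have e: "(\<Sum>l<?m. Q $$ (l, a) * Q $$ (l, b)) = (if a = b then 1 else 0)" if "a < ?m" "b < ?m" for a b
    proof -
      have "(\<Sum>l<?m. Q $$ (l, a) * Q $$ (l, b)) = (Q\<^sup>T * Q) $$ (a, b)"
        using that Qc(1) by (simp add: scalar_prod_def lessThan_atLeast0 del: sum.lessThan_Suc sum.op_ivl_Suc)
      then show ?thesis using that by (simp add: Qc(4))
    qed
    have "(C * C\<^sup>T) $$ (i, j) = (\<Sum>l<r. (Q $$ (l, Suc i) - Q $$ (l, 0)) * (Q $$ (l, Suc j) - Q $$ (l, 0)))"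
      using ij by (simp add: C_def scalar_prod_def lessThan_atLeast0)
    also have "\<dots> = (\<Sum>l<?m. (Q $$ (l, Suc i) - Q $$ (l, 0)) * (Q $$ (l, Suc j) - Q $$ (l, 0)))"
      using Qr[of "Suc i" 0] ij by simp
    also have "\<dots> = (\<Sum>l<?m. Q $$ (l, Suc i) * Q $$ (l, Suc j)) - (\<Sum>l<?m. Q $$ (l, 0) * Q $$ (l, Suc j))
        - (\<Sum>l<?m. Q $$ (l, Suc i) * Q $$ (l, 0)) + (\<Sum>l<?m. Q $$ (l, 0) * Q $$ (l, 0))"
      by (simp only: left_diff_distrib right_diff_distrib sum_subtractf)
    also have "\<dots> = (if i = j then 1 else 0) + 1" using ij by (simp only: e Suc_less_eq zero_less_Suc) simp
    finally show "(C * C\<^sup>T) $$ (i, j) = Matrix.mat r r (\<lambda>(i, j). (if i = j then 1 else 0) + 1) $$ (i, j)"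
      using ij by simp
  qed (auto simp: C_def)
  have "Determinant.det (gram_edges n r x)
       = (real r + 1) * Determinant.det (gram n r (\<lambda>i k. \<Sum>j<Suc r. Q $$ (i, j) * x (Suc j) k))" for n x
  proof -
    let ?z = "\<lambda>i k. \<Sum>j<?m. Q $$ (i, j) * x (Suc j) k"
    have edge: "x (i + 2) k - x 1 k = (\<Sum>l<r. C $$ (i, l) * ?z l k)" if "i < r" for i k
    proof -
      have "x (i + 2) k - x 1 k = (\<Sum>l<?m. Q $$ (l, Suc i) * ?z l k) - (\<Sum>l<?m. Q $$ (l, 0) * ?z l k)"
        using that Qback[of "Suc i" "\<lambda>j. x (Suc j) k"] Qback[of 0 "\<lambda>j. x (Suc j) k"]
        by (simp del: sum.lessThan_Suc)
      also have "\<dots> = (\<Sum>l<?m. (Q $$ (l, Suc i) - Q $$ (l, 0)) * ?z l k)"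
        by (simp only: left_diff_distrib sum_subtractf)
      also have "\<dots> = (\<Sum>l<r. (Q $$ (l, Suc i) - Q $$ (l, 0)) * ?z l k)"
        using Qr[of "Suc i" 0] that by (subst sum.lessThan_Suc) simp
      also have "\<dots> = (\<Sum>l<r. C $$ (i, l) * ?z l k)"
        using that by (intro sum.cong refl) (simp add: C_def)
      finally show ?thesis .
    qed
    have "gram_edges n r x = C * gram n r ?z * C\<^sup>T"
    proof (rule eq_matI)
      fix i j assume "i < dim_row (C * gram n r ?z * C\<^sup>T)" "j < dim_col (C * gram n r ?z * C\<^sup>T)"
      then have ij: "i < r" "j < r" by (auto simp: C_def)
      have "gram_edges n r x $$ (i, j) = (\<Sum>k<n. (x (i + 2) k - x 1 k) * (x (j + 2) k - x 1 k))"
        using ij by (simp add: gram_edges_def)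
      also have "\<dots> = (\<Sum>k<n. (\<Sum>l<r. C $$ (i, l) * ?z l k) * (\<Sum>l'<r. C $$ (j, l') * ?z l' k))"
        by (simp only: edge ij)
      also have "\<dots> = (\<Sum>k<n. \<Sum>l<r. \<Sum>l'<r. C $$ (i, l) * (?z l k * ?z l' k) * C $$ (j, l'))"
        by (simp only: sum_product mult_ac)
      also have "\<dots> = (\<Sum>l<r. \<Sum>l'<r. C $$ (i, l) * (\<Sum>k<n. ?z l k * ?z l' k) * C $$ (j, l'))"
        by (subst sum.swap, rule sum.cong[OF refl], subst sum.swap)
          (simp only: sum_distrib_left sum_distrib_right)
      also have "\<dots> = (\<Sum>l'<r. (\<Sum>l<r. C $$ (i, l) * gram n r ?z $$ (l, l')) * C $$ (j, l'))"
        by (subst sum.swap) (simp add: gram_def sum_distrib_right del: sum.lessThan_Suc)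
      also have "\<dots> = (C * gram n r ?z * C\<^sup>T) $$ (i, j)"
      proof -
        have CG: "C * gram n r ?z \<in> carrier_mat r r" using Cc gram_carrier by (rule mult_carrier_mat)
        have CT: "C\<^sup>T \<in> carrier_mat r r" using Cc by simp
        have "(C * gram n r ?z * C\<^sup>T) $$ (i, j) = (\<Sum>l'<r. (C * gram n r ?z) $$ (i, l') * C $$ (j, l'))"
          unfolding mult_mat_entry[OF CG CT ij] using Cc ij by (intro sum.cong refl arg_cong2[where f = "(*)"]) simp
        also have "\<dots> = (\<Sum>l'<r. (\<Sum>l<r. C $$ (i, l) * gram n r ?z $$ (l, l')) * C $$ (j, l'))"
          using ij by (intro sum.cong refl) (simp only: mult_mat_entry[OF Cc gram_carrier] lessThan_iff)
        finally show ?thesis ..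
      qed
      finally show "gram_edges n r x $$ (i, j) = (C * gram n r ?z * C\<^sup>T) $$ (i, j)" .
    qed (auto simp: gram_edges_def C_def)
    then have "Determinant.det (gram_edges n r x) = Determinant.det (C * C\<^sup>T) * Determinant.det (gram n r ?z)"
      using det_mult[of "C * gram n r ?z" r "C\<^sup>T"] det_mult[of C r "gram n r ?z"] det_mult[of C r "C\<^sup>T"] Cc by simp
    then show ?thesis by (simp only: CC det_one_plus_ones)
  qed
  then show thesis using that[OF Qc(1,3)] by blast
qed

section \<open>The law of the Gram determinant\<close>

lemma measurable_det_gram [simp]: "(\<lambda>z. Determinant.det (gram n r z)) \<in> borel_measurable (gauss_rows r n)"
  unfolding gram_def by (rule borel_measurable_det_mat) (intro borel_measurable_sum borel_measurable_times measurable_gauss_rows_entry; simp)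

lemma distr_gauss_rows_restrict:
  assumes "n \<le> N"
  shows "distr (gauss_rows r N) (gauss_rows r n) (\<lambda>x. \<lambda>i\<in>{..<r}. \<lambda>k\<in>{..<n}. x i k) = gauss_rows r n"
proof -
  have 1: "distr (std_gaussian_euclid N) (std_gaussian_euclid n) (\<lambda>y. restrict y {..<n}) = std_gaussian_euclid n"
  proof -
    interpret product_prob_space "\<lambda>_ :: nat. std_gaussian" "{..<N}" by standard
    show ?thesis unfolding std_gaussian_euclid_def
      by (rule distr_PiM_restrict_finite) (use assms in auto)
  qed
  have 2: "(\<lambda>y. restrict y {..<n}) \<in> measurable (std_gaussian_euclid N) (std_gaussian_euclid n)"
    unfolding std_gaussian_euclid_def by (rule measurable_restrict_subset) (use assms in auto)
  have "distr (gauss_rows r N) (gauss_rows r n) (compose {..<r} (\<lambda>y. restrict y {..<n})) = gauss_rows r n"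
    unfolding gauss_rows_def
    by (subst distr_PiM_finite_prob_space') (simp_all add: prob_space_std_gaussian_euclid 1 2)
  moreover have "(\<lambda>x. \<lambda>i\<in>{..<r}. \<lambda>k\<in>{..<n}. x i k :: real) = compose {..<r} (\<lambda>y. restrict y {..<n})"
    by (auto simp: compose_def fun_eq_iff)
  ultimately show ?thesis by simp
qed

lemma gram_cong:
  assumes "\<And>i k. i < r \<Longrightarrow> k < n \<Longrightarrow> z i k = z' i k" shows "gram n r z = gram n r z'"
  using assms by (auto simp: gram_def intro!: eq_matI sum.cong)

lemma gram_compose_orthogonal:
  assumes Q: "Q \<in> carrier_mat n n" "Q\<^sup>T * Q = 1\<^sub>m n"
  shows "gram n r (\<lambda>i. matmap n Q (z i)) = gram n r z"
  unfolding gram_def by (rule eq_matI) (auto simp: matmap_inner[OF Q])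

text \<open>The rotation Q taking \<open>y\<close> to a multiple of the last basis vector depends on
  \<open>y\<close> alone, so for fixed \<open>y\<close> it preserves the law of the other rows;
  fixing \<open>y\<close> also avoids a measurable choice of Q. The last coordinate of those rows
  then disappears from the determinant and is integrated out.\<close>

lemma nn_integral_gauss_rows_peel_fixed:
  assumes y: "y \<in> space (lebesgue_euclid (Suc n))" and F: "F \<in> borel_measurable borel"
  shows "(\<integral>\<^sup>+x. F (Determinant.det (gram (Suc n) (Suc r) (x(r := y)))) \<partial>gauss_rows r (Suc n))
    = (\<integral>\<^sup>+x. F ((\<Sum>k<Suc n. (y k)\<^sup>2) * Determinant.det (gram n r x)) \<partial>gauss_rows r n)"
proof -
  let ?N = "Suc n"
  have "{..<n} \<subseteq> {..<?N} - {n}" by auto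
  from rotation_eliminates[OF lessI finite_lessThan this y] obtain Q
    where "Q \<in> rotations ?N" and Q0: "\<And>l. l < n \<Longrightarrow> matmap ?N Q y l = 0" by auto
  then have Q: "Q \<in> carrier_mat ?N ?N" "Q * Q\<^sup>T = 1\<^sub>m ?N" "Q\<^sup>T * Q = 1\<^sub>m ?N" by (auto simp: rotations_def)
  have sq: "(matmap ?N Q y n)\<^sup>2 = (\<Sum>k<?N. (y k)\<^sup>2)"
  proof -
    have "(\<Sum>k<?N. matmap ?N Q y k * matmap ?N Q y k) = (matmap ?N Q y n)\<^sup>2"
      by (subst sum.lessThan_Suc) (simp add: Q0 power2_eq_square)
    then show ?thesis by (simp only: matmap_inner[OF Q(1,3)]) (simp only: power2_eq_square)
  qed
  have key: "Determinant.det (gram ?N (Suc r) (x(r := y)))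
      = (\<Sum>k<?N. (y k)\<^sup>2) * Determinant.det (gram n r (\<lambda>i. matmap ?N Q (x i)))" for x
  proof -
    have "gram ?N (Suc r) (x(r := y)) = gram ?N (Suc r) (\<lambda>i. matmap ?N Q ((x(r := y)) i))"
      by (rule gram_compose_orthogonal[OF Q(1,3), symmetric])
    also have "Determinant.det \<dots> = (matmap ?N Q y n)\<^sup>2
        * Determinant.det (gram n r (\<lambda>i. matmap ?N Q ((x(r := y)) i)))"
      by (subst det_gram_peel) (simp_all add: Q0)
    also have "gram n r (\<lambda>i. matmap ?N Q ((x(r := y)) i)) = gram n r (\<lambda>i. matmap ?N Q (x i))"
      by (rule gram_cong) simp
    finally show ?thesis by (simp only: sq)
  qed
  let ?H = "\<lambda>x. F ((\<Sum>k<?N. (y k)\<^sup>2) * Determinant.det (gram n r x))"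
  have H: "?H \<in> borel_measurable (gauss_rows r n)"
    by (intro measurable_compose[OF _ F] borel_measurable_times borel_measurable_const measurable_det_gram)
  have HN: "?H \<in> borel_measurable (gauss_rows r ?N)"
  proof -
    have "(\<lambda>x. Determinant.det (gram n r x)) \<in> borel_measurable (gauss_rows r ?N)"
      unfolding gram_def
      by (rule borel_measurable_det_mat) (intro borel_measurable_sum borel_measurable_times measurable_gauss_rows_entry; simp)
    then show ?thesis by (intro measurable_compose[OF _ F] borel_measurable_times borel_measurable_const)
  qed
  have mC: "compose {..<r} (matmap ?N Q) \<in> measurable (gauss_rows r ?N) (gauss_rows r ?N)"
  proof -
    have "matmap ?N Q \<in> measurable (std_gaussian_euclid ?N) (std_gaussian_euclid ?N)"
      using distr_lebesgue_orthogonal(1)[OF Q(1,2)] by (simp cong: measurable_cong_sets)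
    then show ?thesis
      unfolding gauss_rows_def compose_def
      by (intro measurable_restrict) (auto intro: measurable_compose[OF measurable_component_singleton])
  qed
  have mR: "(\<lambda>x. \<lambda>i\<in>{..<r}. \<lambda>k\<in>{..<n}. x i k) \<in> measurable (gauss_rows r ?N) (gauss_rows r n)"
    by (intro measurable_to_gauss_rows measurable_gauss_rows_entry) auto
  have "(\<integral>\<^sup>+x. F (Determinant.det (gram ?N (Suc r) (x(r := y)))) \<partial>gauss_rows r ?N)
      = (\<integral>\<^sup>+x. ?H (compose {..<r} (matmap ?N Q) x) \<partial>gauss_rows r ?N)"
    unfolding key
    by (intro nn_integral_cong arg_cong[where f = F] arg_cong2[where f = "(*)"] refl
        arg_cong[where f = Determinant.det] gram_cong) (simp add: compose_def)
  also have "\<dots> = (\<integral>\<^sup>+x. ?H x \<partial>distr (gauss_rows r ?N) (gauss_rows r ?N) (compose {..<r} (matmap ?N Q)))"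
    by (rule nn_integral_distr[symmetric, OF mC]) (use HN in simp)
  also have "\<dots> = (\<integral>\<^sup>+x. ?H x \<partial>gauss_rows r ?N)"
    by (simp only: distr_gauss_rows_compose[OF Q(1,2)])
  also have "\<dots> = (\<integral>\<^sup>+x. ?H (\<lambda>i\<in>{..<r}. \<lambda>k\<in>{..<n}. x i k) \<partial>gauss_rows r ?N)"
    by (intro nn_integral_cong arg_cong[where f = F] arg_cong2[where f = "(*)"] refl
        arg_cong[where f = Determinant.det] gram_cong) simp
  also have "\<dots> = (\<integral>\<^sup>+x. ?H x \<partial>distr (gauss_rows r ?N) (gauss_rows r n) (\<lambda>x. \<lambda>i\<in>{..<r}. \<lambda>k\<in>{..<n}. x i k))"
    by (rule nn_integral_distr[symmetric, OF mR]) (use H in simp)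
  also have "\<dots> = (\<integral>\<^sup>+x. ?H x \<partial>gauss_rows r n)"
    by (simp only: distr_gauss_rows_restrict[OF le_SucI[OF order_refl]])
  finally show ?thesis .
qed

lemma borel_measurable_sqnorm [simp]:
  "(\<lambda>y. \<Sum>k<n. (y k)\<^sup>2) \<in> borel_measurable (std_gaussian_euclid n)"
proof -
  have "(\<lambda>y. \<Sum>k<n. (y k)\<^sup>2) \<in> borel_measurable (lebesgue_euclid n)"
    by (intro borel_measurable_sum borel_measurable_power) simp
  then show ?thesis by (simp cong: measurable_cong_sets)
qed

text \<open>Row \<open>r\<close> is taken as the outer variable of integration, so that the inner
  integral is the one with \<open>y\<close> fixed. It depends on \<open>y\<close> through the
  squared norm only, which gives the independent factor.\<close>

theorem distr_det_gram_peel: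
  "distr (gauss_rows (Suc r) (Suc n)) borel (\<lambda>z. Determinant.det (gram (Suc n) (Suc r) z))
   = distr (std_gaussian_euclid (Suc n) \<Otimes>\<^sub>M gauss_rows r n) borel
       (\<lambda>(y, x). (\<Sum>k<Suc n. (y k)\<^sup>2) * Determinant.det (gram n r x))" (is "?lhs = ?rhs")
proof (rule measure_eqI)
  let ?N = "Suc n"
  let ?G = "std_gaussian_euclid ?N"
  fix B assume "B \<in> sets ?lhs"
  then have B: "B \<in> sets borel" by simp
  define F :: "real \<Rightarrow> ennreal" where "F = indicator B"
  have F: "F \<in> borel_measurable borel" using B by (simp add: F_def)
  interpret product_sigma_finite "\<lambda>_ :: nat. ?G"
    by (intro product_sigma_finite.intro prob_space_imp_sigma_finite prob_space_std_gaussian_euclid)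
  interpret R: prob_space "gauss_rows r n" by (rule prob_space_gauss_rows)
  interpret G: prob_space ?G by (rule prob_space_std_gaussian_euclid)
  have ins: "{..<Suc r} = insert r {..<r}" by auto
  have pm: "(\<lambda>(y, x). (\<Sum>k<?N. (y k)\<^sup>2) * Determinant.det (gram n r x)) \<in> borel_measurable (?G \<Otimes>\<^sub>M gauss_rows r n)"
    unfolding case_prod_beta'
    by (intro borel_measurable_times measurable_compose[OF measurable_fst borel_measurable_sqnorm]
        measurable_compose[OF measurable_snd measurable_det_gram])
  have dm: "(\<lambda>z. F (Determinant.det (gram ?N (Suc r) z))) \<in> borel_measurable (gauss_rows (Suc r) ?N)"
    by (rule measurable_compose[OF measurable_det_gram F])
  have "emeasure ?lhs B = (\<integral>\<^sup>+t. F t \<partial>?lhs)"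
    using B by (simp add: F_def)
  also have "\<dots> = (\<integral>\<^sup>+z. F (Determinant.det (gram ?N (Suc r) z)) \<partial>gauss_rows (Suc r) ?N)"
    by (rule nn_integral_distr[OF measurable_det_gram]) (use F in simp)
  also have "\<dots> = (\<integral>\<^sup>+y. \<integral>\<^sup>+x. F (Determinant.det (gram ?N (Suc r) (x(r := y)))) \<partial>gauss_rows r ?N \<partial>?G)"
    using dm unfolding gauss_rows_def ins by (intro product_nn_integral_insert_rev) auto
  also have "\<dots> = (\<integral>\<^sup>+y. \<integral>\<^sup>+x. F ((\<Sum>k<?N. (y k)\<^sup>2) * Determinant.det (gram n r x)) \<partial>gauss_rows r n \<partial>?G)"
    by (intro nn_integral_cong nn_integral_gauss_rows_peel_fixed F) simp
  also have "\<dots> = (\<integral>\<^sup>+p. F ((\<lambda>(y, x). (\<Sum>k<?N. (y k)\<^sup>2) * Determinant.det (gram n r x)) p) \<partial>(?G \<Otimes>\<^sub>M gauss_rows r n))"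
    by (subst R.nn_integral_fst[symmetric, OF measurable_compose[OF pm F]]) simp
  also have "\<dots> = (\<integral>\<^sup>+t. F t \<partial>?rhs)"
    by (rule nn_integral_distr[symmetric, OF pm]) (use F in simp)
  also have "\<dots> = emeasure ?rhs B" using B by (simp add: F_def)
  finally show "emeasure ?lhs B = emeasure ?rhs B" .
qed simp

text \<open>The vertices pass through three maps that send Gaussian arrays to Gaussian arrays:
  \<open>?S\<close> renumbers them from 0, \<open>?X\<close> mixes them by Q, and \<open>?R\<close>
  forgets the centroid vector.\<close>

lemma distr_det_gram_edges:
  assumes "0 < n"
  shows "distr (PiM {1..r+1} (\<lambda>_. std_gaussian_euclid n)) borel (\<lambda>x. Determinant.det (gram_edges n r x))
    = distr (gauss_rows r n) borel (\<lambda>z. (real r + 1) * Determinant.det (gram n r z))"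
proof -
  obtain Q where Q: "Q \<in> carrier_mat (Suc r) (Suc r)" "Q * Q\<^sup>T = 1\<^sub>m (Suc r)"
    and det: "\<And>n x. Determinant.det (gram_edges n r x)
       = (real r + 1) * Determinant.det (gram n r (\<lambda>i k. \<Sum>j<Suc r. Q $$ (i, j) * x (Suc j) k))"
    by (rule gram_edges_orthogonal[of r]) (rule that)
  let ?P = "PiM {1..r+1} (\<lambda>_. std_gaussian_euclid n)"
  let ?S = "\<lambda>x. \<lambda>i\<in>{..<Suc r}. x (Suc i) :: nat \<Rightarrow> real"
  let ?X = "\<lambda>x. \<lambda>i\<in>{..<Suc r}. \<lambda>k\<in>{..<n}. \<Sum>j<Suc r. Q $$ (i, j) * x j k"
  let ?R = "\<lambda>x. \<lambda>i\<in>{..<r}. x i :: nat \<Rightarrow> real"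
  let ?D = "\<lambda>z. (real r + 1) * Determinant.det (gram n r z)"
  have S: "distr ?P (gauss_rows (Suc r) n) ?S = gauss_rows (Suc r) n"
    unfolding gauss_rows_def
    by (rule distr_PiM_reindex[where f = Suc]) (auto simp: prob_space_std_gaussian_euclid)
  have mS: "?S \<in> measurable ?P (gauss_rows (Suc r) n)"
    unfolding gauss_rows_def by (intro measurable_restrict measurable_component_singleton) auto
  have X: "distr (gauss_rows (Suc r) n) (gauss_rows (Suc r) n) ?X = gauss_rows (Suc r) n"
    by (rule distr_gauss_rows_mix) (use assms Q in auto)
  have mX: "?X \<in> measurable (gauss_rows (Suc r) n) (gauss_rows (Suc r) n)"
    by (intro measurable_to_gauss_rows borel_measurable_sum borel_measurable_times borel_measurable_const
        measurable_gauss_rows_entry) auto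
  have R: "distr (gauss_rows (Suc r) n) (gauss_rows r n) ?R = gauss_rows r n"
  proof -
    interpret product_prob_space "\<lambda>_ :: nat. std_gaussian_euclid n" "{..<Suc r}"
      by (intro product_prob_space.intro product_sigma_finite.intro product_prob_space_axioms.intro
          prob_space_imp_sigma_finite prob_space_std_gaussian_euclid)
    show ?thesis unfolding gauss_rows_def by (rule distr_PiM_restrict_finite) auto
  qed
  have mR: "?R \<in> measurable (gauss_rows (Suc r) n) (gauss_rows r n)"
    unfolding gauss_rows_def by (intro measurable_restrict measurable_component_singleton) auto
  have mD: "?D \<in> borel_measurable (gauss_rows r n)"
    by (intro borel_measurable_times borel_measurable_const measurable_det_gram)
  have mDR: "?D \<circ> ?R \<in> borel_measurable (gauss_rows (Suc r) n)" by (rule measurable_comp[OF mR mD])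
  have mDRX: "?D \<circ> ?R \<circ> ?X \<in> borel_measurable (gauss_rows (Suc r) n)" by (rule measurable_comp[OF mX mDR])
  have "distr (gauss_rows r n) borel ?D = distr (distr (gauss_rows (Suc r) n) (gauss_rows r n) ?R) borel ?D"
    by (simp only: R)
  also have "\<dots> = distr (gauss_rows (Suc r) n) borel (?D \<circ> ?R)" by (rule distr_distr[OF mD mR])
  also have "\<dots> = distr (distr (gauss_rows (Suc r) n) (gauss_rows (Suc r) n) ?X) borel (?D \<circ> ?R)"
    by (simp only: X)
  also have "\<dots> = distr (gauss_rows (Suc r) n) borel (?D \<circ> ?R \<circ> ?X)" by (rule distr_distr[OF mDR mX])
  also have "\<dots> = distr (distr ?P (gauss_rows (Suc r) n) ?S) borel (?D \<circ> ?R \<circ> ?X)"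
    by (simp only: S)
  also have "\<dots> = distr ?P borel (?D \<circ> ?R \<circ> ?X \<circ> ?S)" by (rule distr_distr[OF mDRX mS])
  also have "?D \<circ> ?R \<circ> ?X \<circ> ?S = (\<lambda>x. Determinant.det (gram_edges n r x))"
    unfolding det comp_def
    by (intro ext arg_cong2[where f = "(*)"] refl arg_cong[where f = Determinant.det] gram_cong) simp
  finally show ?thesis ..
qed

section \<open>Logarithmic moments\<close>

text \<open>The law of the squared norm under Lebesgue measure is read off from the volumes of balls.\<close>

lemma distr_sqnorm_lebesgue:
  assumes n: "n > 0"
  shows "distr (lebesgue_euclid n) borel (\<lambda>x. \<Sum>k<n. (x k)\<^sup>2)
    = density lborel (\<lambda>t. ennreal (indicator {0<..} t * (unit_ball_vol (real n) * (real n / 2) * t powr (real n / 2 - 1))))"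
    (is "?A = ?B")
proof -
  let ?L = "lebesgue_euclid n" and ?c = "unit_ball_vol (real n)"
  have sm: "(\<lambda>x. \<Sum>k<n. (x k)\<^sup>2) \<in> borel_measurable ?L"
    by (intro borel_measurable_sum borel_measurable_power) simp
  \<comment> \<open>Distribution functions suffice. For a > 0 the set below level \<open>a\<close>
    is the ball of radius sqrt a, whose volume is that of the unit ball times a^(n/2).\<close>
  have A: "emeasure ?A {..a} = ennreal (if a > 0 then ?c * a powr (real n / 2) else 0)" for a
  proof -
    have "emeasure ?A {..a} = emeasure ?L ((\<lambda>x. \<Sum>k<n. (x k)\<^sup>2) -` {..a} \<inter> space ?L)"
      by (rule emeasure_distr[OF sm]) simp
    also have "\<dots> = ennreal (if a > 0 then ?c * a powr (real n / 2) else 0)"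
    proof (cases "a > 0")
      case True
      have "(\<lambda>x. \<Sum>k<n. (x k)\<^sup>2) -` {..a} \<inter> space ?L = {f. sqrt (\<Sum>i<n. (f i)\<^sup>2) \<le> sqrt a} \<inter> space (PiM {..<n} (\<lambda>_. lborel))"
        by (auto simp: lebesgue_euclid_def)
      moreover have "sqrt a ^ n = a powr (real n / 2)"
        using True by (simp add: powr_half_sqrt[symmetric] powr_powr flip: powr_realpow)
      ultimately show ?thesis
        using emeasure_cball_aux[of "{..<n}" "sqrt a"] True by (simp add: lebesgue_euclid_def)
    next
      case False
      \<comment> \<open>For \<open>a\<close> at most 0 only the origin can qualify, and it lies in a
        null coordinate hyperplane; n > 0 provides the coordinate 0.\<close>
      have "(\<lambda>x. \<Sum>k<n. (x k)\<^sup>2) -` {..a} \<inter> space ?L \<subseteq> {y \<in> space ?L. y 0 = 0}"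
      proof clarsimp
        fix x assume "(\<Sum>k<n. (x k)\<^sup>2) \<le> a"
        with False have "(\<Sum>k<n. (x k)\<^sup>2) = 0"
          by (intro antisym sum_nonneg) auto
        then show "x 0 = 0" using n by (subst (asm) sum_nonneg_eq_0_iff) auto
      qed
      moreover have "(\<lambda>x. \<Sum>k<n. (x k)\<^sup>2) -` {..a} \<inter> space ?L \<in> sets ?L"
        by (rule measurable_sets[OF sm]) simp
      ultimately have "emeasure ?L ((\<lambda>x. \<Sum>k<n. (x k)\<^sup>2) -` {..a} \<inter> space ?L) = 0"
        using null_coordinate_hyperplane[OF n, of 0] emeasure_mono[of _ _ ?L]
        by (metis (no_types, lifting) null_setsD1 null_setsD2 le_zero_eq)
      then show ?thesis using False by simp
    qed
    finally show ?thesis .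
  qed
  have B: "emeasure ?B {..a} = ennreal (if a > 0 then ?c * a powr (real n / 2) else 0)" for a
  proof -
    let ?f = "\<lambda>t. ?c * (real n / 2) * t powr (real n / 2 - 1)"
    have "emeasure ?B {..a} = (\<integral>\<^sup>+t. ennreal (indicator {0<..} t * ?f t) * indicator {..a} t \<partial>lborel)"
      by (rule emeasure_density) auto
    also have "\<dots> = (\<integral>\<^sup>+t. ennreal (?f t) * indicator {0<..a} t \<partial>lborel)"
      by (intro nn_integral_cong) (auto simp: indicator_def)
    also have "\<dots> = ennreal (if a > 0 then ?c * a powr (real n / 2) else 0)"
    proof (cases "a > 0")
      case True
      have "((\<lambda>t. t powr (real n / 2 - 1)) has_integral (a powr (real n / 2 - 1 + 1) / (real n / 2 - 1 + 1))) {0..a}"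
        by (rule has_integral_powr_from_0) (use n True in auto)
      then have "((\<lambda>t. ?f t) has_integral (?c * (real n / 2) * (a powr (real n / 2 - 1 + 1) / (real n / 2 - 1 + 1)))) {0..a}"
        by (rule has_integral_mult_right)
      also have "?c * (real n / 2) * (a powr (real n / 2 - 1 + 1) / (real n / 2 - 1 + 1)) = ?c * a powr (real n / 2)"
        using n by simp
      finally have "(\<integral>\<^sup>+t. ennreal (?f t) * indicator {0..a} t \<partial>lborel) = ennreal (?c * a powr (real n / 2))"
        by (intro nn_integral_has_integral_lebesgue') auto
      moreover have "(\<integral>\<^sup>+t. ennreal (?f t) * indicator {0..a} t \<partial>lborel) = (\<integral>\<^sup>+t. ennreal (?f t) * indicator {0<..a} t \<partial>lborel)"
        by (intro nn_integral_cong_AE AE_I[where N = "{0}"]) (auto simp: indicator_def split: if_splits)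
      ultimately show ?thesis using True by simp
    qed (simp add: indicator_def)
    finally show ?thesis .
  qed
  show ?thesis
  proof (rule measure_eqI_generator_eq[where E = "range atMost" and \<Omega> = UNIV and A = "\<lambda>i. {..real i}"])
    show "Int_stable (range (atMost :: real \<Rightarrow> real set))"
      by (auto simp: Int_stable_def intro: range_eqI)
    show "sets ?A = sigma_sets UNIV (range atMost)" "sets ?B = sigma_sets UNIV (range atMost)"
      by (simp_all add: borel_eq_atMost)
    show "(\<Union>i. {..real i}) = UNIV" by (auto intro: real_arch_simple)
    fix X assume "X \<in> range (atMost :: real \<Rightarrow> real set)"
    then show "emeasure ?A X = emeasure ?B X" using A B by auto
  qed (auto simp: A)
qed

text \<open>The Gaussian density is a function of the squared norm, so it multiplies the
  push-forward of Lebesgue measure. The result is the chi-square density with \<open>n\<close>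
  degrees of freedom.\<close>

theorem distr_sqnorm_gaussian:
  assumes n: "n > 0"
  shows "distr (std_gaussian_euclid n) borel (\<lambda>x. \<Sum>k<n. (x k)\<^sup>2)
    = density lborel (\<lambda>t. ennreal (indicator {0<..} t *
        (t powr (real n / 2 - 1) * exp (- t / 2) / (2 powr (real n / 2) * Gamma (real n / 2)))))"
    (is "?A = ?B")
proof (rule measure_eqI)
  let ?L = "lebesgue_euclid n" and ?c = "unit_ball_vol (real n)"
  let ?s = "\<lambda>x. \<Sum>k<n. (x k)\<^sup>2 :: real"
  let ?h = "\<lambda>t. ennreal ((1 / sqrt (2 * pi)) ^ n * exp (- t / 2))"
  let ?g = "\<lambda>t. ennreal (indicator {0<..} t * (?c * (real n / 2) * t powr (real n / 2 - 1)))"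
  have sm: "?s \<in> borel_measurable ?L"
    by (intro borel_measurable_sum borel_measurable_power) simp
  have phi: "(\<lambda>x. ennreal (\<Prod>k<n. std_normal_density (x k))) = (\<lambda>x. ?h (?s x))"
    by (simp only: prod_std_normal_density)
  have hm: "?h \<in> borel_measurable borel" by measurable
  fix B assume "B \<in> sets ?A"
  then have B: "B \<in> sets borel" by simp
  have "emeasure ?A B = emeasure (std_gaussian_euclid n) (?s -` B \<inter> space ?L)"
    using B sm by (subst emeasure_distr) (simp_all cong: measurable_cong_sets)
  also have "\<dots> = (\<integral>\<^sup>+x. ?h (?s x) * indicator (?s -` B \<inter> space ?L) x \<partial>?L)"
    unfolding std_gaussian_euclid_density phi
    by (rule emeasure_density[OF measurable_compose[OF sm hm] measurable_sets[OF sm B]])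
  also have "\<dots> = (\<integral>\<^sup>+x. ?h (?s x) * indicator B (?s x) \<partial>?L)"
    by (intro nn_integral_cong) (auto simp: indicator_def)
  also have "\<dots> = (\<integral>\<^sup>+t. ?h t * indicator B t \<partial>distr ?L borel ?s)"
    by (rule nn_integral_distr[symmetric, OF sm]) (use hm B in \<open>auto intro!: borel_measurable_times_ennreal\<close>)
  also have "\<dots> = (\<integral>\<^sup>+t. ?g t * (?h t * indicator B t) \<partial>lborel)"
    unfolding distr_sqnorm_lebesgue[OF n]
    by (rule nn_integral_density) (use hm B in \<open>auto intro!: borel_measurable_times_ennreal\<close>)
  also have "\<dots> = (\<integral>\<^sup>+t. ennreal (indicator {0<..} t *
        (t powr (real n / 2 - 1) * exp (- t / 2) / (2 powr (real n / 2) * Gamma (real n / 2)))) * indicator B t \<partial>lborel)"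
  proof (intro nn_integral_cong)
    fix t :: real
    have G: "Gamma (real n / 2 + 1) = (real n / 2) * Gamma (real n / 2)"
      using n by (intro Gamma_plus1) auto
    have Gp: "Gamma (real n / 2) > 0" using n by (intro Gamma_real_pos) auto
    \<comment> \<open>The powers of pi cancel against the volume of the unit ball, leaving 1 /
      (2^(n/2) Gamma(n/2)).\<close>
    have "(1 / sqrt (2 * pi)) ^ n = 1 / (2 powr (real n / 2) * pi powr (real n / 2))"
      by (simp add: power_divide powr_half_sqrt[symmetric] powr_powr powr_mult mult.commute flip: powr_realpow)
    then have "?c * (real n / 2) * (1 / sqrt (2 * pi)) ^ n = 1 / (2 powr (real n / 2) * Gamma (real n / 2))"
      using n Gp by (simp add: unit_ball_vol_def G)
    then have "?c * (real n / 2) * t powr (real n / 2 - 1) * ((1 / sqrt (2 * pi)) ^ n * exp (- t / 2))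
        = t powr (real n / 2 - 1) * exp (- t / 2) / (2 powr (real n / 2) * Gamma (real n / 2))"
      by (simp add: field_simps)
    then show "?g t * (?h t * indicator B t) = ennreal (indicator {0<..} t *
        (t powr (real n / 2 - 1) * exp (- t / 2) / (2 powr (real n / 2) * Gamma (real n / 2)))) * indicator B t"
      using n by (auto simp: indicator_def simp flip: ennreal_mult)
  qed
  also have "\<dots> = emeasure ?B B"
    by (rule emeasure_density[symmetric]) (use B in auto)
  finally show "emeasure ?A B = emeasure ?B B" .
qed simp

text \<open>Euler's integral for Gamma at a + s, with t^s written as
  \<open>exp (s * of_real (ln t))\<close> to allow complex exponents. The condition on
  \<open>s\<close> is integrability at 0.\<close>

lemma gamma_moment:
  assumes a: "a > 0" and s: "Re s + a > 0"
  defines "d \<equiv> \<lambda>t. indicator {0<..} t * (t powr (a - 1) * exp (- t / 2) / (2 powr a * Gamma a))"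
  shows "integrable (density lborel (\<lambda>t. ennreal (d t))) (\<lambda>t. exp (s * of_real (ln t)))"
    "(LINT t|density lborel (\<lambda>t. ennreal (d t)). exp (s * of_real (ln t)))
      = exp (s * of_real (ln 2)) * Gamma (of_real a + s) / Gamma (of_real a)"
proof -
  let ?z = "of_real a + s"
  let ?K = "1 / (2 powr a * Gamma a)"
  have Gp: "Gamma a > 0" using a by (rule Gamma_real_pos)
  have rz: "Re ?z > 0" using s by simp
  have dm: "d \<in> borel_measurable lborel" by (simp add: d_def)
  have d0: "d t \<ge> 0" for t using Gp by (auto simp: d_def)
  have fm: "(\<lambda>t. exp (s * complex_of_real (ln t))) \<in> borel_measurable lborel" by measurable
  let ?f = "\<lambda>t. complex_of_real t powr (?z - 1) / of_real (exp (1/2 * t))"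
  have pt: "d t *\<^sub>R exp (s * of_real (ln t)) = of_real ?K * (indicator {0<..} t *\<^sub>R ?f t)" for t
  proof (cases "t > 0")
    case True
    then have "complex_of_real t powr (?z - 1) = exp (s * of_real (ln t)) * of_real (t powr (a - 1))"
      by (simp add: powr_def exp_add[symmetric] exp_of_real[symmetric] Ln_of_real algebra_simps)
    then show ?thesis using True
      by (simp add: d_def scaleR_conv_of_real exp_minus field_simps)
  qed (simp add: d_def)
  have I: "set_integrable lebesgue {0<..} ?f"
    using absolutely_integrable_Gamma_integral[OF rz, of "1/2"] by simp
  \<comment> \<open>On t > 0 the complex power is an exponential of the real logarithm, hence Borel;
    this allows the passage from \<open>lebesgue\<close> to \<open>lborel\<close>.\<close>
  have fbm: "(\<lambda>t. indicator {0<..} t *\<^sub>R ?f t) \<in> borel_measurable borel"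
  proof -
    have "(\<lambda>t. indicator {0<..} t *\<^sub>R ?f t)
        = (\<lambda>t. indicator {0<..} t *\<^sub>R (exp ((?z - 1) * of_real (ln t)) / of_real (exp (1/2 * t))))"
      by (auto simp: powr_def Ln_of_real fun_eq_iff indicator_def)
    then show ?thesis by simp
  qed
  have I': "integrable lborel (\<lambda>t. indicator {0<..} t *\<^sub>R ?f t)"
    using I fbm unfolding set_integrable_def by (subst (asm) integrable_completion) simp_all
  show 1: "integrable (density lborel (\<lambda>t. ennreal (d t))) (\<lambda>t. exp (s * of_real (ln t)))"
    by (subst integrable_density[OF fm dm], use d0 in simp, simp only: pt, intro integrable_mult_right I')
  have "(LINT t|density lborel (\<lambda>t. ennreal (d t)). exp (s * of_real (ln t)))
      = (LINT t|lborel. d t *\<^sub>R exp (s * of_real (ln t)))"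
    by (rule integral_density[OF fm dm]) (use d0 in simp)
  also have "\<dots> = of_real ?K * (LINT t|lborel. indicator {0<..} t *\<^sub>R ?f t)"
    unfolding pt by (rule integral_mult_right_zero)
  also have "(LINT t|lborel. indicator {0<..} t *\<^sub>R ?f t) = 2 powr ?z * Gamma ?z"
  proof -
    let ?g = "\<lambda>t. complex_of_real t powr (?z - 1) / of_real (exp t)"
    \<comment> \<open>Replacing t by 2t removes the factor 1/2 in the exponential and produces the
      power of 2.\<close>
    have scale: "indicator {0<..} (0 + 2 * t) *\<^sub>R ?f (0 + 2 * t) = 2 powr (?z - 1) * (indicator {0<..} t *\<^sub>R ?g t)"
      for t :: real
    proof (cases "t > 0")
      case True
      have "Ln (complex_of_real (2 * t)) = of_real (ln 2) + of_real (ln t)"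
        using True by (subst Ln_of_real) (auto simp: ln_mult)
      moreover have "Ln 2 = of_real (ln 2)" using Ln_of_real[of 2] by simp
      ultimately have "complex_of_real (2 * t) powr (?z - 1) = 2 powr (?z - 1) * of_real t powr (?z - 1)"
        using True by (simp add: powr_def Ln_of_real exp_add[symmetric] distrib_left)
      then show ?thesis using True by simp
    qed (simp add: indicator_def)
    have J: "set_integrable lebesgue {0<..} ?g"
      using absolutely_integrable_Gamma_integral'[OF rz] by simp
    have gbm: "(\<lambda>t. indicator {0<..} t *\<^sub>R ?g t) \<in> borel_measurable borel"
    proof -
      have "(\<lambda>t. indicator {0<..} t *\<^sub>R ?g t)
          = (\<lambda>t. indicator {0<..} t *\<^sub>R (exp ((?z - 1) * of_real (ln t)) / of_real (exp t)))"
        by (auto simp: powr_def Ln_of_real fun_eq_iff indicator_def)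
      then show ?thesis by simp
    qed
    have "(LINT t|lborel. indicator {0<..} t *\<^sub>R ?f t)
        = \<bar>2\<bar> *\<^sub>R (LINT t|lborel. indicator {0<..} (0 + 2 * t) *\<^sub>R ?f (0 + 2 * t))"
      by (rule lborel_integral_real_affine) simp
    also have "\<dots> = 2 * (2 powr (?z - 1) * (LINT t|lborel. indicator {0<..} t *\<^sub>R ?g t))"
      unfolding scale integral_mult_right_zero by (simp add: scaleR_conv_of_real)
    also have "(LINT t|lborel. indicator {0<..} t *\<^sub>R ?g t) = (LINT t|lebesgue. indicator {0<..} t *\<^sub>R ?g t)"
      using gbm by (subst integral_completion) simp_all
    also have "\<dots> = Gamma ?z"
      using set_lebesgue_integral_eq_integral(2)[OF J] integral_unique[OF Gamma_integral_complex'[OF rz]]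
      by (simp add: set_lebesgue_integral_def)
    finally show ?thesis by (simp add: powr_diff)
  qed
  also have "of_real ?K * (2 powr ?z * Gamma ?z) = exp (s * of_real (ln 2)) * Gamma ?z / Gamma (of_real a)"
  proof -
    have "Ln 2 = of_real (ln 2)" using Ln_of_real[of 2] by simp
    then show ?thesis
      using Gp by (simp add: Gamma_complex_of_real powr_add powr_of_real[symmetric] powr_def[of _ s] field_simps)
  qed
  finally show "(LINT t|density lborel (\<lambda>t. ennreal (d t)). exp (s * of_real (ln t)))
      = exp (s * of_real (ln 2)) * Gamma (of_real a + s) / Gamma (of_real a)" .
qed

section \<open>Complex moments of products of independent variables\<close>

definition log_moment :: "real measure \<Rightarrow> complex \<Rightarrow> complex \<Rightarrow> bool" where
  "log_moment \<nu> s v \<longleftrightarrow> integrable \<nu> (\<lambda>t. exp (s * of_real (ln t)))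
     \<and> (LINT t|\<nu>. exp (s * of_real (ln t))) = v"

lemma measurable_exp_ln: "(\<lambda>t. exp (s * complex_of_real (ln t))) \<in> borel_measurable borel"
  by measurable

lemma log_moment_distr:
  assumes f: "f \<in> borel_measurable M"
  shows "log_moment (distr M borel f) s v \<longleftrightarrow> integrable M (\<lambda>x. exp (s * of_real (ln (f x))))
     \<and> (LINT x|M. exp (s * of_real (ln (f x)))) = v"
  unfolding log_moment_def
  by (simp add: integrable_distr_eq[OF f measurable_exp_ln] integral_distr[OF f measurable_exp_ln])

text \<open>Independence factors the moment by Fubini. Positivity almost everywhere is carried along
  because splitting \<open>ln\<close> of the product relies on positive factors.\<close>

lemma log_moment_product:
  assumes A: "prob_space A" and B: "prob_space B"
    and f: "f \<in> borel_measurable A" "AE x in A. f x > 0" "log_moment (distr A borel f) s v"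
    and g: "g \<in> borel_measurable B" "AE x in B. g x > 0" "log_moment (distr B borel g) s w"
  shows "AE p in A \<Otimes>\<^sub>M B. f (fst p) * g (snd p) > (0::real)"
    "log_moment (distr (A \<Otimes>\<^sub>M B) borel (\<lambda>(x, y). f x * g y)) s (v * w)"
proof -
  interpret A: prob_space A by fact
  interpret B: prob_space B by fact
  interpret AB: pair_prob_space A B ..
  note [measurable] = f(1) g(1)
  let ?e = "\<lambda>t. exp (s * complex_of_real (ln t))"
  have pos: "AE p in A \<Otimes>\<^sub>M B. f (fst p) > 0 \<and> g (snd p) > 0"
  proof (subst AB.AE_pair_iff[symmetric])
    show "{x \<in> space (A \<Otimes>\<^sub>M B). 0 < f (fst x) \<and> 0 < g (snd x)} \<in> sets (A \<Otimes>\<^sub>M B)" by measurable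
    show "AE x in A. AE y in B. 0 < f x \<and> 0 < g y"
      using f(2) by eventually_elim (use g(2) in simp)
  qed
  then show "AE p in A \<Otimes>\<^sub>M B. f (fst p) * g (snd p) > 0" by eventually_elim simp
  have F: "integrable A (\<lambda>x. ?e (f x))" "(LINT x|A. ?e (f x)) = v"
    and G: "integrable B (\<lambda>x. ?e (g x))" "(LINT x|B. ?e (g x)) = w"
    using f g by (simp_all add: log_moment_distr)
  let ?h = "\<lambda>p. ?e (f (fst p)) * ?e (g (snd p))"
  have I: "integrable (A \<Otimes>\<^sub>M B) ?h"
  proof (rule AB.Fubini_integrable)
    show "integrable A (\<lambda>x. LINT y|B. norm (?h (x, y)))"
      using integrable_norm[OF F(1)] by (simp add: norm_mult)
    show "AE x in A. integrable B (\<lambda>y. ?h (x, y))"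
      using G(1) by simp
  qed measurable
  have V: "(LINT p|(A \<Otimes>\<^sub>M B). ?h p) = v * w"
    using AB.integral_fst'[OF I] F G by simp
  have ae: "AE p in A \<Otimes>\<^sub>M B. ?e (case p of (x, y) \<Rightarrow> f x * g y) = ?h p"
    using pos by eventually_elim (auto simp: ln_mult distrib_left exp_add case_prod_beta')
  have pm: "(\<lambda>(x, y). f x * g y) \<in> borel_measurable (A \<Otimes>\<^sub>M B)" by measurable
  have "integrable (A \<Otimes>\<^sub>M B) (\<lambda>p. ?e (case p of (x, y) \<Rightarrow> f x * g y)) \<longleftrightarrow> integrable (A \<Otimes>\<^sub>M B) ?h"
    by (rule integrable_cong_AE[OF measurable_compose[OF pm measurable_exp_ln] _ ae]) measurable
  moreover have "(LINT p|(A \<Otimes>\<^sub>M B). ?e (case p of (x, y) \<Rightarrow> f x * g y)) = (LINT p|(A \<Otimes>\<^sub>M B). ?h p)"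
    by (rule integral_cong_AE[OF measurable_compose[OF pm measurable_exp_ln] _ ae]) measurable
  ultimately show "log_moment (distr (A \<Otimes>\<^sub>M B) borel (\<lambda>(x, y). f x * g y)) s (v * w)"
    using I V by (simp add: log_moment_distr[OF pm])
qed

text \<open>The moment of order \<open>s\<close> of a chi-square variable with \<open>k\<close>
  degrees of freedom.\<close>

definition chi_moment :: "complex \<Rightarrow> nat \<Rightarrow> complex" where
  "chi_moment s k = exp (s * of_real (ln 2)) * Gamma (of_real (real k / 2) + s) / Gamma (of_real (real k / 2))"

lemma log_moment_sqnorm:
  assumes n: "n > 0" and s: "Re s + real n / 2 > 0"
  shows "AE y in std_gaussian_euclid n. (\<Sum>k<n. (y k)\<^sup>2) > 0"
    "log_moment (distr (std_gaussian_euclid n) borel (\<lambda>y. \<Sum>k<n. (y k)\<^sup>2)) s (chi_moment s n)"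
proof -
  show "log_moment (distr (std_gaussian_euclid n) borel (\<lambda>y. \<Sum>k<n. (y k)\<^sup>2)) s (chi_moment s n)"
    unfolding log_moment_def distr_sqnorm_gaussian[OF n] chi_moment_def
    using gamma_moment[of "real n / 2" s] n s by simp
  have "AE t in distr (std_gaussian_euclid n) borel (\<lambda>y. \<Sum>k<n. (y k)\<^sup>2). t > 0"
    unfolding distr_sqnorm_gaussian[OF n] by (subst AE_density) (auto simp: indicator_def)
  then show "AE y in std_gaussian_euclid n. (\<Sum>k<n. (y k)\<^sup>2) > 0"
    by (subst (asm) AE_distr_iff[OF borel_measurable_sqnorm]) auto
qed

text \<open>Induction with the codimension \<open>n\<close> fixed, since peeling a row lowers the
  dimension and the number of rows together. The smallest number of degrees of freedom that occurs
  is \<open>n + 1\<close>, which sets the condition on \<open>s\<close>.\<close>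

theorem log_moment_det_gram:
  assumes "Re s + real (n + 1) / 2 > 0"
  shows "(AE z in gauss_rows r (n + r). Determinant.det (gram (n + r) r z) > 0) \<and>
    log_moment (distr (gauss_rows r (n + r)) borel (\<lambda>z. Determinant.det (gram (n + r) r z))) s
      (\<Prod>k\<in>{n<..n + r}. chi_moment s k)"
proof (induction r)
  case 0
  interpret prob_space "gauss_rows 0 n" by (rule prob_space_gauss_rows)
  have d: "Determinant.det (gram n 0 z) = 1" for z
    by (rule det_dim_zero) (simp add: gram_def)
  have "log_moment (distr (gauss_rows 0 n) borel (\<lambda>_. 1)) s 1"
    by (subst log_moment_distr) (simp_all add: prob_space)
  then show ?case by (simp add: d del: distr_const)
next
  case (Suc r)
  let ?N = "Suc (n + r)"
  let ?G = "std_gaussian_euclid ?N"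
  have "real r / 2 \<ge> 0" by simp
  with assms have s: "Re s + real ?N / 2 > 0" unfolding of_nat_add of_nat_Suc add_divide_distrib by simp
  have P: "AE p in ?G \<Otimes>\<^sub>M gauss_rows r (n + r). (\<Sum>k<?N. (fst p k)\<^sup>2) * Determinant.det (gram (n + r) r (snd p)) > 0"
    and L: "log_moment (distr (?G \<Otimes>\<^sub>M gauss_rows r (n + r)) borel
      (\<lambda>(y, x). (\<Sum>k<?N. (y k)\<^sup>2) * Determinant.det (gram (n + r) r x))) s (chi_moment s ?N * (\<Prod>k\<in>{n<..n + r}. chi_moment s k))"
    using log_moment_product[OF prob_space_std_gaussian_euclid prob_space_gauss_rows borel_measurable_sqnorm
        log_moment_sqnorm(1)[OF _ s] log_moment_sqnorm(2)[OF _ s] measurable_det_gram] Suc.IH by blast+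
  have pm: "(\<lambda>(y, x). (\<Sum>k<?N. (y k)\<^sup>2) * Determinant.det (gram (n + r) r x)) \<in> borel_measurable (?G \<Otimes>\<^sub>M gauss_rows r (n + r))"
    unfolding case_prod_beta'
    by (intro borel_measurable_times measurable_compose[OF measurable_fst borel_measurable_sqnorm]
        measurable_compose[OF measurable_snd measurable_det_gram])
  have "{n<..n + Suc r} = insert ?N {n<..n + r}" by auto
  then have "(\<Prod>k\<in>{n<..n + Suc r}. chi_moment s k) = chi_moment s ?N * (\<Prod>k\<in>{n<..n + r}. chi_moment s k)"
    by simp
  moreover have "AE t in distr (gauss_rows (Suc r) ?N) borel (\<lambda>z. Determinant.det (gram ?N (Suc r) z)). t > 0"
    unfolding distr_det_gram_peel by (subst AE_distr_iff[OF pm]) (use P in \<open>auto simp: case_prod_beta'\<close>)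
  then have "AE z in gauss_rows (Suc r) ?N. Determinant.det (gram ?N (Suc r) z) > 0"
    by (subst (asm) AE_distr_iff[OF measurable_det_gram]) auto
  ultimately show ?case using L by (simp only: add_Suc_right distr_det_gram_peel simp_thms)
qed

section \<open>The moment generating function in closed form\<close>

lemma borel_measurable_det_gram_edges:
  "(\<lambda>x. Determinant.det (gram_edges n r x)) \<in> borel_measurable (PiM {1..r+1} (\<lambda>_. lebesgue_euclid n))"
proof -
  have e: "(\<lambda>x. x i k) \<in> borel_measurable (PiM {1..r+1} (\<lambda>_. lebesgue_euclid n))" if "i \<in> {1..r+1}" "k < n" for i k
    by (rule measurable_compose[OF measurable_component_singleton[OF that(1)] measurable_lebesgue_euclid_component[OF that(2)]])
  show ?thesis
    unfolding gram_edges_def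
    by (rule borel_measurable_det_mat)
      (intro borel_measurable_sum borel_measurable_times borel_measurable_diff e; simp)
qed

text \<open>The log-volume is half the logarithm of the edge Gram determinant, so the moment
  generating function at \<open>t\<close> comes from the moment of order t/2 of that determinant.
  The domain is set by the factor with n - r + 1 degrees of freedom.\<close>

theorem mgf_centred_log_volume:
  fixes M :: "'a measure" and X :: "nat \<Rightarrow> 'a \<Rightarrow> (nat \<Rightarrow> real)"
  assumes M: "prob_space M" and r: "1 \<le> r" "r \<le> n"
    and ind: "prob_space.indep_vars M (\<lambda>_. borel_euclid n) X {1..r+1}"
    and gauss: "\<And>i. i \<in> {1..r+1} \<Longrightarrow> distr M (borel_euclid n) (X i) = std_gaussian_euclid n"
  defines "Y \<equiv> \<lambda>\<omega>. centred_log_volume n r (\<lambda>i. X i \<omega>)"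
  shows "Y \<in> borel_measurable M"
    "Re t + real (n - r) + 1 > 0 \<Longrightarrow> mgf_integrable M Y t"
    "Re t + real (n - r) + 1 > 0 \<Longrightarrow> mgf M Y t
       = exp (- t * of_real (m_seq n - m_seq (n - r) + 1/2 * ln ((real r + 1) * real (n - r) / real n)))
         * exp (t / 2 * of_real (ln (real r + 1))) * (\<Prod>k\<in>{n - r<..n}. chi_moment (t / 2) k)"
proof -
  interpret M: prob_space M by fact
  let ?I = "{1..r+1}"
  let ?P = "PiM ?I (\<lambda>_. std_gaussian_euclid n)"
  let ?D = "\<lambda>x. Determinant.det (gram_edges n r x)"
  let ?b = "m_seq n - m_seq (n - r) + 1/2 * ln ((real r + 1) * real (n - r) / real n)"
  let ?W = "\<lambda>\<omega>. \<lambda>i\<in>?I. X i \<omega>"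
  have Xm: "X i \<in> measurable M (borel_euclid n)" if "i \<in> ?I" for i
    using ind that by (simp add: M.indep_vars_def)
  have sP: "sets (PiM ?I (\<lambda>_. borel_euclid n)) = sets (PiM ?I (\<lambda>_. lebesgue_euclid n))"
    "sets ?P = sets (PiM ?I (\<lambda>_. lebesgue_euclid n))"
    by (intro sets_PiM_cong refl; simp add: sets_borel_euclid)+
  have W: "?W \<in> measurable M (PiM ?I (\<lambda>_. borel_euclid n))"
    by (intro measurable_restrict Xm)
  have WP: "?W \<in> measurable M ?P"
    using W measurable_cong_sets[OF refl, of "PiM ?I (\<lambda>_. borel_euclid n)" ?P M] sP by blast
  have "distr M (PiM ?I (\<lambda>_. borel_euclid n)) ?W = PiM ?I (\<lambda>i. distr M (borel_euclid n) (X i))"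
    using ind by (subst (asm) M.indep_vars_iff_distr_eq_PiM') (use Xm in auto)
  also have "\<dots> = ?P" by (intro PiM_cong refl gauss)
  finally have law: "distr M ?P ?W = ?P"
    using sP distr_cong[OF refl, of "PiM ?I (\<lambda>_. borel_euclid n)" ?P M ?W ?W] by simp
  have Dm: "?D \<in> borel_measurable ?P"
    using borel_measurable_det_gram_edges[of n r] measurable_cong_sets[OF sP(2) refl, of borel] by blast
  have DWm: "(\<lambda>\<omega>. ?D (?W \<omega>)) \<in> borel_measurable M" by (rule measurable_compose[OF WP Dm])
  \<comment> \<open>Only the vertices 1, ..., r + 1 enter the determinant; the family restricted to
    them has a product law.\<close>
  have DW: "?D (\<lambda>i. X i \<omega>) = ?D (?W \<omega>)" for \<omega>
    by (intro arg_cong[where f = Determinant.det]) (auto simp: gram_edges_def intro!: eq_matI sum.cong)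
  have Y: "Y = (\<lambda>\<omega>. 1/2 * ln (?D (?W \<omega>)) - ?b)"
    by (simp only: Y_def centred_log_volume_def log_volume_gram[OF r(2)] DW) (simp add: algebra_simps)
  show "Y \<in> borel_measurable M"
    unfolding Y by (intro borel_measurable_diff borel_measurable_times borel_measurable_const borel_measurable_ln DWm)
  assume t: "Re t + real (n - r) + 1 > 0"
  let ?s = "t / 2"
  define m where "m = n - r"
  have n: "n = m + r" using r by (simp add: m_def)
  have "Re ?s + real (m + 1) / 2 > 0" using t by (simp add: m_def add_divide_distrib)
  note G = log_moment_det_gram[OF this, of r]
  have lawD: "distr M borel (\<lambda>\<omega>. ?D (?W \<omega>)) = distr (gauss_rows r n) borel (\<lambda>z. (real r + 1) * Determinant.det (gram n r z))"
  proof -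
    have "distr M borel (\<lambda>\<omega>. ?D (?W \<omega>)) = distr (distr M ?P ?W) borel ?D"
      by (subst distr_distr[OF Dm WP]) (simp add: comp_def)
    then show ?thesis using r by (simp only: law distr_det_gram_edges[of n r])
  qed
  let ?e = "\<lambda>t. exp (?s * complex_of_real (ln t))"
  have dm: "(\<lambda>z. Determinant.det (gram n r z)) \<in> borel_measurable (gauss_rows r n)" by simp
  have dm': "(\<lambda>z. (real r + 1) * Determinant.det (gram n r z)) \<in> borel_measurable (gauss_rows r n)"
    by (intro borel_measurable_times borel_measurable_const dm)
  have ae: "AE z in gauss_rows r n. ?e ((real r + 1) * Determinant.det (gram n r z)) = ?e (real r + 1) * ?e (Determinant.det (gram n r z))"
  proof -
    have "AE z in gauss_rows r n. Determinant.det (gram n r z) > 0" using conjunct1[OF G] by (simp only: n)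
    then show ?thesis by eventually_elim (simp add: ln_mult distrib_left exp_add)
  qed
  have Gi: "integrable (gauss_rows r n) (\<lambda>z. ?e (Determinant.det (gram n r z)))"
    "(LINT z|gauss_rows r n. ?e (Determinant.det (gram n r z))) = (\<Prod>k\<in>{m<..n}. chi_moment ?s k)"
    using G log_moment_distr[OF dm] n by simp_all
  have "integrable (gauss_rows r n) (\<lambda>z. ?e ((real r + 1) * Determinant.det (gram n r z)))
      \<longleftrightarrow> integrable (gauss_rows r n) (\<lambda>z. ?e (real r + 1) * ?e (Determinant.det (gram n r z)))"
    by (rule integrable_cong_AE[OF _ _ ae])
      (intro measurable_compose[OF dm' measurable_exp_ln] borel_measurable_times borel_measurable_const
        measurable_compose[OF dm measurable_exp_ln])+
  moreover have "(LINT z|gauss_rows r n. ?e ((real r + 1) * Determinant.det (gram n r z)))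
      = (LINT z|gauss_rows r n. ?e (real r + 1) * ?e (Determinant.det (gram n r z)))"
    by (rule integral_cong_AE[OF _ _ ae])
      (intro measurable_compose[OF dm' measurable_exp_ln] borel_measurable_times borel_measurable_const
        measurable_compose[OF dm measurable_exp_ln])+
  ultimately have "log_moment (distr (gauss_rows r n) borel (\<lambda>z. (real r + 1) * Determinant.det (gram n r z))) ?s
      (?e (real r + 1) * (\<Prod>k\<in>{m<..n}. chi_moment ?s k))"
    using Gi by (simp add: log_moment_distr[OF dm'])
  then have LM: "integrable M (\<lambda>\<omega>. ?e (?D (?W \<omega>)))"
    "(LINT \<omega>|M. ?e (?D (?W \<omega>))) = ?e (real r + 1) * (\<Prod>k\<in>{m<..n}. chi_moment ?s k)"
    unfolding lawD[symmetric] using log_moment_distr[OF DWm] by blast+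
  have eY: "exp (t * complex_of_real (Y \<omega>)) = exp (- t * of_real ?b) * ?e (?D (?W \<omega>))" for \<omega>
    unfolding Y exp_add[symmetric] by (simp add: algebra_simps)
  show "mgf_integrable M Y t"
    unfolding mgf_integrable_def eY by (intro integrable_mult_right LM)
  show "mgf M Y t = exp (- t * of_real ?b) * ?e (real r + 1) * (\<Prod>k\<in>{n - r<..n}. chi_moment ?s k)"
    unfolding mgf_def eY integral_mult_right_zero LM(2) m_def by (simp only: mult.assoc)
qed

section \<open>Ratios of Gamma functions\<close>

lemma Ln_approx_quadratic:
  fixes z :: complex
  assumes z: "norm z \<le> 1/2"
  shows "norm (ln (1 + z) - (z - z\<^sup>2 / 2)) \<le> 2 * norm z ^ 3"
proof -
  let ?f = "\<lambda>n. - ((- z) ^ n) / of_nat n"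
  have "?f sums ln (1 + z)" using z by (intro Ln_series') auto
  from sums_split_initial_segment[OF this, of 3]
  have "(\<lambda>i. ?f (i + 3)) sums (ln (1 + z) - (\<Sum>i<3. ?f i))" .
  also have "(\<Sum>i<3. ?f i) = z - z\<^sup>2 / 2" by (simp add: numeral_3_eq_3 power2_eq_square)
  finally have s: "(\<lambda>i. ?f (i + 3)) sums (ln (1 + z) - (z - z\<^sup>2 / 2))" .
  have g: "(\<lambda>i. norm z ^ 3 * norm z ^ i) sums (norm z ^ 3 * (1 / (1 - norm z)))"
    using z by (intro sums_mult geometric_sums) auto
  have n: "norm (?f (i + 3)) \<le> norm z ^ 3 * norm z ^ i" for i
  proof -
    have "norm (?f (i + 3)) = norm z ^ (i + 3) / real (i + 3)"
      by (simp only: norm_divide norm_minus_cancel norm_power norm_of_nat)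
    also have "\<dots> \<le> norm z ^ (i + 3) / 1" by (intro divide_left_mono) auto
    finally show ?thesis by (simp add: power_add mult.commute)
  qed
  have "norm (ln (1 + z) - (z - z\<^sup>2 / 2)) \<le> norm z ^ 3 * (1 / (1 - norm z))"
    by (rule norm_sums_le[OF s g n])
  also have "\<dots> \<le> norm z ^ 3 * 2"
    using z by (intro mult_left_mono) (auto simp: field_simps)
  finally show ?thesis by simp
qed

lemma ln_approx_quadratic:
  fixes x :: real
  assumes x: "\<bar>x\<bar> \<le> 1/2"
  shows "\<bar>ln (1 + x) - (x - x\<^sup>2 / 2)\<bar> \<le> 2 * \<bar>x\<bar> ^ 3"
proof -
  have e: "ln (1 + complex_of_real x) - (complex_of_real x - (complex_of_real x)\<^sup>2 / 2) = of_real (ln (1 + x) - (x - x\<^sup>2 / 2))"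
    using x Ln_of_real[of "1 + x"] by simp
  have "norm (complex_of_real (ln (1 + x) - (x - x\<^sup>2 / 2))) \<le> 2 * norm (complex_of_real x) ^ 3"
    unfolding e[symmetric] using x by (intro Ln_approx_quadratic) simp
  then show ?thesis by (simp only: norm_of_real)
qed

text \<open>A logarithm of Q(x + 1) / Q(x), where Q(x) is Gamma(x + s) / Gamma(x) divided by exp (s
  ln x + s (s - 1) / (2x)); the Gamma quotients contribute 1 + s/x.\<close>

definition ln_Gamma_step :: "complex \<Rightarrow> real \<Rightarrow> complex" where
  "ln_Gamma_step s x = ln (1 + s / of_real x) - s * of_real (ln (1 + 1 / x))
     - s * (s - 1) / 2 * of_real (1 / (x + 1) - 1 / x)"

text \<open>The terms of order 1/x and 1/x^2 cancel, which is what the coefficient s (s - 1) / 2 is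
  chosen for. The three parts of the constant bound the cubic tail of the complex logarithm, that of
  the real one, and the difference between 1/(x + 1) - 1/x and -1/x^2.\<close>

lemma norm_ln_Gamma_step:
  assumes s: "norm s \<le> K" and x: "x \<ge> 2" "x \<ge> 2 * K"
  shows "norm (ln_Gamma_step s x) \<le> (2 * K ^ 3 + 2 * K + K * (K + 1)) / x ^ 3"
proof -
  have K: "K \<ge> 0" using norm_ge_zero s by (rule order_trans)
  let ?x = "complex_of_real x"
  have x0: "x > 0" "?x \<noteq> 0" using x by auto
  define a where "a = ln (1 + s / ?x) - (s / ?x - (s / ?x)\<^sup>2 / 2)"
  define b where "b = ln (1 + 1 / x) - (1 / x - (1 / x)\<^sup>2 / 2)"
  have "norm (s / ?x) \<le> 1 / 2"
    using s x x0 by (simp add: norm_divide field_simps)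
  from Ln_approx_quadratic[OF this] have "norm a \<le> 2 * norm (s / ?x) ^ 3"
    by (simp add: a_def)
  also have "\<dots> = 2 * norm s ^ 3 / x ^ 3" using x0 by (simp add: norm_divide power_divide)
  also have "\<dots> \<le> 2 * K ^ 3 / x ^ 3"
    using s x0 by (intro divide_right_mono mult_left_mono power_mono) auto
  finally have a: "norm a \<le> 2 * K ^ 3 / x ^ 3" .
  have "\<bar>b\<bar> \<le> 2 * \<bar>1 / x\<bar> ^ 3" unfolding b_def using x by (intro ln_approx_quadratic) (simp add: field_simps)
  also have "\<dots> = 2 / x ^ 3" using x0 by (simp add: power_divide)
  finally have b: "\<bar>b\<bar> \<le> 2 / x ^ 3" .
  have d: "1 / (x + 1) - 1 / x = - (1 / x\<^sup>2) + 1 / (x\<^sup>2 * (x + 1))"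
    using x0 by (simp add: divide_simps) (simp add: algebra_simps power2_eq_square)
  have e: "ln_Gamma_step s x = a - s * of_real b - s * (s - 1) / 2 * of_real (1 / (x\<^sup>2 * (x + 1)))"
  proof -
    have "ln (1 + s / ?x) = a + (s / ?x - (s / ?x)\<^sup>2 / 2)" by (simp add: a_def)
    moreover have "ln (1 + 1 / x) = b + (1 / x - (1 / x)\<^sup>2 / 2)" by (simp add: b_def)
    ultimately have "ln_Gamma_step s x = a + (s / ?x - (s / ?x)\<^sup>2 / 2) - s * of_real (b + (1 / x - (1 / x)\<^sup>2 / 2))
        - s * (s - 1) / 2 * of_real (- (1 / x\<^sup>2) + 1 / (x\<^sup>2 * (x + 1)))"
      unfolding ln_Gamma_step_def d by simp
    also have "\<dots> = a - s * of_real b - s * (s - 1) / 2 * of_real (1 / (x\<^sup>2 * (x + 1)))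
        + (s / ?x - (s / ?x)\<^sup>2 / 2 - s * (1 / ?x - (1 / ?x)\<^sup>2 / 2) + s * (s - 1) / 2 * (1 / ?x\<^sup>2))"
      by (simp add: algebra_simps)
    also have "s / ?x - (s / ?x)\<^sup>2 / 2 - s * (1 / ?x - (1 / ?x)\<^sup>2 / 2) + s * (s - 1) / 2 * (1 / ?x\<^sup>2) = 0"
      using x0 by (simp add: field_simps power2_eq_square)
    finally show ?thesis by simp
  qed
  have c: "norm (s * (s - 1) / 2 * of_real (1 / (x\<^sup>2 * (x + 1)))) \<le> K * (K + 1) / x ^ 3"
  proof -
    have "norm (s * (s - 1) / 2 * of_real (1 / (x\<^sup>2 * (x + 1)))) = norm s * norm (s - 1) / 2 * (1 / (x\<^sup>2 * (x + 1)))"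
      using x0 by (simp add: norm_mult norm_divide norm_power)
    also have "\<dots> \<le> K * (K + 1) * (1 / x ^ 3)"
    proof (intro mult_mono)
      have "norm (s - 1) \<le> K + 1" using norm_triangle_ineq4[of s 1] s by simp
      then have "norm s * norm (s - 1) \<le> K * (K + 1)" using s K by (intro mult_mono) auto
      moreover have "norm s * norm (s - 1) \<ge> 0" by simp
      ultimately show "norm s * norm (s - 1) / 2 \<le> K * (K + 1)" by linarith
      have "x ^ 3 \<le> x\<^sup>2 * (x + 1)" using x0 by (simp add: power2_eq_square power3_eq_cube algebra_simps)
      then show "1 / (x\<^sup>2 * (x + 1)) \<le> 1 / x ^ 3" using x0 by (intro divide_left_mono) auto
    qed (use K x0 in auto)
    finally show ?thesis by simp
  qed
  have "norm (s * of_real b) \<le> K * (2 / x ^ 3)"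
    unfolding norm_mult norm_of_real using s b K by (intro mult_mono) auto
  then have "norm (ln_Gamma_step s x) \<le> 2 * K ^ 3 / x ^ 3 + K * (2 / x ^ 3) + K * (K + 1) / x ^ 3"
    unfolding e using a c by (intro order_trans[OF norm_triangle_ineq4] add_mono) auto
  also have "\<dots> = (2 * K ^ 3 + 2 * K + K * (K + 1)) / x ^ 3" by (simp add: add_divide_distrib)
  finally show ?thesis .
qed

text \<open>Telescoping with 1/x^3 <= 1/(x - 1)^2 - 1/x^2; the 4 comes from z - 1 >= z/2.\<close>

lemma sum_inverse_cube_le:
  assumes "z \<ge> (2::real)"
  shows "(\<Sum>j<N. 1 / (z + real j) ^ 3) \<le> 4 / z\<^sup>2"
proof -
  have "(\<Sum>j<N. 1 / (z + real j) ^ 3) \<le> 1 / (z - 1)\<^sup>2 - 1 / (z + real N - 1)\<^sup>2"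
  proof (induction N)
    case (Suc N)
    let ?x = "z + real N"
    have x: "?x \<ge> 2" using assms by simp
    have "1 / ?x ^ 3 \<le> 1 / (?x - 1)\<^sup>2 - 1 / ?x\<^sup>2"
    proof -
      have p: "(?x - 1)\<^sup>2 > 0" "?x\<^sup>2 > 0" "?x > 0" using x by auto
      have "1 / (?x - 1)\<^sup>2 - 1 / ?x\<^sup>2 = (2 * ?x - 1) / ((?x - 1)\<^sup>2 * ?x\<^sup>2)"
        using p by (simp add: divide_simps) (simp add: algebra_simps power2_eq_square)
      also have "\<dots> \<ge> ?x / (?x\<^sup>2 * ?x\<^sup>2)"
        using x p by (intro frac_le mult_right_mono power_mono mult_pos_pos) auto
      also have "?x / (?x\<^sup>2 * ?x\<^sup>2) = 1 / ?x ^ 3" using p by (simp add: power2_eq_square power3_eq_cube)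
      finally show ?thesis .
    qed
    then show ?case using Suc by (simp add: algebra_simps)
  qed simp
  also have "\<dots> \<le> 1 / (z - 1)\<^sup>2" by simp
  also have "\<dots> \<le> 1 / (z / 2)\<^sup>2" using assms by (intro divide_left_mono power_mono mult_pos_pos) auto
  finally show ?thesis by (simp add: power_divide)
qed

lemma pos_Re_notin_nonpos_Ints: "Re z > 0 \<Longrightarrow> z \<notin> \<int>\<^sub>\<le>\<^sub>0"
  by (auto elim!: nonpos_Ints_cases)

lemma Gamma_add_of_nat:
  fixes z :: complex
  assumes "Re z > 0"
  shows "Gamma (z + of_nat N) = pochhammer z N * Gamma z"
proof (induction N)
  case (Suc N)
  have "Re (z + of_nat N) > 0" using assms by simp
  then have "Gamma (z + of_nat N + 1) = (z + of_nat N) * Gamma (z + of_nat N)"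
    by (intro Gamma_plus1 pos_Re_notin_nonpos_Ints)
  then show ?case using Suc by (simp add: pochhammer_Suc add_ac)
qed simp

text \<open>The remainder \<open>h\<close> in the ratio asymptotics satisfies \<open>h(z + 1) - h(z) =\<close> \<open>ln_Gamma_step s z\<close>
  and vanishes at infinity, so it is a convergent sum of third-order terms.\<close>

theorem Gamma_ratio_asymptotics:
  fixes s :: complex
  assumes s: "norm s \<le> K" and z: "z \<ge> 2" "z \<ge> 2 * K"
  defines "C \<equiv> 2 * K ^ 3 + 2 * K + K * (K + 1)"
  shows "\<exists>h. norm h \<le> 4 * C / z\<^sup>2 \<and>
    Gamma (of_real z + s) / Gamma (of_real z)
      = exp (s * of_real (ln z) + s * (s - 1) / (2 * of_real z) + h)"
proof -
  have K: "K \<ge> 0" using norm_ge_zero s by (rule order_trans)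
  have C: "C \<ge> 0" using K by (simp add: C_def)
  have Res: "Re (of_real x + s) > 0" if "x \<ge> z" for x
  proof -
    have "\<bar>Re s\<bar> \<le> K" using abs_Re_le_cmod[of s] s by simp
    then show ?thesis using z that by simp
  qed
  \<comment> \<open>The Gamma quotient over its main term; the claim is that Q(z) is the exponential
    of a small number.\<close>
  define Q where "Q x = Gamma (of_real x + s) / Gamma (of_real x)
      * exp (- s * of_real (ln x) - s * (s - 1) / (2 * of_real x))" for x :: real
  have step: "Q (x + 1) = Q x * exp (ln_Gamma_step s x)" if x: "x \<ge> z" for x
  proof -
    have x0: "x > 0" using x z by simp
    have G1: "Gamma (of_real (x + 1) + s) = (of_real x + s) * Gamma (of_real x + s)"
      using Gamma_plus1[of "of_real x + s"] pos_Re_notin_nonpos_Ints[OF Res[OF x]] by (simp add: add_ac)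
    have G2: "Gamma (complex_of_real (x + 1)) = of_real x * Gamma (of_real x)"
      using Gamma_plus1[of "complex_of_real x"] pos_Re_notin_nonpos_Ints[of "of_real x"] x0 by simp
    have "1 + s / of_real x = (of_real x + s) / of_real x" using x0 by (simp add: field_simps)
    moreover have "of_real x + s \<noteq> 0" using Res[OF x] by (metis less_irrefl zero_complex.sel(1))
    ultimately have eL: "exp (ln (1 + s / of_real x)) = (of_real x + s) / of_real x"
      using x0 by simp
    have lnx: "ln (1 + 1 / x) = ln (x + 1) - ln x"
    proof -
      have "1 + 1 / x = (x + 1) / x" using x0 by (simp add: field_simps)
      then show ?thesis using x0 by (simp add: ln_div)
    qed
    have "exp (ln_Gamma_step s x) = (of_real x + s) / of_real x
        * exp (- s * of_real (ln (x + 1)) - s * (s - 1) / (2 * of_real (x + 1))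
           - (- s * of_real (ln x) - s * (s - 1) / (2 * of_real x)))"
    proof -
      have "ln_Gamma_step s x = ln (1 + s / of_real x) + (- s * of_real (ln (x + 1)) - s * (s - 1) / (2 * of_real (x + 1))
           - (- s * of_real (ln x) - s * (s - 1) / (2 * of_real x)))"
        unfolding ln_Gamma_step_def lnx by (simp add: right_diff_distrib)
      then show ?thesis by (simp only: exp_add eL)
    qed
    moreover have "a * G / (b * H) * e' = G / H * e * (a / b * d)" if "e * d = e'" for a b G H e e' d :: complex
      unfolding that[symmetric] by (simp add: mult_ac)
    ultimately show ?thesis
      unfolding Q_def G1 G2 by (simp only: exp_add[symmetric] add_diff_cancel_left' add.commute[of "- s * of_real (ln x) - _"] diff_add_cancel)
  qed
  have QN: "Q (z + real N) = Q z * exp (\<Sum>j<N. ln_Gamma_step s (z + real j))" for N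
  proof (induction N)
    case (Suc N)
    have "Q (z + real (Suc N)) = Q (z + real N) * exp (ln_Gamma_step s (z + real N))"
      using step[of "z + real N"] by (simp add: add_ac)
    then show ?case by (simp add: Suc exp_add)
  qed simp
  have bound: "norm (ln_Gamma_step s (z + real j)) \<le> C / (z + real j) ^ 3" for j
    unfolding C_def by (rule norm_ln_Gamma_step) (use s z in auto)
  have sb: "(\<Sum>j<N. norm (ln_Gamma_step s (z + real j))) \<le> 4 * C / z\<^sup>2" for N
  proof -
    have "(\<Sum>j<N. norm (ln_Gamma_step s (z + real j))) \<le> (\<Sum>j<N. C * (1 / (z + real j) ^ 3))"
      using bound by (intro sum_mono) simp
    also have "\<dots> \<le> C * (4 / z\<^sup>2)"
      unfolding sum_distrib_left[symmetric] by (intro mult_left_mono sum_inverse_cube_le z C)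
    finally show ?thesis by (simp add: mult.commute)
  qed
  have sm: "summable (\<lambda>j. norm (ln_Gamma_step s (z + real j)))"
    by (rule summableI_nonneg_bounded[of _ "4 * C / z\<^sup>2"]) (use sb in auto)
  define S where "S = (\<Sum>j. ln_Gamma_step s (z + real j))"
  have "norm S \<le> (\<Sum>j. norm (ln_Gamma_step s (z + real j)))"
    unfolding S_def by (rule summable_norm[OF sm])
  also have "\<dots> \<le> 4 * C / z\<^sup>2" by (rule suminf_le_const[OF sm sb])
  finally have S: "norm S \<le> 4 * C / z\<^sup>2" .
  have lim1: "(\<lambda>N. Q (z + real N)) \<longlonglongrightarrow> Q z * exp S"
    unfolding QN S_def by (intro tendsto_intros summable_LIMSEQ summable_norm_cancel[OF sm])
  \<comment> \<open>Euler's limit formula, in the form of \<open>Gamma_series'\<close>, gives this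
    limit directly: the factorials cancel in the quotient of the two series, and the power of N is
    absorbed by that of z + N. Comparison with \<open>lim1\<close> identifies Q(z) as exp (-
    S).\<close>
  have lim2: "(\<lambda>N. Q (z + real N)) \<longlonglongrightarrow> 1"
  proof -
    let ?z = "complex_of_real z"
    have nz: "Gamma ?z \<noteq> 0" "Gamma (?z + s) \<noteq> 0"
      using pos_Re_notin_nonpos_Ints[of ?z] pos_Re_notin_nonpos_Ints[OF Res[OF order_refl]] z
      by (auto simp: Gamma_eq_zero_iff)
    have "(\<lambda>N. Gamma (?z + s) / Gamma_series' (?z + s) N * (Gamma_series' ?z N / Gamma ?z)
        * exp (- s * of_real (ln (z + real N) - ln (real N)) - s * (s - 1) / (2 * of_real (z + real N)))) \<longlonglongrightarrow>
        Gamma (?z + s) / Gamma (?z + s) * (Gamma ?z / Gamma ?z) * exp (- s * of_real 0 - 0)"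
    proof (intro tendsto_intros Gamma_series'_LIMSEQ nz)
      show "(\<lambda>N. ln (z + real N) - ln (real N)) \<longlonglongrightarrow> 0"
      proof (rule Lim_transform_eventually)
        show "(\<lambda>N. ln (1 + z / real N)) \<longlonglongrightarrow> 0"
          using tendsto_ln[OF tendsto_add[OF tendsto_const[of 1] lim_const_over_n[of z]]] by simp
        show "\<forall>\<^sub>F N in sequentially. ln (1 + z / real N) = ln (z + real N) - ln (real N)"
          using eventually_gt_at_top[of 0]
        proof eventually_elim
          case (elim N)
          have "1 + z / real N = (z + real N) / real N" using elim by (simp add: field_simps)
          then show ?case using elim z by (simp add: ln_div)
        qed
      qed
      have "filterlim (\<lambda>N. 2 * (z + real N)) at_top sequentially"
        by (intro filterlim_tendsto_pos_mult_at_top[of _ 2] tendsto_const filterlim_tendsto_add_at_top[of _ z]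
            filterlim_real_sequentially) auto
      then have "(\<lambda>N. inverse (2 * (z + real N))) \<longlonglongrightarrow> 0" by (rule tendsto_inverse_0_at_top)
      then have "(\<lambda>N. s * (s - 1) * of_real (inverse (2 * (z + real N)))) \<longlonglongrightarrow> s * (s - 1) * of_real 0"
        by (intro tendsto_intros)
      then show "(\<lambda>N. s * (s - 1) / (2 * of_real (z + real N))) \<longlonglongrightarrow> 0"
        by (simp add: divide_inverse)
    qed
    also have "Gamma (?z + s) / Gamma (?z + s) * (Gamma ?z / Gamma ?z) * exp (- s * of_real 0 - 0) = 1"
      using nz by simp
    finally have L: "(\<lambda>N. Gamma (?z + s) / Gamma_series' (?z + s) N * (Gamma_series' ?z N / Gamma ?z)
        * exp (- s * of_real (ln (z + real N) - ln (real N)) - s * (s - 1) / (2 * of_real (z + real N)))) \<longlonglongrightarrow> 1" .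
    show ?thesis
    proof (rule Lim_transform_eventually[OF L])
      show "\<forall>\<^sub>F N in sequentially. Gamma (?z + s) / Gamma_series' (?z + s) N * (Gamma_series' ?z N / Gamma ?z)
        * exp (- s * of_real (ln (z + real N) - ln (real N)) - s * (s - 1) / (2 * of_real (z + real N))) = Q (z + real N)"
        using eventually_gt_at_top[of 0]
      proof eventually_elim
        case (elim N)
        have p: "pochhammer ?z N \<noteq> 0" "pochhammer (?z + s) N \<noteq> 0"
          using pos_Re_notin_nonpos_Ints[of ?z] pos_Re_notin_nonpos_Ints[OF Res[OF order_refl]] z
          by (auto simp: pochhammer_eq_0_iff)
        have g1: "Gamma (complex_of_real (z + real N) + s) = pochhammer (?z + s) N * Gamma (?z + s)"
          using Gamma_add_of_nat[OF Res[OF order_refl], of N] by (simp add: add_ac)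
        have g2: "Gamma (complex_of_real (z + real N)) = pochhammer ?z N * Gamma ?z"
          using Gamma_add_of_nat[of ?z N] z by simp
        let ?l = "complex_of_real (ln (real N))"
        have "exp (?z * ?l) / exp ((?z + s) * ?l) = exp (- s * ?l)"
          by (simp add: exp_diff[symmetric] algebra_simps)
        moreover have "exp (- s * of_real (ln (z + real N) - ln (real N)) - s * (s - 1) / (2 * of_real (z + real N)))
            = exp (- s * of_real (ln (z + real N)) - s * (s - 1) / (2 * of_real (z + real N))) / exp (- s * ?l)"
          by (simp add: exp_diff[symmetric] algebra_simps)
        ultimately show ?case
          unfolding Q_def g1 g2 Gamma_series'_def using p nz by (simp add: field_simps)
      qed
    qed
  qed
  have "Q z * exp S = 1" by (rule LIMSEQ_unique[OF lim1 lim2])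
  then have "Q z = exp (- S)" by (simp add: exp_minus field_simps)
  then have "Gamma (of_real z + s) / Gamma (of_real z)
      = exp (- S) / exp (- s * of_real (ln z) - s * (s - 1) / (2 * of_real z))"
    by (simp add: Q_def field_simps)
  also have "\<dots> = exp (s * of_real (ln z) + s * (s - 1) / (2 * of_real z) + (- S))"
    by (simp add: exp_diff[symmetric] algebra_simps)
  finally show ?thesis using S by (intro exI[of _ "- S"]) simp
qed

section \<open>Mod-Gaussian convergence\<close>

text \<open>Twice the increment of \<open>m_seq\<close> is the increment of Stirling's approximation
  to ln k!, hence close to ln k. Everything is expanded in u = 1/k, with \<open>e\<close> the cubic
  remainder of ln (1 - u).\<close>

lemma m_seq_increment:
  assumes k: "k \<ge> 2"
  shows "\<bar>ln (real k) - 2 * (m_seq k - m_seq (k - 1))\<bar> \<le> 3 / (real k)\<^sup>2"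
    "\<bar>1 / real k - (ln (real k) - ln (real (k - 1)))\<bar> \<le> 2 / (real k)\<^sup>2"
proof -
  let ?k = "real k"
  define u where "u = 1 / ?k"
  define e where "e = ln (1 - u) - (- u - u\<^sup>2 / 2)"
  have k1: "?k \<ge> 2" using k by simp
  have u: "0 < u" "u \<le> 1/2" "?k * u = 1" using k1 by (auto simp: u_def field_simps)
  have "\<bar>e\<bar> \<le> 2 * \<bar>- u\<bar> ^ 3"
    using ln_approx_quadratic[of "- u"] u by (simp add: e_def)
  then have e: "\<bar>e\<bar> \<le> 2 * u ^ 3" using u by simp
  have km: "real (k - 1) = ?k - 1" using k by (simp add: of_nat_diff)
  have "1 - u = (?k - 1) / ?k" using k1 by (simp add: u_def field_simps)
  then have L: "ln (?k - 1) = ln ?k + (- u - u\<^sup>2 / 2 + e)"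
    using k1 by (simp add: e_def ln_div)
  have "ln ?k - 2 * (m_seq k - m_seq (k - 1)) = (?k - 1/2) * (- u - u\<^sup>2 / 2 + e) + 1"
    unfolding m_seq_def km L by (simp add: algebra_simps add_divide_distrib diff_divide_distrib)
  \<comment> \<open>Since k u = 1, the constant terms and the terms of order u cancel; the error (k
    - 1/2) e is of order u^2 as well.\<close>
  also have "\<dots> = u\<^sup>2 / 4 + (?k - 1/2) * e"
  proof -
    have "(?k - 1/2) * (- u - u\<^sup>2 / 2 + e) + 1 = - (?k * u) - (?k * u) * u / 2 + u / 2 + u\<^sup>2 / 4 + (?k - 1/2) * e + 1"
      by (simp add: algebra_simps power2_eq_square)
    then show ?thesis by (simp add: u(3))
  qed
  finally have 1: "ln ?k - 2 * (m_seq k - m_seq (k - 1)) = u\<^sup>2 / 4 + (?k - 1/2) * e" .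
  have "\<bar>(?k - 1/2) * e\<bar> \<le> ?k * (2 * u ^ 3)"
    unfolding abs_mult using k1 e by (intro mult_mono) auto
  also have "\<dots> = 2 * u\<^sup>2 * (?k * u)" by (simp add: power2_eq_square power3_eq_cube)
  also have "\<dots> = 2 * u\<^sup>2" by (simp add: u(3))
  finally have "\<bar>(?k - 1/2) * e\<bar> \<le> 2 * u\<^sup>2" .
  moreover have "u\<^sup>2 \<ge> 0" by simp
  ultimately have "\<bar>ln ?k - 2 * (m_seq k - m_seq (k - 1))\<bar> \<le> 3 * u\<^sup>2"
    unfolding 1 by linarith
  then show "\<bar>ln ?k - 2 * (m_seq k - m_seq (k - 1))\<bar> \<le> 3 / ?k\<^sup>2"
    by (simp add: u_def power_divide)
  have "u ^ 3 = u * u\<^sup>2" by (simp add: power2_eq_square power3_eq_cube)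
  also have "\<dots> \<le> 1/2 * u\<^sup>2" using u by (intro mult_right_mono) auto
  finally have "u ^ 3 \<le> u\<^sup>2 / 2" by simp
  moreover have "1 / ?k - (ln ?k - ln (real (k - 1))) = - u\<^sup>2 / 2 + e"
    unfolding km L by (simp add: u_def)
  ultimately have "\<bar>1 / ?k - (ln ?k - ln (real (k - 1)))\<bar> \<le> 2 * u\<^sup>2"
    using e \<open>u\<^sup>2 \<ge> 0\<close> by linarith
  then show "\<bar>1 / ?k - (ln ?k - ln (real (k - 1)))\<bar> \<le> 2 / ?k\<^sup>2"
    by (simp add: u_def power_divide)
qed

definition log_norming :: "complex \<Rightarrow> nat \<Rightarrow> complex" where
  "log_norming t k = t * of_real (m_seq k) + (t\<^sup>2 / 4 - t / 2) * of_real (ln (real k))"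

text \<open>The Gamma ratio at z = k/2 and s = t/2; its ln (k/2) absorbs the \<open>ln 2\<close> of
  \<open>chi_moment\<close>. In \<open>C\<close>, the 16 is 4 divided by the (1/2)^2 coming from z,
  the 3 and the last 2 are the constants of \<open>m_seq_increment\<close>, and the bound K/2 on s
  is relaxed to K.\<close>

lemma chi_moment_asymptotics:
  fixes t :: complex
  assumes t: "norm t \<le> K" and k: "k \<ge> 4" "real k \<ge> 2 * K"
  defines "C \<equiv> 16 * (2 * K ^ 3 + 2 * K + K * (K + 1)) + 3 * K + 2 * K * (K + 1)"
  shows "\<exists>h. norm h \<le> C / (real k)\<^sup>2 \<and>
    chi_moment (t / 2) k = exp (log_norming t k - log_norming t (k - 1) + h)"
proof -
  have K: "K \<ge> 0" using norm_ge_zero t by (rule order_trans)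
  let ?s = "t / 2" and ?C0 = "2 * K ^ 3 + 2 * K + K * (K + 1)"
  have s: "norm ?s \<le> K" using t K by (simp add: norm_divide)
  have z: "real k / 2 \<ge> 2" using k by simp
  have s2: "norm ?s \<le> K / 2" using t by (simp add: norm_divide)
  obtain h where h: "norm h \<le> 4 * (2 * (K/2) ^ 3 + 2 * (K/2) + (K/2) * (K/2 + 1)) / (real k / 2)\<^sup>2"
    "Gamma (of_real (real k / 2) + ?s) / Gamma (of_real (real k / 2))
      = exp (?s * of_real (ln (real k / 2)) + ?s * (?s - 1) / (2 * of_real (real k / 2)) + h)"
    using Gamma_ratio_asymptotics[OF s2 z] k by auto
  define a where "a = ln (real k) - 2 * (m_seq k - m_seq (k - 1))"
  define b where "b = 1 / real k - (ln (real k) - ln (real (k - 1)))"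
  define g where "g = h + ?s * of_real a + ?s * (?s - 1) * of_real b"
  have "chi_moment ?s k = exp (?s * of_real (ln 2)) * (Gamma (of_real (real k / 2) + ?s) / Gamma (of_real (real k / 2)))"
    by (simp add: chi_moment_def)
  also have "\<dots> = exp (?s * of_real (ln 2) + (?s * of_real (ln (real k / 2)) + ?s * (?s - 1) / (2 * of_real (real k / 2)) + h))"
    unfolding h(2) exp_add ..
  also have "?s * of_real (ln 2) + (?s * of_real (ln (real k / 2)) + ?s * (?s - 1) / (2 * of_real (real k / 2)) + h)
      = ?s * of_real (ln (real k)) + ?s * (?s - 1) * of_real (1 / real k) + h"
    using k by (simp add: ln_div field_simps)
  also have "\<dots> = log_norming t k - log_norming t (k - 1) + g"
  proof -
    have "ln (real k) = a + 2 * (m_seq k - m_seq (k - 1))" "1 / real k = b + (ln (real k) - ln (real (k - 1)))"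
      by (simp_all add: a_def b_def)
    moreover have "?s * of_real (a + 2 * (m_seq k - m_seq (k - 1)))
        + ?s * (?s - 1) * of_real (b + (ln (real k) - ln (real (k - 1)))) + h
        = log_norming t k - log_norming t (k - 1) + g"
      by (simp add: log_norming_def g_def algebra_simps power2_eq_square)
    ultimately show ?thesis by metis
  qed
  finally have "chi_moment ?s k = exp (log_norming t k - log_norming t (k - 1) + g)" .
  moreover have "norm g \<le> C / (real k)\<^sup>2"
  proof -
    have h': "norm h \<le> 16 * ?C0 / (real k)\<^sup>2"
    proof -
      have "2 * (K/2) ^ 3 + 2 * (K/2) + (K/2) * (K/2 + 1) \<le> ?C0"
        using K by (intro add_mono mult_mono power_mono) auto
      then have "4 * (2 * (K/2) ^ 3 + 2 * (K/2) + (K/2) * (K/2 + 1)) / (real k / 2)\<^sup>2 \<le> 4 * ?C0 / (real k / 2)\<^sup>2"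
        by (intro divide_right_mono) auto
      then show ?thesis using h(1) by (simp add: power_divide)
    qed
    have ab: "\<bar>a\<bar> \<le> 3 / (real k)\<^sup>2" "\<bar>b\<bar> \<le> 2 / (real k)\<^sup>2"
      unfolding a_def b_def using k by (intro m_seq_increment; simp)+
    have "norm (?s * of_real a) \<le> K * (3 / (real k)\<^sup>2)"
      unfolding norm_mult norm_of_real using s ab K by (intro mult_mono) auto
    moreover have "norm (?s * (?s - 1) * of_real b) \<le> K * (K + 1) * (2 / (real k)\<^sup>2)"
    proof -
      have "norm (?s - 1) \<le> K + 1" using norm_triangle_ineq4[of ?s 1] s by simp
      then show ?thesis
        unfolding norm_mult norm_of_real using s ab K by (intro mult_mono mult_nonneg_nonneg) auto
    qed
    ultimately have "norm g \<le> 16 * ?C0 / (real k)\<^sup>2 + K * (3 / (real k)\<^sup>2) + K * (K + 1) * (2 / (real k)\<^sup>2)"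
      unfolding g_def using h' by (intro order_trans[OF norm_triangle_ineq] add_mono) auto
    also have "\<dots> = C / (real k)\<^sup>2" by (simp add: C_def add_divide_distrib)
    finally show ?thesis .
  qed
  ultimately show ?thesis by blast
qed

text \<open>The main terms telescope, and the errors C/k^2 are dominated by C (1/(k - 1) - 1/k). The
  bound keeps this telescoped form so that the induction on \<open>n\<close> closes.\<close>

lemma prod_chi_moment_asymptotics:
  fixes t :: complex
  assumes t: "norm t \<le> K" and m: "m \<ge> 4" "real m \<ge> 2 * K" "m \<le> n"
  defines "C \<equiv> 16 * (2 * K ^ 3 + 2 * K + K * (K + 1)) + 3 * K + 2 * K * (K + 1)"
  shows "\<exists>h. norm h \<le> C * (1 / real m - 1 / real n) \<and>
    (\<Prod>k\<in>{m<..n}. chi_moment (t / 2) k) = exp (log_norming t n - log_norming t m + h)"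
  using \<open>m \<le> n\<close>
proof (induction n rule: dec_induct)
  case base
  show ?case by (intro exI[of _ 0]) simp
next
  case (step n)
  have K: "K \<ge> 0" using norm_ge_zero t by (rule order_trans)
  have C: "C \<ge> 0" using K by (simp add: C_def)
  obtain h where h: "norm h \<le> C * (1 / real m - 1 / real n)"
    "(\<Prod>k\<in>{m<..n}. chi_moment (t / 2) k) = exp (log_norming t n - log_norming t m + h)"
    using step.IH by blast
  obtain g where g: "norm g \<le> C / (real (Suc n))\<^sup>2"
    "chi_moment (t / 2) (Suc n) = exp (log_norming t (Suc n) - log_norming t n + g)"
    using chi_moment_asymptotics[OF t, of "Suc n"] step m unfolding C_def by auto
  have n0: "real n > 0" using step m by simp
  have "1 / (real (Suc n))\<^sup>2 \<le> 1 / (real n * real (Suc n))"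
    using n0 by (intro divide_left_mono) (auto simp: power2_eq_square)
  also have "\<dots> = 1 / real n - 1 / real (Suc n)" using n0 by (simp add: field_simps)
  finally have "C * (1 / (real (Suc n))\<^sup>2) \<le> C * (1 / real n - 1 / real (Suc n))"
    using C by (rule mult_left_mono)
  then have "norm (h + g) \<le> C * (1 / real m - 1 / real (Suc n))"
    using h(1) g(1) norm_triangle_ineq[of h g] by (simp add: right_diff_distrib)
  moreover have "{m<..Suc n} = insert (Suc n) {m<..n}" using step by auto
  then have "(\<Prod>k\<in>{m<..Suc n}. chi_moment (t / 2) k) = exp (log_norming t (Suc n) - log_norming t m + (h + g))"
    by (simp add: h(2) g(2) exp_add[symmetric] algebra_simps)
  ultimately show ?case by blast
qed

lemma norm_exp_minus_one_le: "norm (exp z - 1) \<le> exp (norm z) - (1::real)" for z :: complex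
proof -
  have "(\<lambda>n. z ^ n /\<^sub>R fact n) sums exp z" by (rule exp_converges)
  from sums_split_initial_segment[OF this, of 1]
  have 1: "(\<lambda>n. z ^ (n + 1) /\<^sub>R fact (n + 1)) sums (exp z - 1)" by simp
  have "(\<lambda>n. norm z ^ n /\<^sub>R fact n) sums exp (norm z)" by (rule exp_converges)
  from sums_split_initial_segment[OF this, of 1]
  have 2: "(\<lambda>n. norm z ^ (n + 1) /\<^sub>R fact (n + 1)) sums (exp (norm z) - 1)" by simp
  show ?thesis
    by (rule norm_sums_le[OF 1 2]) (simp add: norm_power abs_inverse del: power_Suc fact_Suc)
qed

section \<open>The standard Gaussian as reference law\<close>

lemma real_distribution_std_gaussian: "real_distribution std_gaussian"
  unfolding real_distribution_def real_distribution_axioms_def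
  using prob_space_std_gaussian by simp

lemma infinitely_divisible_std_gaussian: "infinitely_divisible std_gaussian"
  unfolding infinitely_divisible_def
proof (intro conjI allI impI real_distribution_std_gaussian)
  fix k :: nat assume k: "k \<ge> 1"
  \<comment> \<open>The k-th convolution root is the centred normal law of variance 1/k.\<close>
  define \<sigma> where "\<sigma> = 1 / sqrt (real k)"
  have \<sigma>: "\<sigma> > 0" using k by (simp add: \<sigma>_def)
  let ?\<nu> = "density lborel (\<lambda>x. ennreal (normal_density 0 \<sigma> x))"
  have p: "prob_space ?\<nu>" using \<sigma> by (rule prob_space_normal_density)
  let ?P = "PiM {..<k} (\<lambda>_. ?\<nu>)"
  interpret P: prob_space ?P by (intro prob_space_PiM p)
  have "0 \<in> {..<k}" using k by simp
  then have kne: "{..<k} \<noteq> {}" by blast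
  have m: "(\<lambda>x. x i) \<in> measurable ?P borel" if "i < k" for i
    using measurable_component_singleton[of i "{..<k}" "\<lambda>_. ?\<nu>"] that by (simp cong: measurable_cong_sets)
  have comp: "distr ?P ?\<nu> (\<lambda>x. x i) = ?\<nu>" if "i < k" for i
    by (rule distr_PiM_component) (use p that in auto)
  have ind: "P.indep_vars (\<lambda>_. ?\<nu>) (\<lambda>i x. x i) {..<k}"
    by (rule indep_vars_PiM_components) (use kne p in auto)
  then have ind': "P.indep_vars (\<lambda>_. borel) (\<lambda>i x. x i) {..<k}"
    by (rule P.indep_vars_compose2[where Y = "\<lambda>_ x. x"]) (auto simp: measurable_def)
  have d: "distributed ?P lborel (\<lambda>x. x i) (\<lambda>x. ennreal (normal_density 0 \<sigma> x))" if "i < k" for i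
    unfolding distributed_def
    using comp[OF that] m[OF that] distr_cong[of ?P ?P ?\<nu> lborel "\<lambda>x. x i" "\<lambda>x. x i"] by simp
  have "distributed ?P lborel (\<lambda>x. \<Sum>i<k. x i)
      (\<lambda>x. ennreal (normal_density (\<Sum>i<k. 0) (sqrt (\<Sum>i<k. \<sigma>\<^sup>2)) x))"
    by (rule P.sum_indep_normal) (use kne \<sigma> ind' d in auto)
  moreover have "sqrt (\<Sum>i<k. \<sigma>\<^sup>2) = 1" using k by (simp add: \<sigma>_def power_divide)
  ultimately have "distr ?P lborel (\<lambda>x. \<Sum>i<k. x i) = std_gaussian"
    by (simp add: distributed_def std_gaussian_def)
  moreover have "distr ?P borel (\<lambda>x. \<Sum>i<k. x i) = distr ?P lborel (\<lambda>x. \<Sum>i<k. x i)"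
    by (rule distr_cong) auto
  ultimately have "distr ?P borel (\<lambda>x. \<Sum>i<k. x i) = std_gaussian" by simp
  moreover have "real_distribution ?\<nu>"
    unfolding real_distribution_def real_distribution_axioms_def using p by simp
  ultimately show "\<exists>\<nu>. real_distribution \<nu> \<and> distr (PiM {..<k} (\<lambda>i. \<nu>)) borel (\<lambda>x. \<Sum>i<k. x i) = std_gaussian"
    by blast
qed

text \<open>Shifting the integration variable by Re t completes the square and leaves the
  characteristic function at Im t.\<close>

lemma mgf_std_gaussian:
  "mgf_integrable std_gaussian (\<lambda>x. x) t" "mgf std_gaussian (\<lambda>x. x) t = exp (1/2 * t\<^sup>2)"
proof -
  define a b where "a = Re t" and "b = Im t"
  let ?f = "\<lambda>x. std_normal_density x *\<^sub>R exp (t * complex_of_real x)"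
  let ?g = "\<lambda>x. std_normal_density x *\<^sub>R iexp (b * x)"
  let ?c = "exp (t * of_real a - of_real (a\<^sup>2 / 2))"
  have t: "t = of_real a + \<i> * of_real b" by (simp add: a_def b_def complex_eq)
  have fm: "(\<lambda>x. exp (t * complex_of_real x)) \<in> borel_measurable lborel" by measurable
  have gm: "(\<lambda>x. iexp (b * x)) \<in> borel_measurable lborel" by measurable
  have shift: "?f (a + 1 * x) = ?c * ?g x" for x
  proof -
    have "std_normal_density (a + x) = std_normal_density x * exp (- (a * x) - a\<^sup>2 / 2)"
      by (simp add: std_normal_density_def exp_add[symmetric] power2_sum add_divide_distrib diff_divide_distrib algebra_simps)
    moreover have "complex_of_real (exp (- (a * x) - a\<^sup>2 / 2)) * exp (t * of_real (a + x)) = ?c * iexp (b * x)"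
      unfolding exp_of_real[symmetric] exp_add[symmetric]
      by (rule arg_cong[where f = exp]) (simp add: t algebra_simps power2_eq_square)
    ultimately show ?thesis by (simp add: scaleR_conv_of_real mult_ac)
  qed
  have "integrable std_gaussian (\<lambda>x. iexp (b * x))"
    using prob_space.integrable_iexp[OF prob_space_std_gaussian, of "\<lambda>x. of_real (b * x)"] by simp
  then have gi: "integrable lborel ?g"
    unfolding std_gaussian_def by (subst (asm) integrable_density[OF gm]) auto
  have fi: "integrable lborel ?f"
    by (subst lborel_integrable_real_affine_iff[of 1 _ a, symmetric], simp, simp only: shift, intro integrable_mult_right gi)
  then show "mgf_integrable std_gaussian (\<lambda>x. x) t"
    unfolding mgf_integrable_def std_gaussian_def by (subst integrable_density[OF fm]) auto
  have "mgf std_gaussian (\<lambda>x. x) t = (LINT x|lborel. ?f x)"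
    unfolding mgf_def std_gaussian_def by (rule integral_density[OF fm]) auto
  also have "\<dots> = (LINT x|lborel. ?f (a + 1 * x))"
    using lborel_integral_real_affine[of 1 ?f a] by simp
  also have "\<dots> = ?c * (LINT x|lborel. ?g x)"
    unfolding shift by (rule integral_mult_right_zero)
  also have "(LINT x|lborel. ?g x) = (LINT x|std_gaussian. iexp (b * x))"
    unfolding std_gaussian_def by (rule integral_density[symmetric, OF gm]) auto
  also have "\<dots> = char std_normal_distribution b" by (simp add: char_def std_gaussian_def)
  also have "\<dots> = of_real (exp (- b\<^sup>2 / 2))" by (simp add: char_std_normal_distribution)
  also have "?c * of_real (exp (- b\<^sup>2 / 2)) = exp (1/2 * t\<^sup>2)"
    unfolding exp_of_real[symmetric] exp_add[symmetric]
    by (rule arg_cong[where f = exp]) (simp add: t algebra_simps power2_eq_square field_simps)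
  finally show "mgf std_gaussian (\<lambda>x. x) t = exp (1/2 * t\<^sup>2)" .
qed

theorem proposition4p12:
  fixes M :: "nat \<Rightarrow> 'a measure"
    and X :: "nat \<Rightarrow> nat \<Rightarrow> 'a \<Rightarrow> (nat \<Rightarrow> real)"
    and r :: "nat \<Rightarrow> nat"
    and Y :: "nat \<Rightarrow> 'a \<Rightarrow> real"
  defines "Y \<equiv> \<lambda>n \<omega>. centred_log_volume n (r n) (\<lambda>i. X n i \<omega>)"
  assumes r: "\<And>n. n \<ge> 1 \<Longrightarrow> 1 \<le> r n \<and> r n \<le> n"
    and prob: "\<And>n. n \<ge> 1 \<Longrightarrow> prob_space (M n)"
    and indep: "\<And>n. n \<ge> 1 \<Longrightarrow>
          prob_space.indep_vars (M n) (\<lambda>_. borel_euclid n) (X n) {1..r n + 1}"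
    and gauss: "\<And>n i. n \<ge> 1 \<Longrightarrow> i \<in> {1..r n + 1} \<Longrightarrow>
          distr (M n) (borel_euclid n) (X n i) = std_gaussian_euclid n"
    and codim: "filterlim (\<lambda>n. n - r n) at_top sequentially"
  shows "(\<forall>t::complex.
            (\<lambda>n. mgf (M n) (Y n) t
                   / exp (1/4 * t\<^sup>2 * complex_of_real (ln (real n / real (n - r n)))))
            \<longlonglongrightarrow> 1)
       \<and> ((\<lambda>n. real (n - r n)) \<in> o(\<lambda>n. real n) \<longrightarrow>
            (\<forall>a b. - \<infinity> < a \<and> a < b \<longrightarrow>
               mod_phi_convergent M Y std_gaussian (\<lambda>t. 1/2 * t\<^sup>2)
                 (\<lambda>n. 1/2 * ln (real n / real (n - r n))) (\<lambda>_. 1) a b))"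
proof -
  define R where "R n t = mgf (M n) (Y n) t / exp (1/4 * t\<^sup>2 * complex_of_real (ln (real n / real (n - r n))))" for n t
  have big: "\<forall>\<^sub>F n in sequentially. real (n - r n) \<ge> c" for c
    using filterlim_compose[OF filterlim_real_sequentially codim] by (simp add: filterlim_at_top)
  note mg = mgf_centred_log_volume[OF prob conjunct1[OF r] conjunct2[OF r] indep gauss]
  \<comment> \<open>One threshold on \<open>n\<close> serves all \<open>t\<close> in the disc of
    radius K, which makes the convergence uniform there. The requirement n - r >= 2K also keeps
    these \<open>t\<close> inside the domain of the moment generating function.\<close>
  have Rbound: "\<forall>\<^sub>F n in sequentially. \<forall>t. norm t \<le> K \<longrightarrow> norm (R n t - 1) \<le> exp (C / real (n - r n)) - 1"
    if C: "C = 16 * (2 * K ^ 3 + 2 * K + K * (K + 1)) + 3 * K + 2 * K * (K + 1)" and K: "K \<ge> 0" for K C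
    using big[of "max 4 (2 * K)"] eventually_ge_at_top[of 1]
  proof eventually_elim
    case (elim n)
    define m where "m = n - r n"
    have m: "m \<ge> 4" "real m \<ge> 2 * K" "m \<le> n" using elim(1) by (auto simp: m_def)
    have C0: "C \<ge> 0" using K by (simp add: C)
    show ?case
    proof (intro allI impI)
      fix t :: complex assume t: "norm t \<le> K"
      obtain h where h: "norm h \<le> C * (1 / real m - 1 / real n)"
        "(\<Prod>k\<in>{m<..n}. chi_moment (t / 2) k) = exp (log_norming t n - log_norming t m + h)"
        using prod_chi_moment_asymptotics[OF t m] by (auto simp: C)
      have "\<bar>Re t\<bar> \<le> K" using abs_Re_le_cmod[of t] t by simp
      then have "Re t + real (n - r n) + 1 > 0" using m K by (simp add: m_def)
      from mg(3)[OF elim(2) elim(2) elim(2) elim(2) elim(2) _ this]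
      have "mgf (M n) (Y n) t
        = exp (- t * of_real (m_seq n - m_seq m + 1/2 * ln ((real (r n) + 1) * real m / real n)))
         * exp (t / 2 * of_real (ln (real (r n) + 1))) * exp (log_norming t n - log_norming t m + h)"
        by (simp add: Y_def m_def h(2)[unfolded m_def])
      then have "R n t = exp (- t * of_real (m_seq n - m_seq m + 1/2 * ln ((real (r n) + 1) * real m / real n))
         + t / 2 * of_real (ln (real (r n) + 1)) + (log_norming t n - log_norming t m + h)
         - 1/4 * t\<^sup>2 * of_real (ln (real n / real m)))"
        by (simp only: R_def m_def exp_add exp_diff)
      \<comment> \<open>The logarithms of r + 1 and the \<open>m_seq\<close> terms cancel; the -t/2
        part of \<open>log_norming\<close> meets the ln (m/n) of the centring, and the t^2/4 part
        meets the Gaussian exponent. Only the error \<open>h\<close> is left.\<close>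
      also have "- t * of_real (m_seq n - m_seq m + 1/2 * ln ((real (r n) + 1) * real m / real n))
         + t / 2 * of_real (ln (real (r n) + 1)) + (log_norming t n - log_norming t m + h)
         - 1/4 * t\<^sup>2 * of_real (ln (real n / real m)) = h"
      proof -
        have l: "ln ((real (r n) + 1) * real m / real n) = ln (real (r n) + 1) + ln (real m) - ln (real n)"
          "ln (real n / real m) = ln (real n) - ln (real m)"
          using m elim(2) by (simp_all add: ln_mult ln_div)
        show ?thesis unfolding log_norming_def l by (simp add: field_simps)
      qed
      finally have "norm (R n t - 1) \<le> exp (norm h) - 1" by (simp add: norm_exp_minus_one_le)
      also have "norm h \<le> C / real m"
      proof -
        have "C * (1 / real n) \<ge> 0" using C0 by simp
        then show ?thesis using h(1) by (simp add: right_diff_distrib)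
      qed
      finally show "norm (R n t - 1) \<le> exp (C / real (n - r n)) - 1" by (simp add: m_def)
    qed
  qed
  have lim0: "(\<lambda>n. exp (C / real (n - r n)) - 1) \<longlonglongrightarrow> 0" for C
  proof -
    have "(\<lambda>n. C / real (n - r n)) \<longlonglongrightarrow> 0"
      by (rule filterlim_compose[OF lim_const_over_n codim])
    then have "(\<lambda>n. exp (C / real (n - r n)) - 1) \<longlonglongrightarrow> exp 0 - 1" by (intro tendsto_intros)
    then show ?thesis by simp
  qed
  have unif: "uniform_limit (cball 0 K) R (\<lambda>_. 1) sequentially" if "K \<ge> 0" for K
  proof (rule uniform_limitI)
    fix e :: real assume "e > 0"
    define C where "C = 16 * (2 * K ^ 3 + 2 * K + K * (K + 1)) + 3 * K + 2 * K * (K + 1)"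
    have "\<forall>\<^sub>F n in sequentially. exp (C / real (n - r n)) - 1 < e"
      using lim0[of C] \<open>e > 0\<close> by (rule order_tendstoD)
    with Rbound[OF C_def that] show "\<forall>\<^sub>F n in sequentially. \<forall>t\<in>cball 0 K. dist (R n t) 1 < e"
      by eventually_elim (force simp: dist_norm)
  qed
  have "(\<lambda>n. R n t) \<longlonglongrightarrow> 1" for t
    using tendsto_uniform_limitI[OF unif[of "norm t"], of t] by simp
  moreover have "mod_phi_convergent M Y std_gaussian (\<lambda>t. 1/2 * t\<^sup>2)
      (\<lambda>n. 1/2 * ln (real n / real (n - r n))) (\<lambda>_. 1) a b"
    if o: "(\<lambda>n. real (n - r n)) \<in> o(\<lambda>n. real n)" and ab: "- \<infinity> < a" "a < b" for a b
    unfolding mod_phi_convergent_def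
  proof (intro conjI ballI)
    show "a < b" by fact
    \<comment> \<open>The left edge of the strip is finite, while the right one may be infinite.
      Once n - r is at least -A, the whole strip satisfies Re t + (n - r) + 1 > 0.\<close>
    obtain A where A: "a = ereal A" using ab by (cases a) auto
    show "\<forall>\<^sub>F n in sequentially. prob_space (M n) \<and> Y n \<in> borel_measurable (M n)
          \<and> (\<forall>t\<in>strip a b. mgf_integrable (M n) (Y n) t)"
      using big[of "- A"] eventually_ge_at_top[of 1]
    proof eventually_elim
      case (elim n)
      have "Re t + real (n - r n) + 1 > 0" if "t \<in> strip a b" for t
        using that elim(1) by (simp add: strip_def A)
      then show ?case
        using mg(1)[OF elim(2) elim(2) elim(2) elim(2) elim(2)] mg(2)[OF elim(2) elim(2) elim(2) elim(2) elim(2)]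
          prob[OF elim(2)] unfolding Y_def by blast
    qed
    show "infinitely_divisible std_gaussian" by (rule infinitely_divisible_std_gaussian)
    show "mgf_integrable std_gaussian (\<lambda>x. x) t" "mgf std_gaussian (\<lambda>x. x) t = exp (1/2 * t\<^sup>2)" for t
      by (rule mgf_std_gaussian)+
    show "filterlim (\<lambda>n. 1/2 * ln (real n / real (n - r n))) at_top sequentially"
    proof -
      have "(\<lambda>n. real (n - r n) / real n) \<longlonglongrightarrow> 0" using o by (rule smalloD_tendsto)
      moreover have "\<forall>\<^sub>F n in sequentially. real (n - r n) / real n > 0"
        using big[of 1] eventually_ge_at_top[of 1] by eventually_elim simp
      ultimately have "filterlim (\<lambda>n. real (n - r n) / real n) (at_right 0) sequentially"
        by (rule tendsto_imp_filterlim_at_right)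
      then have "filterlim (\<lambda>n. inverse (real (n - r n) / real n)) at_top sequentially"
        by (rule filterlim_compose[OF filterlim_inverse_at_top_right])
      then have "filterlim (\<lambda>n. ln (inverse (real (n - r n) / real n))) at_top sequentially"
        by (rule filterlim_compose[OF ln_at_top])
      then have "filterlim (\<lambda>n. ln (real n / real (n - r n))) at_top sequentially" by (simp only: inverse_divide)
      then show ?thesis
        by (intro filterlim_tendsto_pos_mult_at_top[OF tendsto_const]) auto
    qed
    show "(\<lambda>_. 1) analytic_on strip a b" by (rule analytic_on_const)
    fix s assume s: "s \<in> strip a b"
    have "open (strip a b)"
    proof -
      have "strip a b = (\<lambda>t. ereal (Re t)) -` {a<..<b}" by (auto simp: strip_def)
      then show ?thesis by (simp only:) (intro open_vimage continuous_intros open_greaterThanLessThan)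
    qed
    \<comment> \<open>The strip is unbounded, while the estimate is uniform on discs; intersecting
      with a disc around 0 that contains \<open>s\<close> gives the neighbourhood.\<close>
    define U where "U = strip a b \<inter> ball 0 (norm s + 1)"
    have "uniform_limit U R (\<lambda>_. 1) sequentially"
      by (rule uniform_limit_on_subset[OF unif[of "norm s + 1"]]) (auto simp: U_def)
    moreover have "(\<lambda>n t. mgf (M n) (Y n) t / exp (complex_of_real (1/2 * ln (real n / real (n - r n))) * (1/2 * t\<^sup>2))) = R"
      by (auto simp: R_def fun_eq_iff mult_ac)
    ultimately show "\<exists>U. open U \<and> s \<in> U \<and> U \<subseteq> strip a b \<and>
          uniform_limit U (\<lambda>n t. mgf (M n) (Y n) t / exp (complex_of_real (1/2 * ln (real n / real (n - r n))) * (1/2 * t\<^sup>2)))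
            (\<lambda>_. 1) sequentially"
      using s \<open>open (strip a b)\<close> by (intro exI[of _ U]) (auto simp: U_def open_Int)
  qed
  ultimately show ?thesis unfolding R_def by blast
qed

end
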